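(* Fix $1<p\leq q<\infty$, $0\leq \alpha<1$ and $L>0$, and let $p'=p/(p-1)$. (a) Let $(X,\mu)$ be a probability space equipped with a tree $\mathcal{T}$, and suppose that $u$, $v$ are two weights on $(X,\mu)$, with $v^{1-p'}$ also a weight, such that $$\left(\int_Q \big(\mathcal{M}^\alpha_{\mathcal{T}}(\chi_Q v^{1-p'})\big)^q u\,d\mu\right)^{1/q}\leq L\left(\int_Q v^{1-p'}\,d\mu\right)^{1/p}\qquad\text{for every } Q\in\mathcal{T}. \quad (\ast)$$ Then $$\|\mathcal{M}^\alpha_{\mathcal{T}}\|_{L^p(v)\to L^q(u)}\leq C_{p,q}L.$$ (b) If $\alpha\geq 1/p-1/q$, then the constant $C_{p,q}$ is the best possible: for any $c<C_{p,q}L$ there exist a probability space $(X,\mu)$ with a tree $\mathcal{T}$ and a pair $(u,v)$ of weights on $(X,\mu)$, with $v^{1-p'}$ also a weight, satisfying the testing condition $(\ast)$, for which $\|\mathcal{M}^\alpha_{\mathcal{T}}\|_{L^p(v)\to L^q(u)}>c$.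
   Context: Tree: given a probability space $(X,\mu)$, a set $\mathcal{T}$ of measurable subsets of $X$ is called a tree if: (i) $X\in\mathcal{T}$ and $\mu(Q)>0$ for every $Q\in\mathcal{T}$; (ii) for every $Q\in\mathcal{T}$ there is a finite subset $C(Q)\subset\mathcal{T}$ containing at least two elements, such that the elements of $C(Q)$ are pairwise disjoint subsets of $Q$ and $Q=\bigcup C(Q)$; (iii) $\mathcal{T}=\bigcup_{m\geq 0}\mathcal{T}^m$, where $\mathcal{T}^0=\{X\}$ and $\mathcal{T}^{m+1}=\bigcup_{Q\in\mathcal{T}^m}C(Q)$. The space is not assumed nonatomic, and it is not assumed that $\sup_{Q\in\mathcal{T}^m}\mu(Q)\to 0$. Fractional maximal operator: for $0\le\alpha<1$ and integrable $f:X\to\mathbb{R}$, $$\mathcal{M}^\alpha_{\mathcal{T}}f(x)=\sup\left\{\mu(Q)^{\alpha}\,\frac{1}{\mu(Q)}\int_Q|f|\,d\mu \,:\, x\in Q,\ Q\in\mathcal{T}\right\}.$$ A weight is a positive, $\mu$-integrable random variable $w$ on $X$. $L^p(w)$ is the space of measurable $f:X\to\mathbb{R}$ with $\|f\|_{L^p(w)}=\left(\int_X|f|^pw\,d\mu\right)^{1/p}<\infty$, and $\|\mathcal{M}^\alpha_{\mathcal{T}}\|_{L^p(v)\to L^q(u)}$ is the smallest $K\in[0,\infty]$ such that $\|\mathcal{M}^\alpha_{\mathcal{T}}f\|_{L^q(u)}\le K\|f\|_{L^p(v)}$ for all $f\in L^p(v)$. $\chi_Q$ is the characteristic function of $Q$.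 The constant: for $1<p<q<\infty$, $$C_{p,q}=(p-1)^{-1/q}\left[\frac{\Gamma(pq/(q-p))}{\Gamma(q/(q-p))\,\Gamma(p(q-1)/(q-p))}\right]^{1/p-1/q},$$ where $\Gamma$ is the Euler Gamma function, and $C_{p,p}=p/(p-1)$. *)

theory Defs
  imports "HOL-Analysis.Analysis" "HOL-Probability.Probability_Measure"
begin

primrec tree_level :: "('a set \<Rightarrow> 'a set set) \<Rightarrow> 'a set \<Rightarrow> nat \<Rightarrow> 'a set set" where
  "tree_level C X 0 = {X}"
| "tree_level C X (Suc m) = (\<Union>Q\<in>tree_level C X m. C Q)"

text \<open>The children map \<open>C\<close> is not part of the data of a tree; one such map has to exist.\<close>

definition is_tree :: "'a measure \<Rightarrow> 'a set set \<Rightarrow> bool" where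
  "is_tree M T \<longleftrightarrow>
     T \<subseteq> sets M \<and>
     space M \<in> T \<and> (\<forall>Q\<in>T. 0 < measure M Q) \<and>
     (\<exists>C. (\<forall>Q\<in>T. C Q \<subseteq> T \<and> finite (C Q) \<and> 2 \<le> card (C Q) \<and>
                 disjoint (C Q) \<and> (\<forall>R\<in>C Q. R \<subseteq> Q) \<and> Q = \<Union> (C Q)) \<and>
          T = (\<Union>m. tree_level C (space M) m))"

text \<open>Real powers of elements of \<open>[0, \<infinity>]\<close>, meant for a positive exponent \<open>r\<close>.\<close>

definition ennpowr :: "ennreal \<Rightarrow> real \<Rightarrow> ennreal" where
  "ennpowr x r = (if x = \<infinity> then \<infinity> else ennreal (enn2real x powr r))"

text \<open>The maximal function takes values in \<open>[0, \<infinity>]\<close>: the tree is infinite, so the supremum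
  can be infinite even for integrable \<open>f\<close>.\<close>

definition frac_max :: "'a measure \<Rightarrow> 'a set set \<Rightarrow> real \<Rightarrow> ('a \<Rightarrow> real) \<Rightarrow> 'a \<Rightarrow> ennreal" where
  "frac_max M T \<alpha> f x =
     (SUP Q\<in>{Q \<in> T. x \<in> Q}.
        ennreal (measure M Q powr \<alpha> * (1 / measure M Q)) * (\<integral>\<^sup>+y\<in>Q. ennreal \<bar>f y\<bar> \<partial>M))"

definition weight :: "'a measure \<Rightarrow> ('a \<Rightarrow> real) \<Rightarrow> bool" where
  "weight M w \<longleftrightarrow> integrable M w \<and> (\<forall>x\<in>space M. 0 < w x)"

text \<open>The weighted norm is defined on \<open>[0, \<infinity>]\<close>-valued functions, so that it applies both to
  \<open>\<bar>f\<bar>\<close> and to the maximal function of \<open>f\<close>.\<close>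

definition wnorm :: "'a measure \<Rightarrow> ('a \<Rightarrow> real) \<Rightarrow> real \<Rightarrow> ('a \<Rightarrow> ennreal) \<Rightarrow> ennreal" where
  "wnorm M w r g = ennpowr (\<integral>\<^sup>+x. ennpowr (g x) r * ennreal (w x) \<partial>M) (1 / r)"

definition wLp :: "'a measure \<Rightarrow> ('a \<Rightarrow> real) \<Rightarrow> real \<Rightarrow> ('a \<Rightarrow> real) set" where
  "wLp M w p = {f \<in> borel_measurable M. wnorm M w p (\<lambda>x. ennreal \<bar>f x\<bar>) < \<infinity>}"

definition frac_max_norm ::
    "'a measure \<Rightarrow> 'a set set \<Rightarrow> real \<Rightarrow> real \<Rightarrow> ('a \<Rightarrow> real) \<Rightarrow> real \<Rightarrow> ('a \<Rightarrow> real) \<Rightarrow> ennreal" where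
  "frac_max_norm M T \<alpha> p v q u =
     Inf {K. \<forall>f\<in>wLp M v p.
              wnorm M u q (frac_max M T \<alpha> f) \<le> K * wnorm M v p (\<lambda>x. ennreal \<bar>f x\<bar>)}"

definition conj_exp :: "real \<Rightarrow> real" where
  "conj_exp p = p / (p - 1)"

definition testing_condition ::
    "'a measure \<Rightarrow> 'a set set \<Rightarrow> real \<Rightarrow> real \<Rightarrow> real \<Rightarrow> real \<Rightarrow> ('a \<Rightarrow> real) \<Rightarrow> ('a \<Rightarrow> real) \<Rightarrow> bool" where
  "testing_condition M T \<alpha> p q L u v \<longleftrightarrow>
     (\<forall>Q\<in>T.
        ennpowr (\<integral>\<^sup>+x\<in>Q. (ennpowr (frac_max M T \<alpha> (\<lambda>y. indicator Q y * v y powr (1 - conj_exp p)) x) q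
                  * ennreal (u x)) \<partial>M) (1 / q)
        \<le> ennreal L * ennpowr (\<integral>\<^sup>+x\<in>Q. ennreal (v x powr (1 - conj_exp p)) \<partial>M) (1 / p))"

definition C_const :: "real \<Rightarrow> real \<Rightarrow> real" where
  "C_const p q =
     (if p = q then p / (p - 1)
      else (p - 1) powr (- 1 / q) *
        (Gamma (p * q / (q - p)) /
          (Gamma (q / (q - p)) * Gamma (p * (q - 1) / (q - p)))) powr (1 / p - 1 / q))"

end

theory Submission
  imports Defs
begin

text \<open>
  Put \<open>\<sigma> = v\<^bsup>1-p'\<^esup>\<close> and \<open>f = g \<sigma>\<close>. Then the norm of \<open>f\<close> in \<open>L\<^sup>p(v)\<close> is that of \<open>g\<close> in \<open>L\<^sup>p(\<sigma>)\<close>,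
  and the quantity attached to a tree set factors as \<open>b\<^sub>Q A\<^sub>Q\<close>, where \<open>A\<^sub>Q\<close> is the \<open>\<sigma>\<close>-average of \<open>\<bar>g\<bar>\<close>
  over \<open>Q\<close> and \<open>b\<^sub>Q = \<mu>(Q)\<^bsup>\<alpha>-1\<^esup> \<sigma>(Q)\<close> does not see \<open>f\<close>.

  Upper bound. Slicing in the values of \<open>A\<^sub>Q\<close> gives
  \<open>sup b\<^sub>Q\<^sup>q A\<^sub>Q\<^sup>q \<le> \<integral> q t\<^bsup>q-1\<^esup> sup {b\<^sub>Q\<^sup>q : A\<^sub>Q > t} dt\<close>. For fixed \<open>t\<close> the sets with \<open>A\<^sub>Q > t\<close> lie in
  disjoint maximal ones \<open>R\<close>. On \<open>R\<close> the inner supremum is controlled by the maximal function of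
  \<open>\<chi>\<^sub>R \<sigma>\<close>, so the testing condition bounds its \<open>u\<close>-integral by \<open>L\<^sup>q \<Sum> \<sigma>(R)\<^bsup>q/p\<^esup>\<close>, and this is at most
  \<open>L\<^sup>q s(t)\<^bsup>q/p\<^esup>\<close> with \<open>s(t)\<close> the \<open>\<sigma>\<close>-measure of the union, because \<open>q \<ge> p\<close>
  (\<open>frac_max_sublevel_testing\<close>). As \<open>t \<sigma>(R) \<le> \<integral>\<^sub>R \<bar>g\<bar> d\<sigma>\<close> on every \<open>R\<close>, also \<open>t s(t) \<le> \<integral>\<^sub>0\<^bsup>s(t)\<^esup> G\<close> for
  the decreasing rearrangement \<open>G\<close> of \<open>\<bar>g\<bar>\<close>. Integration in \<open>t\<close> (\<open>layer_integral_le_average\<close>)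
  leaves a problem on the half-line: to bound
  \<open>\<integral> (q/p) x\<^bsup>q/p-1\<^esup> ((1/x) \<integral>\<^sub>0\<^sup>x G)\<^sup>q dx\<close> by \<open>(\<integral> G\<^sup>p)\<^bsup>q/p\<^esup>\<close>. This is Hardy's inequality for \<open>p = q\<close> and
  Bliss's inequality for \<open>p < q\<close>, and \<open>C\<^sub>p\<^sub>,\<^sub>q\<^sup>q\<close> is the best constant in it (\<open>bliss_inequality\<close>).

  Bliss's inequality. With \<open>r = q/p - 1\<close> the extremal primitive is \<open>x (1 + x\<^sup>r)\<^bsup>-1/r\<^esup>\<close>. An arbitrary
  primitive \<open>F\<close> is compared with it through the map \<open>T\<close> that transports the measure
  \<open>(F/x)\<^sup>q x\<^sup>r dx\<close> to the corresponding measure of the extremal. A boundary term built from \<open>F\<close>, \<open>x\<close>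
  and \<open>T\<close> has a derivative that Young's inequality and the weighted inequality between the
  arithmetic and the geometric mean estimate pointwise, with equality for the extremal
  (\<open>bliss_transport_pointwise\<close>); integration shows that \<open>F\<close> has at least the energy of the
  extremal of the same mass (\<open>bliss_transport\<close>). The energy of the extremal is a Beta integral,
  which is where the Gamma functions come from.

  Sharpness. Take the dyadic tree of \<open>(0,1]\<close> and split the interval into the rings
  \<open>(2\<^bsup>-k-1\<^esup>, 2\<^bsup>-k\<^esup>]\<close>. The density of \<open>\<sigma>\<close> is constant on rings and gives the corner \<open>(0, 2\<^bsup>-k\<^esup>]\<close> the mass
  \<open>t\<^sup>k\<close>, with \<open>t\<close> close to 1. Then \<open>b\<^sub>Q\<close> grows along shrinking corners, so that on a ring the maximal
  function of \<open>\<sigma>\<close> is the value \<open>b\<^sub>Q\<close> of the smallest corner containing the ring, and \<open>u\<close> can be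
  chosen such that the testing condition is an equality on all corners. On dyadic sets inside
  one ring it holds because of \<open>\<alpha> \<ge> 1/p - 1/q\<close> (\<open>ring_inequality\<close>). Sampling a nearly extremal
  function of the inequality on the half-line at the points \<open>t\<^sup>k\<close> loses only a power of \<open>t\<close>
  (\<open>near_extremal_discrete\<close>), and \<open>t \<rightarrow> 1\<close> recovers the constant \<open>C\<^sub>p\<^sub>,\<^sub>q L\<close>.
\<close>

section \<open>The extremal profile of Bliss's inequality\<close>

text \<open>
  Primitives of monotone functions are differentiable only off a countable set, so this is the
  form of the monotonicity criterion that they need. If \<open>f b < f a\<close>, a small linear term keeps the
  inequality strict for a function \<open>h\<close> whose derivatives are positive, and \<open>h\<close> has to cross every
  level between \<open>h b\<close> and \<open>h a\<close> downwards. Countably many exceptional points cannot serve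
  uncountably many levels.
\<close>
lemma nondecreasing_if_deriv_nonneg_off_countable:
  fixes f :: "real \<Rightarrow> real"
  assumes cont: "continuous_on {a..b} f" and "countable S" and "a \<le> b"
    and der: "\<And>x. a < x \<Longrightarrow> x < b \<Longrightarrow> x \<notin> S \<Longrightarrow> \<exists>D\<ge>0. (f has_real_derivative D) (at x)"
  shows "f a \<le> f b"
proof (rule ccontr)
  assume "\<not> f a \<le> f b"
  then have lt: "f b < f a" by simp
  with \<open>a \<le> b\<close> have "a < b" by (cases "a = b") auto
  define e where "e = (f a - f b) / (2 * (b - a))"
  have e: "e > 0" using lt \<open>a < b\<close> by (simp add: e_def)
  define h where "h x = f x + e * (x - a)" for x
  have ee: "e * (b - a) = (f a - f b) / 2"
    using \<open>a < b\<close> by (simp add: e_def field_simps)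
  have hlt: "h b < h a"
    using ee lt by (simp add: h_def)
  have conth: "continuous_on {a..b} h"
    unfolding h_def by (intro continuous_intros cont)
  \<comment> \<open>a level that \<open>h\<close> does not take on the exceptional set\<close>
  have "uncountable {h b<..<h a}" using hlt uncountable_open_interval by blast
  moreover have "countable (h ` S)" using \<open>countable S\<close> by simp
  ultimately obtain c where c: "h b < c" "c < h a" "c \<notin> h ` S"
    by (metis countable_subset greaterThanLessThan_iff subsetI)
  define K where "K = {x \<in> {a..b}. h x \<ge> c}"
  have "closed K"
    unfolding K_def by (rule continuous_closed_preimage[OF conth, of "{c..}", unfolded vimage_def, simplified, THEN back_subst[of closed]]) auto
  have "a \<in> K" using c \<open>a < b\<close> by (simp add: K_def)
  have bdd: "bdd_above K" by (auto simp: K_def bdd_above_def)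
  define x where "x = Sup K"
  have "x \<in> K"
    unfolding x_def using \<open>closed K\<close> \<open>a \<in> K\<close> bdd closed_contains_Sup by blast
  then have x: "a \<le> x" "x \<le> b" "h x \<ge> c" by (auto simp: K_def)
  have "x \<noteq> b" using x c by auto
  then have "x < b" using x by simp
  have above: "h y < c" if "x < y" "y \<le> b" for y
  proof (rule ccontr)
    assume "\<not> h y < c"
    then have "y \<in> K" using that x by (auto simp: K_def)
    then have "y \<le> x" unfolding x_def using bdd cSup_upper by blast
    then show False using that by simp
  qed
  have "h x = c"
  proof (rule ccontr)
    assume "h x \<noteq> c"
    then have "h x > c" using x by simp
    have "continuous_on {x..b} h" using conth x by (auto intro: continuous_on_subset)
    then obtain y where "x \<le> y" "y \<le> b" "h y = c"
      using IVT2'[of h b c x] c x by auto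
    then show False using above[of y] \<open>h x > c\<close> by (cases "x = y") auto
  qed
  have "x \<noteq> a" using \<open>h x = c\<close> c by auto
  have "x \<notin> S" using \<open>h x = c\<close> c by auto
  then obtain D where D: "D \<ge> 0" "(f has_real_derivative D) (at x)"
    using der[of x] x \<open>x \<noteq> a\<close> \<open>x < b\<close> by auto
  have "(h has_real_derivative D + e) (at x)"
    unfolding h_def by (auto intro!: derivative_eq_intros D(2))
  then obtain d where d: "d > 0" "\<And>t. 0 < t \<Longrightarrow> t < d \<Longrightarrow> h x < h (x + t)"
    using DERIV_pos_inc_right[of h "D + e" x] D e by auto
  define t where "t = min (d / 2) (b - x)"
  have "0 < t" "t < d" "x + t \<le> b" using d \<open>x < b\<close> by (auto simp: t_def)
  then show False using d(2)[of t] above[of "x + t"] \<open>h x = c\<close> by auto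
qed

text \<open>
  The heart of the transport argument. Read \<open>F\<close> as the value of the primitive at \<open>x\<close>, \<open>g\<close> as its
  slope, \<open>T\<close> as the image of \<open>x\<close> under the transport map, \<open>h\<close> as the average of the extremal at \<open>T\<close>,
  and \<open>T'\<close> as the derivative of the transport map. Then the left-hand side is the derivative of the
  boundary term \<open>P\<close>. It splits into \<open>g \<psi>\<close>, to which Young's inequality applies, and a
  negative multiple of \<open>(q - r) / x + r T' / T\<close>, to which the inequality between the weighted means
  applies. The exponents in \<open>P\<close> are such that, apart from
  \<open>g powr p / p\<close>, the two results depend on \<open>T'\<close> and \<open>h\<close> alone. For the
  extremal itself (\<open>T = x\<close>, \<open>T' = 1\<close>) both steps are equalities.
\<close>

lemma bliss_transport_pointwise:
  fixes p q r k F g x T h :: real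
  assumes p: "1 < p" and q: "p < q" and r: "r = q / p - 1" and k: "k = 1 - 1 / p"
    and pos: "0 < F" "0 \<le> g" "0 < x" "0 < T" "0 < h"
  defines "P \<equiv> F powr (q - r) * x powr (- (q - r) * k) * T powr (- r * k) / (q - r)"
    and "T' \<equiv> (F / x / h) powr q * (x / T) powr r"
  shows "P * ((q - r) * g / F - (q - r) * k / x - r * k * T' / T)
           \<le> g powr p / p + T' * (k * h powr q - k * q / (q - r) * h powr (q - r))"
proof -
  have p0: "p > 0" and k0: "k > 0" and r0: "r > 0" unfolding r k using p q by (auto simp: field_simps)
  have qk: "q * k = q - r - 1" using p by (simp add: r k field_simps)
  have qr: "q - r > 1" using qk k0 p q by (smt (verit) mult_pos_pos)
  \<comment> \<open>in logarithms, the identities between powers become linear identities between exponents\<close>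
  define lF lx lT lh where l: "lF = ln F" "lx = ln x" "lT = ln T" "lh = ln h"
  have e: "F = exp lF" "x = exp lx" "T = exp lT" "h = exp lh" using pos by (auto simp: l)
  have eP: "P = exp ((q - r) * lF - (q - r) * k * lx - r * k * lT) / (q - r)"
    by (simp add: P_def e exp_powr_real exp_add[symmetric] exp_diff[symmetric] algebra_simps)
  have eT: "T' = exp (q * (lF - lx - lh) + r * (lx - lT))"
    by (simp add: T'_def e exp_powr_real exp_add[symmetric] exp_diff[symmetric] algebra_simps)
  have T'0: "T' > 0" by (simp add: eT)
  have P0: "P > 0" using qr by (simp add: eP)
  define \<psi> where "\<psi> = (q - r) * P / F"
  have epsi: "\<psi> = exp ((q - r - 1) * lF - (q - r) * k * lx - r * k * lT)"
  proof -
    have "\<psi> = exp ((q - r) * lF - (q - r) * k * lx - r * k * lT) / exp lF"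
      using qr by (simp add: \<psi>_def eP e)
    also have "\<dots> = exp ((q - r) * lF - (q - r) * k * lx - r * k * lT - lF)"
      by (simp only: exp_diff)
    finally show ?thesis by (simp add: algebra_simps)
  qed
  have psik: "\<psi> powr (1 / k) = T' * h powr q"
  proof -
    have "((q - r - 1) * lF - (q - r) * k * lx - r * k * lT) * (1 / k) = q * lF - (q - r) * lx - r * lT"
      unfolding qk[symmetric] using k0 by (simp add: field_simps)
    moreover have "T' * h powr q = exp (q * lF - (q - r) * lx - r * lT)"
      by (simp add: eT e exp_powr_real exp_add[symmetric] algebra_simps)
    ultimately show ?thesis by (simp add: epsi exp_powr_real)
  qed
  have "k < 1" using k p by simp
  then have k1: "1 / k > 1" using k0 by (simp add: field_simps)
  have "g * \<psi> \<le> g powr p / p + \<psi> powr (1 / k) / (1 / k)"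
    using k pos by (intro Youngs_inequality p k1) (auto simp: epsi)
  then have young: "g * \<psi> \<le> g powr p / p + k * (T' * h powr q)"
    by (simp add: psik mult.commute)
  have "(1 / x) powr ((q - r) / q) * (T' / T) powr (r / q) \<le> (q - r) / q * (1 / x) + r / q * (T' / T)"
    by (rule Youngs_inequality_0) (use pos T'0 qr r0 q p in \<open>auto simp: field_simps\<close>)
  then have "q * ((1 / x) powr ((q - r) / q) * (T' / T) powr (r / q)) \<le> q * ((q - r) / q * (1 / x) + r / q * (T' / T))"
    using p q by (intro mult_left_mono) auto
  also have "\<dots> = (q - r) / x + r * T' / T" using p q by (simp add: distrib_left)
  finally have am: "q * ((1 / x) powr ((q - r) / q) * (T' / T) powr (r / q)) \<le> (q - r) / x + r * T' / T" .
  have "k * P * (q * ((1 / x) powr ((q - r) / q) * (T' / T) powr (r / q))) = k * q / (q - r) * (T' * h powr (q - r))"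
  proof -
    have q0: "q > 0" using p q by simp
    have q2: "q * k * z = (q - r - 1) * z" for z using qk by simp
    have ka: "k = (q - r - 1) / q" using qk q0 by (simp add: field_simps)
    define L1 L2 L3 R where L: "L1 = (q - r) * lF - (q - r) * k * lx - r * k * lT" "L2 = (- lx) * ((q - r) / q)"
      "L3 = (q * (lF - lx - lh) + r * (lx - lT) - lT) * (r / q)"
      "R = q * (lF - lx - lh) + r * (lx - lT) + lh * (q - r)"
    have "L1 + (L2 + L3) = R"
      unfolding L ka using q0 by (simp add: field_simps)
    then have "exp L1 * (exp L2 * exp L3) = exp R" by (simp only: exp_add[symmetric])
    moreover have "(1 / x) powr ((q - r) / q) = exp L2"
      unfolding L by (simp add: e exp_minus[symmetric] inverse_eq_divide[symmetric] exp_powr_real)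
    moreover have "(T' / T) powr (r / q) = exp L3"
      unfolding L by (simp add: eT e exp_diff[symmetric] exp_powr_real)
    moreover have "T' * h powr (q - r) = exp R"
      unfolding L by (simp add: eT e exp_powr_real exp_add)
    moreover have "P = exp L1 / (q - r)" by (simp add: eP L)
    ultimately show ?thesis by simp
  qed
  then have am2: "k * q / (q - r) * (T' * h powr (q - r)) \<le> k * P * ((q - r) / x + r * T' / T)"
    using am k0 P0 by (metis mult_left_mono less_imp_le mult_pos_pos)
  have "P * ((q - r) * g / F - (q - r) * k / x - r * k * T' / T) = g * \<psi> - k * P * ((q - r) / x + r * T' / T)"
    by (simp add: \<psi>_def algebra_simps)
  also have "\<dots> \<le> g powr p / p + k * (T' * h powr q) - k * q / (q - r) * (T' * h powr (q - r))"
    using young am2 by simp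
  also have "\<dots> = g powr p / p + T' * (k * h powr q - k * q / (q - r) * h powr (q - r))"
    by (simp add: algebra_simps)
  finally show ?thesis .
qed

text \<open>
  The extremal primitive is \<open>y * bliss_avg r y\<close>. Its slope is \<open>bliss_avg r y powr (1 + r)\<close>, whose
  \<open>p\<close>-th power is \<open>bliss_avg r y powr q\<close> if \<open>r = q / p - 1\<close>; energy and mass below are the two
  integrals in Bliss's inequality for the extremal, truncated at \<open>y\<close>.
\<close>

definition bliss_avg :: "real \<Rightarrow> real \<Rightarrow> real" where
  "bliss_avg r y = (1 + y powr r) powr (- 1 / r)"

definition bliss_energy :: "real \<Rightarrow> real \<Rightarrow> real \<Rightarrow> real" where
  "bliss_energy q r y = integral {0..y} (\<lambda>s. bliss_avg r s powr q)"

definition bliss_mass :: "real \<Rightarrow> real \<Rightarrow> real \<Rightarrow> real" where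
  "bliss_mass q r y = integral {0..y} (\<lambda>s. bliss_avg r s powr q * s powr r)"

lemma one_plus_powr_pos [simp]: "0 < 1 + (y::real) powr r" "1 + (y::real) powr r \<noteq> 0"
  using powr_ge_zero[of y r] by linarith+

lemma bliss_avg_powr: "bliss_avg r y powr c = (1 + y powr r) powr (- c / r)"
  by (simp add: bliss_avg_def powr_powr)

lemma bliss_avg_pos: "0 < bliss_avg r y"
  by (simp add: bliss_avg_def)

lemma bliss_avg_le_1: "0 < r \<Longrightarrow> bliss_avg r y \<le> 1"
  unfolding bliss_avg_def using powr_mono2'[of "- 1 / r" 1 "1 + y powr r"] by simp

lemma continuous_on_powr_nonneg: "0 < r \<Longrightarrow> continuous_on {0..} (\<lambda>s::real. s powr r)"
  by (intro continuous_on_powr') (auto intro!: continuous_intros)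

lemma continuous_on_bliss_avg: "0 < r \<Longrightarrow> continuous_on {0..} (bliss_avg r)"
  unfolding bliss_avg_def
  by (intro continuous_intros continuous_on_powr_nonneg) auto

lemma continuous_on_bliss_avg_powr: "0 < r \<Longrightarrow> continuous_on {0..y} (\<lambda>s. bliss_avg r s powr c)"
  using bliss_avg_pos[of r]
  by (intro continuous_intros continuous_on_subset[OF continuous_on_bliss_avg]) (auto simp: less_imp_neq[symmetric])

lemma indefinite_integral_deriv:
  fixes f :: "real \<Rightarrow> real"
  assumes "f integrable_on {0..b}" "isCont f x" "0 < x" "x < b"
  shows "((\<lambda>x. integral {0..x} f) has_real_derivative f x) (at x)"
proof -
  have "((\<lambda>u. integral {0..u} f) has_vector_derivative f x) (at x within ({0..b} - {}))"
    using assms by (intro integral_has_vector_derivative_continuous_at)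
      (auto intro: continuous_at_imp_continuous_at_within)
  moreover have "at x within {0..b} = at x"
    using assms by (intro at_within_interior) auto
  ultimately show ?thesis by (simp add: has_real_derivative_iff_has_vector_derivative)
qed

lemma indefinite_integral_deriv_continuous:
  fixes f :: "real \<Rightarrow> real"
  assumes "continuous_on {0..b} f" "0 < x" "x < b"
  shows "((\<lambda>x. integral {0..x} f) has_real_derivative f x) (at x)"
proof (rule indefinite_integral_deriv[OF integrable_continuous_interval[OF assms(1)] _ assms(2,3)])
  show "isCont f x" using continuous_on_interior[OF assms(1), of x] assms by simp
qed

text \<open>
  The function is the boundary term of \<open>bliss_transport_pointwise\<close> along the extremal,
  and the derivative is the case of equality there. For \<open>n = 1\<close> it says that the slope of the
  extremal primitive is \<open>bliss_avg r y powr (1 + r)\<close>.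
\<close>

lemma deriv_bliss_boundary:
  assumes "0 < r" "0 < n" "0 < y" "q = n + r"
  shows "((\<lambda>y. y * bliss_avg r y powr n / n) has_real_derivative
           (bliss_avg r y powr q - (n - 1) / n * bliss_avg r y powr n)) (at y)"
proof -
  define b where "b = 1 + y powr r"
  have b: "b > 0" "y powr r = b - 1" by (auto simp: b_def)
  have eq: "(\<lambda>y. y * bliss_avg r y powr n / n) = (\<lambda>y. y * (1 + y powr r) powr (- n / r) / n)"
    by (simp add: bliss_avg_powr)
  have "((\<lambda>y. y * (1 + y powr r) powr (- n / r) / n) has_real_derivative
      (b powr (- n / r) - y * (n / r * b powr (- n / r - 1) * (r * y powr (r - 1)))) / n) (at y)"
    unfolding b_def by (rule derivative_eq_intros refl | use assms in simp)+
  also have "y * (n / r * b powr (- n / r - 1) * (r * y powr (r - 1))) = n * (b - 1) * b powr (- q / r)"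
  proof -
    have "- n / r - 1 = - q / r" using assms by (simp add: field_simps)
    moreover have "y * y powr (r - 1) = b - 1"
      using assms b by (simp add: powr_mult_base)
    moreover have "y * (n / r * b powr (- q / r) * (r * y powr (r - 1))) = n * (y * y powr (r - 1)) * b powr (- q / r)"
      using assms by simp
    ultimately show ?thesis by simp
  qed
  also have "b powr (- n / r) = b * b powr (- q / r)"
  proof -
    have "1 + - q / r = - n / r" using assms by (simp add: field_simps)
    then show ?thesis using b powr_add[of b 1 "- q / r"] by simp
  qed
  also have "(b * b powr (- q / r) - n * (b - 1) * b powr (- q / r)) / n = b powr (- q / r) - (n - 1) / n * (b * b powr (- q / r))"
    using assms by (simp add: field_simps)
  also have "b * b powr (- q / r) = b powr (- n / r)"
  proof -
    have "1 + - q / r = - n / r" using assms by (simp add: field_simps)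
    then show ?thesis using b powr_add[of b 1 "- q / r"] by simp
  qed
  finally show ?thesis unfolding eq by (simp add: bliss_avg_powr b_def)
qed

lemma bliss_avg_powr_shift:
  assumes "0 < r" "q = n + r"
  shows "bliss_avg r y powr n = bliss_avg r y powr q * (1 + y powr r)"
proof -
  have "- n / r = 1 + - q / r" using assms by (simp add: field_simps)
  then show ?thesis using powr_add[of "1 + y powr r" 1 "- q / r"] by (simp add: bliss_avg_powr)
qed

text \<open>
  Integrated form of \<open>deriv_bliss_boundary\<close>. Since the boundary term vanishes at infinity, it
  fixes the ratio of total energy and total mass without evaluating either integral.
\<close>

lemma bliss_energy_mass:
  assumes "0 < r" "1 < n" "0 \<le> y" "q = n + r"
  shows "n * (y * bliss_avg r y powr n / n) = bliss_energy q r y - (n - 1) * bliss_mass q r y"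
proof (cases "y = 0")
  case True
  then show ?thesis by (simp add: bliss_energy_def bliss_mass_def)
next
  case False
  let ?f = "\<lambda>s. bliss_avg r s powr q - (n - 1) / n * bliss_avg r s powr n"
  note c = continuous_on_bliss_avg_powr[OF assms(1)]
  have c': "continuous_on {0..y} (\<lambda>s. s powr r)"
    using assms by (intro continuous_on_subset[OF continuous_on_powr_nonneg]) auto
  have "(?f has_integral (y * bliss_avg r y powr n / n - 0 * bliss_avg r 0 powr n / n)) {0..y}"
  proof (rule fundamental_theorem_of_calculus_interior)
    show "continuous_on {0..y} (\<lambda>y. y * bliss_avg r y powr n / n)"
      using assms by (intro continuous_intros c) auto
    show "((\<lambda>y. y * bliss_avg r y powr n / n) has_vector_derivative ?f x) (at x)" if "x \<in> {0<..<y}" for x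
      using deriv_bliss_boundary[of r n x q] assms that
      by (simp add: has_real_derivative_iff_has_vector_derivative)
  qed (use assms in auto)
  moreover have "?f s = (1 / n) * (bliss_avg r s powr q) - ((n - 1) / n) * (bliss_avg r s powr q * s powr r)" for s
    using bliss_avg_powr_shift[of r q n s] assms by (simp add: field_simps)
  ultimately have I: "((\<lambda>s. (1 / n) * (bliss_avg r s powr q) - ((n - 1) / n) * (bliss_avg r s powr q * s powr r)) has_integral y * bliss_avg r y powr n / n) {0..y}"
    by simp
  have "((\<lambda>s. (1 / n) * (bliss_avg r s powr q) - ((n - 1) / n) * (bliss_avg r s powr q * s powr r)) has_integral
      (1 / n) * bliss_energy q r y - ((n - 1) / n) * bliss_mass q r y) {0..y}"
    unfolding bliss_energy_def bliss_mass_def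
    by (intro has_integral_diff has_integral_mult_right integrable_integral integrable_continuous_interval continuous_intros c c')
  from has_integral_unique[OF I this] show ?thesis using assms by (simp add: field_simps)
qed

lemma bliss_energy_deriv:
  assumes "0 < r" "0 < y"
  shows "(bliss_energy q r has_real_derivative bliss_avg r y powr q) (at y)"
proof -
  note c = continuous_on_bliss_avg_powr[OF assms(1), of "y + 1" q]
  have "bliss_energy q r = (\<lambda>y. integral {0..y} (\<lambda>s. bliss_avg r s powr q))"
    by (simp add: fun_eq_iff bliss_energy_def)
  then show ?thesis using indefinite_integral_deriv_continuous[OF c, of y] assms by simp
qed

lemma continuous_on_bliss_mass_integrand:
  assumes "0 < r"
  shows "continuous_on {0..} (\<lambda>s. bliss_avg r s powr q * s powr r)"
  using bliss_avg_pos[of r] assms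
  by (intro continuous_intros continuous_on_bliss_avg continuous_on_powr_nonneg) (auto simp: less_imp_neq[symmetric])

lemma bliss_mass_deriv:
  assumes "0 < r" "0 < y"
  shows "(bliss_mass q r has_real_derivative bliss_avg r y powr q * y powr r) (at y)"
proof -
  have "bliss_mass q r = (\<lambda>y. integral {0..y} (\<lambda>s. bliss_avg r s powr q * s powr r))"
    by (simp add: fun_eq_iff bliss_mass_def)
  then show ?thesis
    using indefinite_integral_deriv_continuous[OF continuous_on_subset[OF continuous_on_bliss_mass_integrand], of r "y + 1" y q] assms by auto
qed

lemma continuous_on_bliss_mass: "0 < r \<Longrightarrow> continuous_on {0..y} (bliss_mass q r)"
  unfolding bliss_mass_def[abs_def]
  by (intro indefinite_integral_continuous_1 integrable_continuous_interval
       continuous_on_subset[OF continuous_on_bliss_mass_integrand]) auto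

lemma continuous_on_bliss_energy:
  assumes "0 < r" shows "continuous_on {0..y} (bliss_energy q r)"
  unfolding bliss_energy_def[abs_def]
  by (intro indefinite_integral_continuous_1 integrable_continuous_interval continuous_on_bliss_avg_powr assms)

lemma bliss_mass_strict_mono:
  assumes "0 < r" "0 \<le> x" "x < y"
  shows "bliss_mass q r x < bliss_mass q r y"
proof (rule DERIV_pos_imp_increasing_open[OF \<open>x < y\<close>])
  show "continuous_on {x..y} (bliss_mass q r)"
    using continuous_on_bliss_mass[of r y q] assms by (auto intro: continuous_on_subset)
  fix z assume "x < z" "z < y"
  then show "\<exists>D. (bliss_mass q r has_real_derivative D) (at z) \<and> D > 0"
    using bliss_mass_deriv[of r z q] assms bliss_avg_pos[of r z]
    by (intro exI[of _ "bliss_avg r z powr q * z powr r"] conjI) auto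
qed

lemma bliss_mass_le:
  assumes "0 < r" "0 \<le> y" "0 \<le> q"
  shows "bliss_mass q r y \<le> y powr (r + 1) / (r + 1)"
proof -
  have I: "((\<lambda>s. s powr r) has_integral (y powr (r + 1) / (r + 1))) {0..y}"
    using has_integral_powr_from_0[of r y] assms by simp
  have "((\<lambda>s. bliss_avg r s powr q * s powr r) has_integral bliss_mass q r y) {0..y}"
    unfolding bliss_mass_def
    by (intro integrable_integral integrable_continuous_interval
       continuous_on_subset[OF continuous_on_bliss_mass_integrand]) (use assms in auto)
  from this I show ?thesis
  proof (rule has_integral_le)
    fix s
    have "bliss_avg r s powr q \<le> 1"
      using bliss_avg_le_1[of r s] bliss_avg_pos[of r s] assms by (intro powr_le1) auto
    then show "bliss_avg r s powr q * s powr r \<le> s powr r"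
      by (intro mult_left_le_one_le) auto
  qed
qed

section \<open>Bliss and Hardy inequalities for primitives\<close>

text \<open>
  \<open>F\<close> is the primitive of a nonnegative slope \<open>g\<close> and \<open>Gp\<close> that of \<open>g powr p\<close>; both may fail to be
  differentiable on the countable set \<open>S\<close>. The linear bounds on \<open>F\<close> hold for the primitive of a
  bounded decreasing function that does not vanish; they control the boundary terms at 0.
\<close>

locale primitive_data =
  fixes p X B b :: real and S :: "real set" and F g Gp :: "real \<Rightarrow> real"
  assumes p: "1 < p" and X: "0 < X" and b: "0 < b" and S: "countable S"
    and contF: "continuous_on {0..X} F"
    and derF: "\<And>x. 0 < x \<Longrightarrow> x < X \<Longrightarrow> x \<notin> S \<Longrightarrow> (F has_real_derivative g x) (at x) \<and> 0 \<le> g x"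
    and bF: "\<And>x. 0 \<le> x \<Longrightarrow> x \<le> X \<Longrightarrow> b * x \<le> F x \<and> F x \<le> B * x"
    and contGp: "continuous_on {0..X} Gp"
    and derGp: "\<And>x. 0 < x \<Longrightarrow> x < X \<Longrightarrow> x \<notin> S \<Longrightarrow> (Gp has_real_derivative g x powr p) (at x)"
    and Gp0: "Gp 0 = 0"
begin

lemma F0: "F 0 = 0" using bF[of 0] X by simp

lemma Fpos: "0 < x \<Longrightarrow> x \<le> X \<Longrightarrow> 0 < F x"
  using bF[of x] b by (smt (verit) mult_pos_pos)

lemma B_pos: "0 < B" using bF[of X] Fpos[of X] X by (smt (verit) mult_nonpos_nonneg)

lemma average_bounds:
  assumes "0 < x" "x \<le> X"
  shows "b \<le> F x / x" "F x / x \<le> B" "0 \<le> F x / x"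
  using bF[of x] Fpos[OF assms] assms by (auto simp: field_simps)

text \<open>
  The transport map \<open>T\<close> is defined by equality of masses up to \<open>x\<close> and up to \<open>T x\<close>, so the mass
  hypothesis says \<open>T X = y\<close>. The function \<open>Z\<close> collects the energy of \<open>F\<close>, minus the energy of the
  extremal up to \<open>T\<close>, and the boundary terms of both. By \<open>bliss_transport_pointwise\<close> it is
  nondecreasing, and it starts at 0.
\<close>

lemma bliss_transport:
  fixes q r k y :: real
  assumes q: "p < q" and r: "r = q / p - 1" and k: "k = 1 - 1 / p" and y: "0 < y"
    and mass: "integral {0..X} (\<lambda>x. (F x / x) powr q * x powr r) = bliss_mass q r y"
  shows "bliss_energy q r y - p * (y * bliss_avg r y powr (q - r) / (q - r)) \<le> Gp X"
proof -
  have p0: "p > 0" and k0: "k > 0" and r0: "r > 0" and q0: "q > 0" unfolding r k using p q by (auto simp: field_simps)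
  have qk: "q * k = q - r - 1" using p by (simp add: r k field_simps)
  have qr: "q - r > 1" using qk k0 q0 by (smt (verit) mult_pos_pos)
  define \<phi> where "\<phi> x = (F x / x) powr q * x powr r" for x
  note B = B_pos
  have \<phi>pos: "\<phi> x > 0" if "0 < x" "x \<le> X" for x using Fpos[OF that] that by (simp add: \<phi>_def)
  have \<phi>le: "\<phi> x \<le> B powr q * x powr r" if "0 \<le> x" "x \<le> X" for x
  proof (cases "x = 0")
    case False
    then show ?thesis unfolding \<phi>_def using q0 average_bounds[of x] that by (intro mult_right_mono powr_mono2) auto
  qed (simp add: \<phi>_def)
  have \<phi>ge: "b powr q * x powr r \<le> \<phi> x" if "0 \<le> x" "x \<le> X" for x
  proof (cases "x = 0")
    case False
    then show ?thesis unfolding \<phi>_def using q0 b average_bounds[of x] that by (intro mult_right_mono powr_mono2) auto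
  qed (simp add: \<phi>_def)
  \<comment> \<open>at 0 the powers of F and T are indeterminate; bounds by a power of x give continuity there\<close>
  have squeeze0: "continuous (at 0 within {0..X}) h"
    if h0: "h 0 = 0" and h: "\<And>x. 0 \<le> x \<Longrightarrow> x \<le> X \<Longrightarrow> 0 \<le> h x \<and> h x \<le> c * x powr s" and s: "s > 0"
    for h :: "real \<Rightarrow> real" and c s
  proof -
    have "continuous_on {0..} (\<lambda>x. c * x powr s)"
      by (intro continuous_intros continuous_on_powr_nonneg s)
    then have "((\<lambda>x. c * x powr s) \<longlongrightarrow> c * 0 powr s) (at 0 within {0..})"
      unfolding continuous_on_def by (rule bspec) auto
    then have "((\<lambda>x. c * x powr s) \<longlongrightarrow> c * 0 powr s) (at 0 within {0..X})"
      by (rule tendsto_within_subset) auto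
    then have "((\<lambda>x. c * x powr s) \<longlongrightarrow> 0) (at 0 within {0..X})" by simp
    then have "(h \<longlongrightarrow> 0) (at 0 within {0..X})"
      by (rule tendsto_sandwich[OF _ _ tendsto_const, rotated 2])
         (use h in \<open>auto simp: eventually_at_filter\<close>)
    then show ?thesis by (simp add: continuous_within h0)
  qed
  have cont\<phi>: "continuous_on {0..X} \<phi>"
    unfolding continuous_on_eq_continuous_within
  proof
    fix x assume x: "x \<in> {0..X}"
    show "continuous (at x within {0..X}) \<phi>"
    proof (cases "x = 0")
      case True
      show ?thesis unfolding True
        by (rule squeeze0[where c = "B powr q" and s = r])
           (use \<phi>le \<phi>pos r0 in \<open>auto simp: \<phi>_def\<close>)
    next
      case False
      have "continuous (at x within {0..X}) F"
        using contF x by (simp add: continuous_on_eq_continuous_within)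
      then show ?thesis unfolding \<phi>_def
        using False x Fpos[of x]
        by (intro continuous_intros) auto
    qed
  qed
  define m where "m x = integral {0..x} \<phi>" for x
  have contm: "continuous_on {0..X} m" unfolding m_def
    by (intro indefinite_integral_continuous_1 integrable_continuous_interval cont\<phi>)
  have derm: "(m has_real_derivative \<phi> x) (at x)" if "0 < x" "x < X" for x
    using indefinite_integral_deriv_continuous[OF cont\<phi> that] by (simp add: m_def[abs_def])
  have m0: "m 0 = 0" by (simp add: m_def)
  have mX: "m X = bliss_mass q r y" using mass by (simp add: m_def \<phi>_def[abs_def])
  have mmono: "m x < m x'" if "0 \<le> x" "x < x'" "x' \<le> X" for x x'
  proof (rule DERIV_pos_imp_increasing_open[OF \<open>x < x'\<close>])
    show "continuous_on {x..x'} m" using contm that by (auto intro: continuous_on_subset)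
    fix z assume "x < z" "z < x'"
    then have "0 < z" "z < X" using that by auto
    then show "\<exists>D. (m has_real_derivative D) (at z) \<and> D > 0" using derm[of z] \<phi>pos[of z] by auto
  qed
  have mge: "b powr q * x powr (r + 1) / (r + 1) \<le> m x" if "0 \<le> x" "x \<le> X" for x
  proof -
    have "((\<lambda>s. b powr q * s powr r) has_integral (b powr q * (x powr (r + 1) / (r + 1)))) {0..x}"
      using has_integral_powr_from_0[of r x] that r0 by (intro has_integral_mult_right) simp
    moreover have "(\<phi> has_integral m x) {0..x}"
      unfolding m_def using cont\<phi> that
      by (intro integrable_integral integrable_continuous_interval) (auto intro: continuous_on_subset)
    ultimately show ?thesis using has_integral_le[of _ _ "{0..x}" \<phi> "m x"] \<phi>ge that by fastforce
  qed
  \<comment> \<open>the transport map: inverse of the mass function of the extremal, after the mass function of F\<close>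
  define Hi where "Hi = the_inv_into {0..y} (bliss_mass q r)"
  have injH: "inj_on (bliss_mass q r) {0..y}"
    by (rule strict_mono_on_imp_inj_on) (auto simp: strict_mono_on_def bliss_mass_strict_mono r0)
  have H0: "bliss_mass q r 0 = 0" by (simp add: bliss_mass_def)
  have imH: "bliss_mass q r ` {0..y} = {0..bliss_mass q r y}"
  proof safe
    fix s assume "s \<in> {0..y}"
    then show "bliss_mass q r s \<in> {0..bliss_mass q r y}"
      using bliss_mass_strict_mono[of r 0 s q] bliss_mass_strict_mono[of r s y q] r0 H0
      by (cases "s = 0"; cases "s = y") auto
  next
    fix w assume "w \<in> {0..bliss_mass q r y}"
    then obtain s where "0 \<le> s" "s \<le> y" "bliss_mass q r s = w"
      using IVT'[of "bliss_mass q r" 0 w y] continuous_on_bliss_mass[OF r0, of y q] y H0 by auto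
    then show "w \<in> bliss_mass q r ` {0..y}" by auto
  qed
  have Hi: "Hi w \<in> {0..y}" "bliss_mass q r (Hi w) = w" if "w \<in> {0..bliss_mass q r y}" for w
    unfolding Hi_def using the_inv_into_into[OF injH, of w "{0..y}"] f_the_inv_into_f[OF injH, of w] that imH by auto
  have contHi: "continuous_on {0..bliss_mass q r y} Hi"
    using continuous_on_inv[where f = "bliss_mass q r" and s = "{0..y}" and g = Hi, OF continuous_on_bliss_mass[OF r0] compact_Icc] imH
    by (simp add: Hi_def the_inv_into_f_f[OF injH])
  define T where "T x = Hi (m x)" for x
  have mrange: "m x \<in> {0..bliss_mass q r y}" if "0 \<le> x" "x \<le> X" for x
    using mmono[of 0 x] mmono[of x X] that m0 mX by (cases "x = 0"; cases "x = X") auto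
  have HT: "bliss_mass q r (T x) = m x" and Trange: "0 \<le> T x" "T x \<le> y" if "0 \<le> x" "x \<le> X" for x
    using Hi[OF mrange[OF that]] by (auto simp: T_def)
  have T0: "T 0 = 0" unfolding T_def m0 Hi_def using the_inv_into_f_f[OF injH, of 0] H0 y by simp
  have TX: "T X = y" unfolding T_def mX Hi_def using the_inv_into_f_f[OF injH, of y] y by simp
  have contT: "continuous_on {0..X} T"
    unfolding T_def by (rule continuous_on_compose2[OF contHi contm]) (use mrange in auto)
  have Tpos: "0 < T x" if "0 < x" "x \<le> X" for x
    using HT[of x] Trange[of x] mmono[of 0 x] m0 H0 that by (cases "T x = 0") auto
  have Tlt: "T x < y" if "0 \<le> x" "x < X" for x
    using HT[of x] Trange[of x] mmono[of x X] mX that by (cases "T x = y") auto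
  have derT: "(T has_real_derivative \<phi> x / (bliss_avg r (T x) powr q * T x powr r)) (at x)" if x: "0 < x" "x < X" for x
  proof -
    let ?D = "bliss_avg r (T x) powr q * T x powr r"
    have Tx: "0 < T x" using Tpos x by auto
    have D0: "?D \<noteq> 0" using Tx bliss_avg_pos[of r "T x"] by simp
    have mx: "0 < m x" "m x < bliss_mass q r y"
      using mmono[of 0 x] mmono[of x X] x m0 mX by auto
    have "isCont Hi (m x)"
      using contHi mx by (intro continuous_on_interior[OF contHi]) auto
    then have "(Hi has_real_derivative inverse ?D) (at (m x))"
      by (intro DERIV_inverse_function[where f = "bliss_mass q r" and a = 0 and b = "bliss_mass q r y"])
         (use bliss_mass_deriv[OF r0 Tx, of q] D0 mx Hi in \<open>auto simp: T_def\<close>)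
    from DERIV_chain2[OF this derm[OF x]] show ?thesis
      by (simp add: T_def[abs_def] divide_inverse mult.commute)
  qed
  define c where "c = b powr (q / (r + 1))"
  have c0: "c > 0" using b by (simp add: c_def)
  \<comment> \<open>near 0 the map T is at least linear, hence the negative power of T in P is harmless\<close>
  have Tge: "c * x \<le> T x" if "0 \<le> x" "x \<le> X" for x
  proof -
    have "b powr q * x powr (r + 1) / (r + 1) \<le> T x powr (r + 1) / (r + 1)"
      using mge[OF that] HT[OF that] bliss_mass_le[of r "T x" q] r0 q0 Trange[OF that] by simp
    then have "b powr q * x powr (r + 1) \<le> T x powr (r + 1)"
      using r0 by (simp add: divide_le_cancel)
    moreover have "(c * x) powr (r + 1) = b powr q * x powr (r + 1)"
      using r0 that b by (simp add: c_def powr_mult powr_powr)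
    ultimately have "(c * x) powr (r + 1) \<le> T x powr (r + 1)" by simp
    then show ?thesis using r0 Trange[OF that] c0 that
      by (metis powr_less_mono2 add_pos_pos zero_less_one not_le)
  qed
  define P where "P x = F x powr (q - r) * x powr (- (q - r) * k) * T x powr (- r * k) / (q - r)" for x
  have P0: "P 0 = 0" by (simp add: P_def F0)
  have Pnn: "0 \<le> P x" for x using qr by (simp add: P_def)
  have Ple: "P x \<le> (B powr (q - r) * c powr (- r * k) / (q - r)) * x powr 1" if "0 \<le> x" "x \<le> X" for x
  proof (cases "x = 0")
    case False
    then have x: "0 < x" "x \<le> X" using that by auto
    have 1: "F x powr (q - r) \<le> (B * x) powr (q - r)"
      using bF[of x] Fpos[OF x] that qr by (intro powr_mono2) auto
    have 2: "T x powr (- r * k) \<le> (c * x) powr (- r * k)"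
      using Tge[OF that] c0 x r0 k0 by (intro powr_mono2') auto
    have "P x \<le> (B * x) powr (q - r) * x powr (- (q - r) * k) * (c * x) powr (- r * k) / (q - r)"
      unfolding P_def using 1 2 qr by (intro divide_right_mono mult_mono) auto
    also have "\<dots> = (B powr (q - r) * c powr (- r * k) / (q - r)) * (x powr (q - r) * x powr (- (q - r) * k) * x powr (- r * k))"
      using B x c0 by (simp add: powr_mult)
    also have "x powr (q - r) * x powr (- (q - r) * k) * x powr (- r * k) = x powr 1"
    proof -
      have "(q - r) + (- (q - r) * k) + (- r * k) = 1" using qk by (simp add: algebra_simps)
      then show ?thesis by (simp only: powr_add[symmetric])
    qed
    finally show ?thesis .
  qed (simp add: P0)
  have contP: "continuous_on {0..X} P"
    unfolding continuous_on_eq_continuous_within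
  proof
    fix x assume x: "x \<in> {0..X}"
    show "continuous (at x within {0..X}) P"
    proof (cases "x = 0")
      case True
      show ?thesis unfolding True
        by (rule squeeze0[where h = P and s = 1 and c = "B powr (q - r) * c powr (- r * k) / (q - r)"])
             (use P0 Ple Pnn in auto)
    next
      case False
      have "continuous (at x within {0..X}) F" "continuous (at x within {0..X}) T"
        using contF contT x by (simp_all add: continuous_on_eq_continuous_within)
      then show ?thesis unfolding P_def
        using False x Fpos[of x] Tpos[of x] qr
        by (intro continuous_intros) auto
    qed
  qed
  define Q where "Q y = y * bliss_avg r y powr (q - r) / (q - r)" for y
  have contQ: "continuous_on {0..y} Q"
    unfolding Q_def using qr by (intro continuous_intros continuous_on_bliss_avg_powr r0) auto
  define Z where "Z x = Gp x / p - (bliss_energy q r (T x) / p - Q (T x) + P x)" for x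
  have "Z 0 \<le> Z X"
  proof (rule nondecreasing_if_deriv_nonneg_off_countable[where f = Z and a = 0 and b = X and S = S])
    show "continuous_on {0..X} Z"
      unfolding Z_def using p0
      by (intro continuous_intros contGp contP continuous_on_compose2[OF contQ contT]
          continuous_on_compose2[OF continuous_on_bliss_energy[OF r0] contT]) (use Trange in auto)
    fix x assume x: "0 < x" "x < X" "x \<notin> S"
    note pos = Fpos[of x] Tpos[of x]
    have F': "(F has_real_derivative g x) (at x)" and g0: "0 \<le> g x" using derF[OF x] by auto
    have pp: "0 < F x" "0 < T x" using pos x by auto
    define h where "h = bliss_avg r (T x)"
    have h: "h > 0" by (simp add: h_def bliss_avg_pos)
    define T' where "T' = (F x / x / h) powr q * (x / T x) powr r"
    have T'eq: "\<phi> x / (bliss_avg r (T x) powr q * T x powr r) = T'"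
      using pp h x by (simp add: T'_def \<phi>_def h_def powr_divide powr_mult)
    have T': "(T has_real_derivative T') (at x)" using derT[OF x(1,2)] T'eq by simp
    have P': "(P has_real_derivative P x * ((q - r) * g x / F x - (q - r) * k / x - r * k * T' / T x)) (at x)"
    proof -
      have pw: "((\<lambda>x. u x powr c) has_real_derivative u x powr c * (c * u' / u x)) (at x)"
        if "(u has_real_derivative u') (at x)" "0 < u x" for u u' c
      proof -
        have "((\<lambda>x. u x powr c) has_real_derivative c * u x powr (c - 1) * u') (at x)"
          using that by (auto intro!: derivative_eq_intros simp: mult_ac)
        then show ?thesis
          by (rule DERIV_cong) (use that in \<open>simp add: powr_diff\<close>)
      qed
      have a: "((\<lambda>x. F x powr (q - r) * x powr (- (q - r) * k) * T x powr (- r * k) / (q - r)) has_real_derivative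
         (((F x powr (q - r) * ((q - r) * g x / F x)) * x powr (- (q - r) * k)
            + (x powr (- (q - r) * k) * ((- (q - r) * k) * 1 / x)) * F x powr (q - r)) * T x powr (- r * k)
          + (T x powr (- r * k) * ((- r * k) * T' / T x)) * (F x powr (q - r) * x powr (- (q - r) * k))) / (q - r)) (at x)"
        by (intro DERIV_cdivide DERIV_mult pw F' T' DERIV_ident pp x)
      show ?thesis
        unfolding P_def
        by (rule DERIV_cong[OF a]) (simp add: algebra_simps add_divide_distrib diff_divide_distrib)
    qed
    have E': "((\<lambda>x. bliss_energy q r (T x)) has_real_derivative h powr q * T') (at x)"
      using DERIV_chain2[OF bliss_energy_deriv[OF r0 pp(2)] T'] by (simp add: h_def)
    have Q': "((\<lambda>x. Q (T x)) has_real_derivative (h powr q - (q - r - 1) / (q - r) * h powr (q - r)) * T') (at x)"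
      using DERIV_chain2[OF deriv_bliss_boundary[OF r0 _ pp(2), of "q - r" q] T'] qr by (simp add: h_def Q_def[abs_def])
    let ?Z' = "g x powr p / p - (h powr q * T' / p - (h powr q - (q - r - 1) / (q - r) * h powr (q - r)) * T'
       + P x * ((q - r) * g x / F x - (q - r) * k / x - r * k * T' / T x))"
    have "(Z has_real_derivative ?Z') (at x)"
      unfolding Z_def
      by (intro derivative_intros derGp x E' Q' P' DERIV_cdivide)
    moreover have "?Z' \<ge> 0"
    proof -
      have "P x * ((q - r) * g x / F x - (q - r) * k / x - r * k * T' / T x)
           \<le> g x powr p / p + T' * (k * h powr q - k * q / (q - r) * h powr (q - r))"
        unfolding P_def T'_def by (rule bliss_transport_pointwise[OF p q r k pp(1) g0 x(1) pp(2) h])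
      also have "k * q = q - r - 1" using qk by (simp add: mult.commute)
      finally have "P x * ((q - r) * g x / F x - (q - r) * k / x - r * k * T' / T x)
           \<le> g x powr p / p + T' * (k * h powr q - (q - r - 1) / (q - r) * h powr (q - r))" .
      moreover have "h powr q * T' / p = T' * (1 - k) * h powr q" by (simp add: k)
      ultimately show ?thesis by (simp add: algebra_simps)
    qed
    ultimately show "\<exists>D\<ge>0. (Z has_real_derivative D) (at x)" by blast
  qed (use X S in auto)
  moreover have "Z 0 = 0" by (simp add: Z_def Gp0 T0 P0 Q_def bliss_energy_def)
  moreover have "Z X = Gp X / p - (bliss_energy q r y / p - Q y + P X)" by (simp add: Z_def TX)
  ultimately have "bliss_energy q r y / p - Q y \<le> Gp X / p" using Pnn[of X] by simp
  then have "p * (bliss_energy q r y / p - Q y) \<le> p * (Gp X / p)" using p0 by (intro mult_left_mono) auto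
  then show ?thesis using p0 by (simp add: Q_def algebra_simps)
qed

end

lemma bounded_continuous_integrable:
  fixes f :: "real \<Rightarrow> real"
  assumes "continuous_on {0<..X} f" "\<And>x. 0 < x \<Longrightarrow> x \<le> X \<Longrightarrow> \<bar>f x\<bar> \<le> c"
  shows "f integrable_on {0..X}"
proof -
  have "f integrable_on {0<..X}"
  proof (rule measurable_bounded_by_integrable_imp_integrable)
    show "f \<in> borel_measurable (lebesgue_on {0<..X})"
      using assms(1) by (intro continuous_imp_measurable_on_sets_lebesgue) auto
    show "(\<lambda>_. c) integrable_on {0<..X}"
      by (intro integrable_on_const bounded_set_imp_lmeasurable) auto
  qed (use assms in auto)
  then show ?thesis
  proof (rule integrable_spike_set)
    show "negligible {x \<in> {0<..X} - {0..X}. f x \<noteq> 0}" by (rule negligible_subset[of "{0}"]) auto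
    show "negligible {x \<in> {0..X} - {0<..X}. f x \<noteq> 0}" by (rule negligible_subset[of "{0}"]) auto
  qed
qed

lemma Bernoulli_powr:
  fixes z p :: real
  assumes "1 < p" "0 \<le> z"
  shows "1 - z powr p \<le> p * (1 - z)"
proof -
  have "z * 1 \<le> z powr p / p + 1 powr (p / (p - 1)) / (p / (p - 1))"
    using assms by (intro Youngs_inequality) (auto simp: field_simps)
  then have "p * z \<le> p * (z powr p / p + (p - 1) / p)"
    using assms by (intro mult_left_mono) auto
  also have "\<dots> = z powr p + (p - 1)" using assms by (simp add: distrib_left)
  finally show ?thesis by (simp add: algebra_simps)
qed

text \<open>
  For \<open>p = q\<close> there is no extremal to compare with. The boundary term is now
  \<open>x * (F x / x) powr p\<close>, and its derivative is compared with the integrands by the tangent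
  inequality \<open>1 - z powr p \<le> p * (1 - z)\<close>, where \<open>z = 1\<close> is the slope ratio of the power functions
  that are nearly extremal.
\<close>

lemma (in primitive_data) hardy_inequality_real:
  shows "integral {0..X} (\<lambda>x. (F x / x) powr p) \<le> (p / (p - 1)) powr p * Gp X"
proof -
  define c where "c = p / (p - 1)"
  have c0: "c > 0" using p by (simp add: c_def)
  define \<phi> where "\<phi> x = (F x / x) powr p" for x
  note B = B_pos
  have \<phi>le: "\<phi> x \<le> B powr p" if "0 < x" "x \<le> X" for x
    unfolding \<phi>_def using p average_bounds[OF that] by (intro powr_mono2) auto
  have cont\<phi>: "continuous_on {0<..X} \<phi>"
    unfolding \<phi>_def
  proof (intro continuous_intros continuous_on_subset[OF contF] ballI)
    show "F x / x \<noteq> 0" if "x \<in> {0<..X}" for x using Fpos[of x] that by auto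
  qed auto
  have int\<phi>: "\<phi> integrable_on {0..X}"
    by (rule bounded_continuous_integrable[OF cont\<phi>, where c = "B powr p"]) (use \<phi>le in \<open>auto simp: \<phi>_def\<close>)
  define m where "m x = integral {0..x} \<phi>" for x
  have contm: "continuous_on {0..X} m" unfolding m_def
    by (intro indefinite_integral_continuous_1 int\<phi>)
  have derm: "(m has_real_derivative \<phi> x) (at x)" if "0 < x" "x < X" for x
  proof -
    have "isCont \<phi> x" using continuous_on_subset[OF cont\<phi>, of "{0<..<X}"] that
      by (auto simp: continuous_on_eq_continuous_at subset_eq)
    from indefinite_integral_deriv[OF int\<phi> this that] show ?thesis by (simp add: m_def[abs_def])
  qed
  define W where "W x = F x powr p * x powr (1 - p)" for x
  have W0: "W 0 = 0" by (simp add: W_def F0)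
  have Wnn: "0 \<le> W x" for x by (simp add: W_def)
  have Wx: "W x = x * \<phi> x" if "0 < x" "x \<le> X" for x
    using that Fpos[of x] by (simp add: W_def \<phi>_def powr_diff powr_divide)
  have contW: "continuous_on {0..X} W"
    unfolding continuous_on_eq_continuous_within
  proof
    fix x assume x: "x \<in> {0..X}"
    show "continuous (at x within {0..X}) W"
    proof (cases "x = 0")
      case True
      have "((\<lambda>x. B powr p * x) \<longlongrightarrow> B powr p * 0) (at 0 within {0..X})"
        by (intro tendsto_intros)
      then have lim: "((\<lambda>x. B powr p * x) \<longlongrightarrow> 0) (at 0 within {0..X})" by simp
      have le: "W x \<le> B powr p * x" if "0 \<le> x" "x \<le> X" for x
        using Wx[of x] \<phi>le[of x] W0 that by (cases "x = 0") (auto simp: mult.commute)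
      from lim have "(W \<longlongrightarrow> 0) (at 0 within {0..X})"
        by (rule tendsto_sandwich[OF _ _ tendsto_const, rotated 2])
           (use Wnn le in \<open>auto simp: eventually_at_filter\<close>)
      then show ?thesis by (simp add: True continuous_within W0)
    next
      case False
      have "continuous (at x within {0..X}) F"
        using contF x by (simp_all add: continuous_on_eq_continuous_within)
      then show ?thesis unfolding W_def
        using False x Fpos[of x]
        by (intro continuous_intros) auto
    qed
  qed
  define Z where "Z x = c powr p * Gp x - m x - c * W x" for x
  have "Z 0 \<le> Z X"
  proof (rule nondecreasing_if_deriv_nonneg_off_countable[where f = Z and a = 0 and b = X and S = S])
    show "continuous_on {0..X} Z"
      unfolding Z_def by (intro continuous_intros contGp contm contW)
    fix x assume x: "0 < x" "x < X" "x \<notin> S"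
    have F': "(F has_real_derivative g x) (at x)" and g0: "0 \<le> g x" using derF[OF x] by auto
    have Fx: "0 < F x" using Fpos x by simp
    have a: "(W has_real_derivative (p * F x powr (p - 1) * g x) * x powr (1 - p) + ((1 - p) * x powr (1 - p - 1) * 1) * F x powr p) (at x)"
      unfolding W_def by (rule derivative_eq_intros F' refl | use Fx x in simp)+
    have W': "(W has_real_derivative \<phi> x * (p * (g x * x / F x) - (p - 1))) (at x)"
    proof (rule DERIV_cong[OF a])
      have e: "x powr (1 - p) = x / x powr p" "x powr (1 - p - 1) = 1 / x powr p" "F x powr (p - 1) = F x powr p / F x"
        "\<phi> x = F x powr p / x powr p"
        using Fx x by (simp_all add: \<phi>_def powr_diff powr_minus_divide powr_divide)
      show "p * F x powr (p - 1) * g x * x powr (1 - p) + (1 - p) * x powr (1 - p - 1) * 1 * F x powr p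
          = \<phi> x * (p * (g x * x / F x) - (p - 1))"
        unfolding e by (simp add: algebra_simps diff_divide_distrib add_divide_distrib)
    qed
    have Z': "(Z has_real_derivative (c powr p * g x powr p - \<phi> x - c * (\<phi> x * (p * (g x * x / F x) - (p - 1))))) (at x)"
      unfolding Z_def by (intro derivative_intros derGp x derm W' DERIV_cmult)
    define z where "z = c * (g x * x / F x)"
    have z0: "z \<ge> 0" using c0 g0 x Fx by (simp add: z_def)
    have "g x * c = z * (F x / x)" using x Fx by (simp add: z_def)
    moreover have "c powr p * g x powr p = (g x * c) powr p"
      using g0 c0 by (subst powr_mult) auto
    ultimately have "c powr p * g x powr p = (z * (F x / x)) powr p" by simp
    also have "\<dots> = z powr p * \<phi> x" unfolding \<phi>_def using z0 Fx x by (subst powr_mult) auto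
    finally have e1: "c powr p * g x powr p = z powr p * \<phi> x" .
    have cp: "c * (p - 1) = p" using p by (simp add: c_def)
    have "c * (\<phi> x * (p * (g x * x / F x) - (p - 1))) = \<phi> x * (p * z - c * (p - 1))"
      by (simp add: z_def algebra_simps)
    then have e2: "c * (\<phi> x * (p * (g x * x / F x) - (p - 1))) = \<phi> x * (p * z - p)"
      unfolding cp .
    have "0 \<le> \<phi> x * (z powr p - 1 - (p * z - p))"
      using Bernoulli_powr[OF p z0] by (intro mult_nonneg_nonneg) (auto simp: \<phi>_def algebra_simps)
    then have "c powr p * g x powr p - \<phi> x - c * (\<phi> x * (p * (g x * x / F x) - (p - 1))) \<ge> 0"
      unfolding e1 e2 by (simp add: algebra_simps)
    then show "\<exists>D\<ge>0. (Z has_real_derivative D) (at x)" using Z' by blast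
  qed (use X S in auto)
  moreover have "Z 0 = 0" by (simp add: Z_def Gp0 W0 m_def)
  moreover have "Z X \<le> c powr p * Gp X - m X" using Wnn[of X] c0 by (simp add: Z_def)
  ultimately show ?thesis by (simp add: m_def \<phi>_def[abs_def] c_def)
qed

section \<open>The sharp constant\<close>

lemma powr_at_top:
  assumes "0 < (r::real)"
  shows "filterlim (\<lambda>y. y powr r) at_top at_top"
proof -
  have "filterlim (\<lambda>y. exp (r * ln y)) at_top at_top"
    by (intro filterlim_compose[OF exp_at_top] filterlim_tendsto_pos_mult_at_top[OF tendsto_const assms] ln_at_top)
  moreover have "eventually (\<lambda>y. exp (r * ln y) = y powr r) at_top"
    using eventually_gt_at_top[of 0] by eventually_elim (simp add: powr_def)
  ultimately show ?thesis by (simp add: filterlim_cong)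
qed

text \<open>
  The substitution \<open>w = y powr r / (1 + y powr r)\<close> turns the truncated energy into an incomplete
  Beta integral over \<open>{0..w}\<close>, and \<open>w \<rightarrow> 1\<close> as \<open>y \<rightarrow> \<infinity>\<close>.
\<close>

lemma bliss_energy_tendsto:
  assumes "0 < r" "1 < q"
  shows "(bliss_energy q r \<longlongrightarrow> Beta (1 / r) ((q - 1) / r) / r) at_top"
proof -
  define a b where ab: "a = 1 / r" "b = (q - 1) / r"
  have pos: "a > 0" "b > 0" using assms by (auto simp: ab)
  define f where "f t = t powr (a - 1) * (1 - t) powr (b - 1)" for t
  have fint: "(f has_integral Beta a b) {0..1}"
    unfolding f_def using has_integral_Beta_real[OF pos] .
  define B0 where "B0 w = integral {0..w} f" for w
  have contB: "continuous_on {0..1} B0"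
    unfolding B0_def using fint by (intro indefinite_integral_continuous_1) (auto simp: integrable_on_def)
  have derB: "(B0 has_real_derivative f w) (at w)" if "0 < w" "w < 1" for w
  proof -
    have "isCont f w" unfolding f_def using that by (intro continuous_intros) auto
    moreover have "f integrable_on {0..1}" using fint by (auto simp: integrable_on_def)
    ultimately show ?thesis using indefinite_integral_deriv[of f 1 w] that by (simp add: B0_def[abs_def])
  qed
  define w where "w y = y powr r / (1 + y powr r)" for y :: real
  have w01: "0 \<le> w y" "w y < 1" for y by (auto simp: w_def)
  have contw: "continuous_on {0..} w"
    unfolding w_def using assms by (intro continuous_intros continuous_on_powr_nonneg) auto
  have E: "bliss_energy q r Y = B0 (w Y) / r" if "0 \<le> Y" for Y
  proof -
    have "((\<lambda>s. bliss_avg r s powr q) has_integral (B0 (w Y) / r - B0 (w 0) / r)) {0..Y}"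
    proof (rule fundamental_theorem_of_calculus_interior)
      show "continuous_on {0..Y} (\<lambda>y. B0 (w y) / r)"
        using assms w01(1) less_imp_le[OF w01(2)]
        by (intro continuous_intros continuous_on_compose2[OF contB continuous_on_subset[OF contw]]) auto
      fix y assume "y \<in> {0<..<Y}"
      then have y: "0 < y" by auto
      define u where "u = 1 + y powr r"
      have u: "u > 1" "y powr r = u - 1" using y by (auto simp: u_def)
      have wy: "0 < w y" "w y < 1" using y by (auto simp: w_def)
      have "(w has_real_derivative ((r * y powr (r - 1)) * (1 + y powr r) - y powr r * (r * y powr (r - 1))) / ((1 + y powr r) * (1 + y powr r))) (at y)"
        unfolding w_def by (rule derivative_eq_intros refl | use y in simp)+
      then have w': "(w has_real_derivative r * y powr (r - 1) * u powr (-2)) (at y)"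
      proof (rule DERIV_cong)
        have u2: "u powr (-2) = 1 / (u * u)" using u by (simp add: powr_minus_divide power2_eq_square)
        show "((r * y powr (r - 1)) * (1 + y powr r) - y powr r * (r * y powr (r - 1))) / ((1 + y powr r) * (1 + y powr r))
          = r * y powr (r - 1) * u powr (-2)"
          unfolding u_def[symmetric] u(2) u2 by (simp add: algebra_simps)
      qed
      have "((\<lambda>y. B0 (w y) / r) has_real_derivative (f (w y) * (r * y powr (r - 1) * u powr (-2)) / r)) (at y)"
        by (intro DERIV_cdivide DERIV_chain2[OF derB[OF wy] w'])
      moreover have "f (w y) * (r * y powr (r - 1) * u powr (-2)) / r = bliss_avg r y powr q"
      proof -
        have 1: "w y powr (a - 1) = y powr (r * (a - 1)) * u powr (- (a - 1))"
        proof -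
          have "w y powr (a - 1) = (y powr r) powr (a - 1) / u powr (a - 1)"
            unfolding w_def u_def[symmetric] using u by (subst powr_divide) auto
          then show ?thesis by (simp only: powr_powr powr_minus divide_inverse)
        qed
        have "1 - w y = u powr (-1)" using u by (simp add: w_def u_def[symmetric] powr_minus field_simps)
        then have 2: "(1 - w y) powr (b - 1) = u powr (- (b - 1))" by (simp only: powr_powr) simp
        have ra: "r * (a - 1) + (r - 1) = 0" using assms by (simp add: ab field_simps)
        have "y powr (r * (a - 1)) * y powr (r - 1) = 1"
          using y by (simp only: powr_add[symmetric] ra) simp
        moreover have "u powr (- (a - 1)) * u powr (- (b - 1)) * u powr (-2) = u powr (- q / r)"
        proof -
          have "- (a - 1) + (- (b - 1)) + (-2) = - q / r" using assms by (simp add: ab field_simps)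
          then show ?thesis by (simp only: powr_add[symmetric])
        qed
        moreover have "bliss_avg r y powr q = u powr (- q / r)" by (simp add: bliss_avg_powr u_def)
        moreover have "f (w y) * (r * y powr (r - 1) * u powr (-2)) / r
           = (y powr (r * (a - 1)) * y powr (r - 1)) * (u powr (- (a - 1)) * u powr (- (b - 1)) * u powr (-2))"
          using assms unfolding f_def 1 2 by (simp only: mult_ac times_divide_eq_right) simp
        ultimately show ?thesis by simp
      qed
      ultimately show "((\<lambda>y. B0 (w y) / r) has_vector_derivative bliss_avg r y powr q) (at y)"
        by (simp add: has_real_derivative_iff_has_vector_derivative)
    qed (use that in auto)
    then show ?thesis using assms by (simp add: bliss_energy_def integral_unique w_def B0_def)
  qed
  have "(w \<longlongrightarrow> 1) at_top"
  proof -
    have "filterlim (\<lambda>y. 1 + y powr r) at_top at_top"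
      by (intro filterlim_tendsto_add_at_top[OF tendsto_const] powr_at_top assms)
    then have "((\<lambda>y. 1 - inverse (1 + y powr r)) \<longlongrightarrow> 1 - 0) at_top"
      by (intro tendsto_intros tendsto_inverse_0_at_top)
    moreover have "1 - inverse (1 + y powr r) = w y" for y
      by (simp add: w_def field_simps)
    ultimately show ?thesis by simp
  qed
  moreover have "eventually (\<lambda>y. w y \<in> {0..1} \<and> w y \<noteq> 1) at_top" using w01 by (auto simp: less_imp_le less_imp_neq)
  ultimately have "filterlim w (at 1 within {0..1}) at_top"
    by (simp add: filterlim_at)
  moreover have "(B0 \<longlongrightarrow> B0 1) (at 1 within {0..1})"
    using contB by (simp add: continuous_on_def)
  ultimately have "((\<lambda>y. B0 (w y)) \<longlongrightarrow> B0 1) at_top"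
    by (rule filterlim_compose[rotated])
  then have "((\<lambda>y. B0 (w y) / r) \<longlongrightarrow> B0 1 / r) at_top"
    using assms by (intro tendsto_intros) auto
  moreover have "B0 1 = Beta a b" using fint by (simp add: B0_def integral_unique)
  moreover have "eventually (\<lambda>y. B0 (w y) / r = bliss_energy q r y) at_top"
    using eventually_ge_at_top[of 0] by eventually_elim (simp add: E)
  ultimately show ?thesis by (simp add: ab cong: filterlim_cong)
qed

lemma bliss_energy_limit_pos: "0 < r \<Longrightarrow> 1 < q \<Longrightarrow> 0 < Beta (1 / r) ((q - 1) / r) / (r::real)"
  by (auto simp: Beta_def intro!: divide_pos_pos mult_pos_pos Gamma_real_pos add_pos_pos)

text \<open>
  By this identity the constant enters the proofs only through the total energy of the extremal.
  It uses \<open>q / (q - p) = 1 / r + 1\<close>, \<open>p * (q - 1) / (q - p) = (q - 1) / r\<close> and the functional equation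
  of the Gamma function.
\<close>

lemma C_const_powr:
  assumes "1 < p" "p < q" and r: "r = q / p - 1"
  shows "C_const p q powr q = (Beta (1 / r) ((q - 1) / r) / r) powr (- r) / (p - 1)"
proof -
  have r0: "r > 0" unfolding r using assms(1,2) by (simp add: field_simps)
  have qp: "q - p = p * r" using assms by (simp add: field_simps)
  have e: "p * q / (q - p) = 1 / r + (q - 1) / r" "q / (q - p) = 1 / r + 1" "p * (q - 1) / (q - p) = (q - 1) / r"
    unfolding qp using r0 assms(1) qp by (simp_all add: field_simps)
  have g: "Gamma (1 / r + 1) = 1 / r * Gamma (1 / r)"
  proof (rule Gamma_plus1, rule notI)
    assume "1 / r \<in> \<int>\<^sub>\<le>\<^sub>0"
    then obtain n where "1 / r = of_int n" "n \<le> 0" by (auto elim: nonpos_Ints_cases)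
    then have "1 / r \<le> 0" by simp
    then show False using r0 by simp
  qed
  have G: "Gamma (1 / r) > 0" "Gamma ((q - 1) / r) > 0" "Gamma (1 / r + (q - 1) / r) > 0"
    using r0 assms by (auto intro!: Gamma_real_pos add_pos_pos)
  define E where "E = Beta (1 / r) ((q - 1) / r) / r"
  have E0: "E > 0" using G r0 by (simp add: E_def Beta_def)
  have i: "Gamma (p * q / (q - p)) / (Gamma (q / (q - p)) * Gamma (p * (q - 1) / (q - p))) = inverse E"
    unfolding e g E_def Beta_def using G r0 by (simp add: field_simps)
  have ir: "inverse E powr r = inverse (E powr r)" using E0 by (simp add: inverse_powr powr_minus)
  have rq: "(1 / p - 1 / q) * q = r" using assms(1,2) unfolding r by (simp add: left_diff_distrib)
  have "C_const p q = (p - 1) powr (- 1 / q) * inverse E powr (1 / p - 1 / q)"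
    using assms unfolding C_const_def i by simp
  then have "C_const p q powr q = (p - 1) powr (- 1 / q * q) * inverse E powr ((1 / p - 1 / q) * q)"
    by (simp add: powr_mult powr_powr)
  also have "\<dots> = inverse (p - 1) * E powr (- r)"
    unfolding rq using assms(1,2) by (simp add: powr_minus ir)
  finally show ?thesis by (simp add: E_def divide_inverse mult.commute)
qed

lemma C_const_pos:
  assumes "1 < p" "p \<le> q"
  shows "0 < C_const p q"
proof (cases "p = q")
  case True
  then show ?thesis using assms by (simp add: C_const_def)
next
  case False
  then have q: "p < q" using assms by simp
  define r where "r = q / p - 1"
  have r0: "r > 0" unfolding r_def using assms q by (simp add: field_simps)
  define E where "E = Beta (1 / r) ((q - 1) / r) / r"
  have "0 < E" unfolding E_def using r0 assms by (intro bliss_energy_limit_pos) auto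
  then have "0 < E powr (- r) / (p - 1)" using assms by (intro divide_pos_pos) auto
  then have "0 < C_const p q powr q" using C_const_powr[OF assms(1) q r_def] by (simp add: E_def)
  moreover have "0 \<le> C_const p q" using assms by (auto simp: C_const_def)
  ultimately show ?thesis by (cases "C_const p q = 0") auto
qed


lemma (in primitive_data) average_integrand:
  assumes q: "0 \<le> q" "0 \<le> r"
  shows "(\<lambda>x. (F x / x) powr q * x powr r) integrable_on {0..X}"
    and "0 < integral {0..X} (\<lambda>x. (F x / x) powr q * x powr r)"
proof -
  define \<phi> where "\<phi> x = (F x / x) powr q * x powr r" for x
  note bnd = average_bounds
  have up: "\<phi> x \<le> B powr q * X powr r" if "0 < x" "x \<le> X" for x
    unfolding \<phi>_def using bnd[OF that] that q b by (intro mult_mono powr_mono2) auto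
  have cont: "continuous_on {0<..X} \<phi>"
    unfolding \<phi>_def
  proof (intro continuous_intros continuous_on_subset[OF contF] ballI)
    show "F x / x \<noteq> 0" if "x \<in> {0<..X}" for x using Fpos[of x] that by auto
  qed auto
  have int: "\<phi> integrable_on {0..X}"
    by (rule bounded_continuous_integrable[OF cont]) (use up in \<open>auto simp: \<phi>_def\<close>)
  then show "(\<lambda>x. (F x / x) powr q * x powr r) integrable_on {0..X}"
    by (simp add: \<phi>_def[abs_def])
  show "0 < integral {0..X} (\<lambda>x. (F x / x) powr q * x powr r)"
  proof -
    have I: "((\<lambda>s. b powr q * s powr r) has_integral (b powr q * (X powr (r + 1) / (r + 1)))) {0..X}"
      using has_integral_powr_from_0[of r X] X q by (intro has_integral_mult_right) simp
    have "b powr q * (X powr (r + 1) / (r + 1)) \<le> integral {0..X} \<phi>"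
    proof (rule has_integral_le[OF I integrable_integral[OF int]])
      fix x assume "x \<in> {0..X}"
      then show "b powr q * x powr r \<le> \<phi> x"
        unfolding \<phi>_def using bnd[of x] b q by (cases "x = 0") (auto intro!: mult_right_mono powr_mono2)
    qed
    moreover have "0 < b powr q * (X powr (r + 1) / (r + 1))" using b X q by auto
    ultimately show ?thesis by (simp add: \<phi>_def[abs_def])
  qed
qed

lemma bliss_boundary_tendsto:
  assumes "0 < r" "1 < n"
  shows "((\<lambda>y. y * bliss_avg r y powr n / n) \<longlongrightarrow> 0) at_top"
proof (rule tendsto_sandwich[OF _ _ tendsto_const])
  show "eventually (\<lambda>y. 0 \<le> y * bliss_avg r y powr n / n) at_top"
    using eventually_ge_at_top[of 0] by eventually_elim (use assms in auto)
  show "eventually (\<lambda>y. y * bliss_avg r y powr n / n \<le> y powr (- (n - 1)) / n) at_top"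
    using eventually_gt_at_top[of 0]
  proof eventually_elim
    case (elim y)
    have "bliss_avg r y powr n \<le> (y powr r) powr (- n / r)"
      unfolding bliss_avg_powr using elim assms by (intro powr_mono2') auto
    also have "\<dots> = y powr (- n)" using assms by (simp add: powr_powr)
    finally have "y * bliss_avg r y powr n \<le> y * y powr (- n)" using elim by (intro mult_left_mono) auto
    also have "\<dots> = y powr (- (n - 1))" using elim by (simp add: powr_mult_base)
    finally show ?case using assms by (intro divide_right_mono) auto
  qed
  have "((\<lambda>y::real. y powr (- (n - 1))) \<longlongrightarrow> 0) at_top"
    using assms by (intro tendsto_neg_powr filterlim_ident) auto
  then have "((\<lambda>y::real. y powr (- (n - 1)) / n) \<longlongrightarrow> 0 / n) at_top"
    using assms by (intro tendsto_intros) auto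
  then show "((\<lambda>y::real. y powr (- (n - 1)) / n) \<longlongrightarrow> 0) at_top" by simp
qed

text \<open>
  Multiplying \<open>F\<close> by a constant achieves any prescribed mass; the power of the constant that the
  energy picks up is the price.
\<close>

lemma (in primitive_data) bliss_transport_scaled:
  assumes q: "p < q" and r: "r = q / p - 1" and y: "0 < y"
    and I: "I = integral {0..X} (\<lambda>x. (F x / x) powr q * x powr r)"
  shows "bliss_energy q r y - p * (y * bliss_avg r y powr (q - r) / (q - r)) \<le> (bliss_mass q r y / I) powr (p / q) * Gp X"
proof -
  have r0: "r > 0" unfolding r using p q by (simp add: field_simps)
  have I0: "I > 0" unfolding I
    by (rule average_integrand(2)) (use p q r0 in auto)
  have H0: "bliss_mass q r y > 0" using bliss_mass_strict_mono[of r 0 y q] r0 y by (simp add: bliss_mass_def)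
  define c where "c = (bliss_mass q r y / I) powr (1 / q)"
  have c0: "c > 0" using I0 H0 by (simp add: c_def)
  have cq: "c powr q = bliss_mass q r y / I" using p q I0 H0 by (simp add: c_def powr_powr)
  have cp: "c powr p = (bliss_mass q r y / I) powr (p / q)" by (simp add: c_def powr_powr)
  interpret scaled: primitive_data p X "c * B" "c * b" S "\<lambda>x. c * F x" "\<lambda>x. c * g x" "\<lambda>x. c powr p * Gp x"
  proof (unfold_locales)
    show "1 < p" "0 < X" "countable S" by (fact p X S)+
    show "0 < c * b" using c0 b by simp
    show "continuous_on {0..X} (\<lambda>x. c * F x)" "continuous_on {0..X} (\<lambda>x. c powr p * Gp x)"
      by (intro continuous_intros contF contGp)+
    fix x
    show "((\<lambda>x. c * F x) has_real_derivative c * g x) (at x) \<and> 0 \<le> c * g x" if "0 < x" "x < X" "x \<notin> S"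
      using derF[OF that] c0 by (auto intro: DERIV_cmult)
    show "c * b * x \<le> c * F x \<and> c * F x \<le> c * B * x" if "0 \<le> x" "x \<le> X"
      using bF[OF that] c0 by (auto simp: mult.assoc)
    show "((\<lambda>x. c powr p * Gp x) has_real_derivative (c * g x) powr p) (at x)" if "0 < x" "x < X" "x \<notin> S"
      using DERIV_cmult[OF derGp[OF that], of "c powr p"] derF[OF that] c0 by (simp add: powr_mult)
    show "c powr p * Gp 0 = 0" by (simp add: Gp0)
  qed
  have "bliss_energy q r y - p * (y * bliss_avg r y powr (q - r) / (q - r)) \<le> c powr p * Gp X"
  proof (rule scaled.bliss_transport[OF q r refl y])
    have "integral {0..X} (\<lambda>x. (c * F x / x) powr q * x powr r) = integral {0..X} (\<lambda>x. c powr q * ((F x / x) powr q * x powr r))"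
    proof (rule integral_cong)
      fix x assume x: "x \<in> {0..X}"
      then have "0 \<le> b * x" using b by auto
      then have "0 \<le> F x / x" using bF[of x] x by (intro divide_nonneg_nonneg) auto
      then have "(c * (F x / x)) powr q = c powr q * (F x / x) powr q" using c0 by (subst powr_mult) auto
      then show "(c * F x / x) powr q * x powr r = c powr q * ((F x / x) powr q * x powr r)" by simp
    qed
    also have "\<dots> = c powr q * I" by (simp add: I)
    also have "\<dots> = bliss_mass q r y" using I0 by (simp add: cq)
    finally show "integral {0..X} (\<lambda>x. (c * F x / x) powr q * x powr r) = bliss_mass q r y" .
  qed
  then show ?thesis by (simp add: cp)
qed

lemma bliss_mass_tendsto:
  assumes r0: "0 < r" and n1: "1 < q - r" and limE: "(bliss_energy q r \<longlongrightarrow> E) at_top"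
  shows "(bliss_mass q r \<longlongrightarrow> E / (q - r - 1)) at_top"
proof -
  note limQ = bliss_boundary_tendsto[OF r0 n1]
  have Heq: "eventually (\<lambda>y. (bliss_energy q r y - (q - r) * (y * bliss_avg r y powr (q - r) / (q - r))) / (q - r - 1) = bliss_mass q r y) at_top"
    using eventually_ge_at_top[of 0]
  proof eventually_elim
    case (elim y)
    show ?case using n1 by (subst bliss_energy_mass[OF r0 n1 elim, of q]) (simp_all)
  qed
  have "((\<lambda>y. (bliss_energy q r y - (q - r) * (y * bliss_avg r y powr (q - r) / (q - r))) / (q - r - 1)) \<longlongrightarrow> (E - (q - r) * 0) / (q - r - 1)) at_top"
    using n1 by (intro tendsto_intros limE limQ) auto
  then show ?thesis
    using tendsto_cong[OF Heq] by simp
qed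

text \<open>
  For \<open>p < q\<close>, let the truncation point of the extremal in \<open>bliss_transport_scaled\<close> tend to infinity:
  the boundary term disappears, and the total mass is expressed by the total energy.
\<close>

lemma (in primitive_data) bliss_inequality_real:
  assumes q: "p \<le> q"
  shows "q / p * integral {0..X} (\<lambda>x. (F x / x) powr q * x powr (q / p - 1)) \<le> C_const p q powr q * Gp X powr (q / p)"
proof (cases "p = q")
  case True
  have "integral {0..X} (\<lambda>x. (F x / x) powr q * x powr (q / p - 1)) = integral {0..X} (\<lambda>x. (F x / x) powr p)"
    by (rule integral_cong) (use True p in \<open>auto simp: powr_def\<close>)
  also have "\<dots> \<le> (p / (p - 1)) powr p * Gp X"
    by (rule hardy_inequality_real)
  finally have *: "integral {0..X} (\<lambda>x. (F x / x) powr q * x powr (q / p - 1)) \<le> (p / (p - 1)) powr p * Gp X" .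
  have "(\<lambda>x. (F x / x) powr q * x powr (q / p - 1)) integrable_on {0..X}"
    by (rule average_integrand(1)) (use p q True in auto)
  then have "0 \<le> integral {0..X} (\<lambda>x. (F x / x) powr q * x powr (q / p - 1))"
    by (rule Henstock_Kurzweil_Integration.integral_nonneg) auto
  then have "0 \<le> (p / (p - 1)) powr p * Gp X" using * by linarith
  then have "0 \<le> Gp X" using p by (simp add: zero_le_mult_iff)
  then show ?thesis using * True p by (simp add: C_const_def)
next
  case False
  then have q: "p < q" using q by simp
  define r where "r = q / p - 1"
  have r0: "r > 0" unfolding r_def using p q by (simp add: field_simps)
  have pq: "q - r - 1 = q / p * (p - 1)" using p by (simp add: r_def field_simps)
  have "0 < q / p * (p - 1)" using p q by (intro mult_pos_pos divide_pos_pos) auto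
  then have n1: "q - r > 1" using pq by linarith
  define I where "I = integral {0..X} (\<lambda>x. (F x / x) powr q * x powr r)"
  have I0: "I > 0" unfolding I_def
    by (rule average_integrand(2)) (use p q r0 in auto)
  define E where "E = Beta (1 / r) ((q - 1) / r) / r"
  have E0: "E > 0" unfolding E_def using r0 p q by (intro bliss_energy_limit_pos) auto
  have limE: "(bliss_energy q r \<longlongrightarrow> E) at_top"
    unfolding E_def using r0 p q by (intro bliss_energy_tendsto) auto
  note limQ = bliss_boundary_tendsto[OF r0 n1]
  note limH = bliss_mass_tendsto[OF r0 n1 limE]
  have ev: "eventually (\<lambda>y. bliss_energy q r y - p * (y * bliss_avg r y powr (q - r) / (q - r)) \<le> (bliss_mass q r y / I) powr (p / q) * Gp X) at_top"
    using eventually_gt_at_top[of 0]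
    by eventually_elim (rule bliss_transport_scaled[OF q r_def _ I_def])
  have l1: "((\<lambda>y. bliss_energy q r y - p * (y * bliss_avg r y powr (q - r) / (q - r))) \<longlongrightarrow> E - p * 0) at_top"
    by (intro tendsto_intros limE limQ)
  have "E / (q - r - 1) / I > 0" using E0 n1 I0 by simp
  then have l2: "((\<lambda>y. (bliss_mass q r y / I) powr (p / q) * Gp X) \<longlongrightarrow> (E / (q - r - 1) / I) powr (p / q) * Gp X) at_top"
    using I0 by (intro tendsto_intros limH) auto
  have main: "E \<le> (E / (q - r - 1) / I) powr (p / q) * Gp X"
    using tendsto_le[OF _ l2 l1 ev] by simp
  have "0 < (E / (q - r - 1) / I) powr (p / q) * Gp X" using main E0 by linarith
  then have G0: "0 < Gp X" by (simp add: zero_less_mult_iff)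
  have "E powr (q / p) \<le> ((E / (q - r - 1) / I) powr (p / q) * Gp X) powr (q / p)"
    using main E0 p q by (intro powr_mono2) auto
  also have "\<dots> = (E / (q - r - 1) / I) * Gp X powr (q / p)"
    using G0 E0 n1 I0 p q by (subst powr_mult) (auto simp: powr_powr)
  finally have "E powr (q / p) \<le> (E / (q - r - 1) / I) * Gp X powr (q / p)" .
  then have "I * (q - r - 1) * E powr (q / p) \<le> I * (q - r - 1) * ((E / (q - r - 1) / I) * Gp X powr (q / p))"
    using I0 n1 by (intro mult_left_mono) auto
  also have "\<dots> = E * Gp X powr (q / p)" using I0 n1 by simp
  finally have "I * E powr (q / p) * (q - r - 1) \<le> E * Gp X powr (q / p)" by (simp only: mult_ac)
  moreover have "E powr (q / p) = E * E powr r" using E0 by (simp add: r_def powr_diff)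
  ultimately have "E * (I * E powr r * (q - r - 1)) \<le> E * Gp X powr (q / p)"
    by (simp only: mult_ac)
  then have "I * E powr r * (q - r - 1) \<le> Gp X powr (q / p)" using E0 by simp
  then have "q / p * I * (p - 1) * E powr r \<le> Gp X powr (q / p)" unfolding pq by (simp add: mult_ac)
  then have "q / p * I \<le> Gp X powr (q / p) / ((p - 1) * E powr r)"
    using p E0 by (subst pos_le_divide_eq) (auto simp: mult_ac)
  also have "\<dots> = E powr (- r) / (p - 1) * Gp X powr (q / p)"
    by (simp add: powr_minus_divide mult_ac)
  finally show ?thesis
    using C_const_powr[OF p q r_def] by (simp add: E_def I_def r_def)
qed

lemma antitone_integrable_powr:
  fixes g :: "real \<Rightarrow> real"
  assumes anti: "antimono g" and B: "\<And>x. 0 \<le> g x" "\<And>x. g x \<le> B" and s: "0 < s"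
  shows "(\<lambda>x. g x powr s) integrable_on {0..X}"
proof -
  have "mono (\<lambda>x. - (g x powr s))"
    using anti B s by (auto simp: mono_def antimono_def intro!: powr_mono2)
  then have "(\<lambda>x. - (g x powr s)) \<in> borel_measurable borel" by (rule borel_measurable_mono)
  then have "(\<lambda>x. - (- (g x powr s))) \<in> borel_measurable borel" by (rule borel_measurable_uminus)
  then have "(\<lambda>x. g x powr s) \<in> borel_measurable borel" by simp
  then have m: "(\<lambda>x. g x powr s) \<in> borel_measurable (lebesgue_on {0..X})"
    by (intro measurable_restrict_space1) (simp add: measurable_completion)
  show ?thesis
    by (rule measurable_bounded_by_integrable_imp_integrable[OF m, where g = "\<lambda>_. B powr s"])
       (use B s in \<open>auto intro!: powr_mono2\<close>)
qed

text \<open>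
  Monotonicity gives everything that \<open>primitive_data\<close> asks for: countably many discontinuities,
  and an average \<open>F x / x\<close> that decreases, hence stays above its value at \<open>X\<close>.
\<close>

lemma bliss_antitone:
  fixes p q X B :: real and g :: "real \<Rightarrow> real"
  assumes p: "1 < p" and q: "p \<le> q" and X: "0 < X"
    and anti: "antimono g" and B: "\<And>x. 0 \<le> g x" "\<And>x. g x \<le> B"
  defines "F \<equiv> \<lambda>x. integral {0..x} g"
  shows "q / p * integral {0..X} (\<lambda>x. (F x / x) powr q * x powr (q / p - 1))
      \<le> C_const p q powr q * integral {0..X} (\<lambda>x. g x powr p) powr (q / p)" (is ?A)
    and "(\<lambda>x. (F x / x) powr q * x powr (q / p - 1)) integrable_on {0..X}" (is ?B)
proof -
  have int: "g integrable_on {0..x}" for x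
    using antitone_integrable_powr[OF anti B, of 1 x] B(1) by simp
  have intp: "(\<lambda>x. g x powr p) integrable_on {0..x}" for x
    using antitone_integrable_powr[OF anti B, of p x] p by simp
  have contF: "continuous_on {0..X} F" unfolding F_def by (rule indefinite_integral_continuous_1[OF int])
  have F0: "0 \<le> F x" for x unfolding F_def using B by (intro Henstock_Kurzweil_Integration.integral_nonneg int) auto
  have low: "g x * x \<le> F x" if "0 \<le> x" for x
  proof -
    have "integral {0..x} (\<lambda>_. g x) \<le> integral {0..x} g"
      using anti by (intro integral_le int) (auto simp: antimono_def)
    then show ?thesis using that by (simp add: F_def mult.commute)
  qed
  have up: "F x \<le> B * x" if "0 \<le> x" for x
  proof -
    have "integral {0..x} g \<le> integral {0..x} (\<lambda>_. B)"
      using B by (intro integral_le int) auto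
    then show ?thesis using that by (simp add: F_def mult.commute)
  qed
  have avg: "F X / X * x \<le> F x" if x: "0 < x" "x \<le> X" for x
  proof -
    have ixX: "g integrable_on {x..X}" using int[of X] by (rule integrable_on_subinterval) (use x in auto)
    have "integral {x..X} g \<le> integral {x..X} (\<lambda>_. g x)"
      using anti by (intro integral_le ixX) (auto simp: antimono_def)
    moreover have "F x + integral {x..X} g = F X"
      unfolding F_def using x int by (intro Henstock_Kurzweil_Integration.integral_combine) auto
    ultimately have "F X \<le> F x + (X - x) * g x" using x by simp
    then have "F X * x \<le> F x * x + (X - x) * (g x * x)"
      using x mult_right_mono[of "F X" "F x + (X - x) * g x" x] by (simp add: algebra_simps)
    also have "\<dots> \<le> F x * x + (X - x) * F x"
      using low[of x] x by (intro add_left_mono mult_left_mono) auto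
    finally have "F X * x \<le> F x * X" by (simp add: algebra_simps)
    then show ?thesis using X by (simp add: field_simps)
  qed
  define S where "S = {x. \<not> isCont g x}"
  have "mono (\<lambda>x. - g x)" using anti by (auto simp: mono_def antimono_def)
  then have "countable {x. \<not> isCont (\<lambda>x. - g x) x}" by (rule mono_ctble_discont)
  moreover have "isCont (\<lambda>x. - g x) x \<longleftrightarrow> isCont g x" for x
    using isCont_minus[of x g] isCont_minus[of x "\<lambda>x. - g x"] by auto
  ultimately have S: "countable S" by (simp add: S_def)
  note der = indefinite_integral_deriv
  show ?A
  proof (cases "F X = 0")
    case True
    have "F x = 0" if "0 < x" "x \<le> X" for x
    proof -
      have "F x \<le> F X" unfolding F_def
        using that int B by (intro integral_subset_le) auto
      then show ?thesis using True F0[of x] by simp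
    qed
    then have "(F x / x) powr q * x powr (q / p - 1) = 0" if "x \<in> {0..X}" for x
      using that by (cases "x = 0") auto
    then have "integral {0..X} (\<lambda>x. (F x / x) powr q * x powr (q / p - 1)) = integral {0..X} (\<lambda>x. 0)"
      by (intro integral_cong)
    then show ?thesis by simp
  next
    case False
    interpret primitive_data p X B "F X / X" S F g "\<lambda>x. integral {0..x} (\<lambda>x. g x powr p)"
    proof (unfold_locales)
      show "1 < p" "0 < X" "countable S" "continuous_on {0..X} F" by (fact p X S contF)+
      show "0 < F X / X" using False F0[of X] X by simp
      show "continuous_on {0..X} (\<lambda>x. integral {0..x} (\<lambda>x. g x powr p))"
        by (rule indefinite_integral_continuous_1[OF intp])
      fix x
      show "(F has_real_derivative g x) (at x) \<and> 0 \<le> g x" if "0 < x" "x < X" "x \<notin> S"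
        using der[OF int, of x X] that B by (simp add: F_def S_def)
      show "F X / X * x \<le> F x \<and> F x \<le> B * x" if "0 \<le> x" "x \<le> X"
        using avg[of x] up[of x] that F0[of 0] by (cases "x = 0") auto
      show "((\<lambda>x. integral {0..x} (\<lambda>x. g x powr p)) has_real_derivative g x powr p) (at x)" if "0 < x" "x < X" "x \<notin> S"
      proof (rule der[OF intp _ that(1,2)])
        have "(g \<longlongrightarrow> g x) (at x)" using that by (simp add: S_def isCont_def)
        then have "((\<lambda>x. g x powr p) \<longlongrightarrow> g x powr p) (at x)"
          using B p by (intro tendsto_powr') auto
        then show "isCont (\<lambda>x. g x powr p) x" by (simp add: isCont_def)
      qed
    qed simp
    show ?thesis by (rule bliss_inequality_real[OF q])
  qed
  have cont: "continuous_on {0<..X} (\<lambda>x. (F x / x) powr q * x powr (q / p - 1))"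
    using p q F0 by (intro continuous_intros continuous_on_powr' continuous_on_subset[OF contF]) auto
  show ?B
  proof (rule bounded_continuous_integrable[OF cont])
    fix x assume x: "0 < x" "x \<le> X"
    then have "F x / x \<le> B" "0 \<le> F x / x" using up[of x] F0[of x] by (auto simp: field_simps)
    moreover have "0 \<le> q / p - 1" using p q by (simp add: field_simps)
    ultimately show "\<bar>(F x / x) powr q * x powr (q / p - 1)\<bar> \<le> B powr q * X powr (q / p - 1)"
      using x p q by (auto simp: abs_mult intro!: mult_mono powr_mono2)
  qed
qed

section \<open>Real powers of extended nonnegative numbers\<close>

lemma ennpowr_ennreal [simp]: "0 \<le> a \<Longrightarrow> ennpowr (ennreal a) r = ennreal (a powr r)"
  by (simp add: ennpowr_def)

lemma ennpowr_top [simp]: "ennpowr top r = top"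
  by (simp add: ennpowr_def infinity_ennreal_def)

lemma ennpowr_0 [simp]: "ennpowr 0 r = 0"
  by (simp add: ennpowr_def)

lemma ennpowr_mono: "0 \<le> r \<Longrightarrow> x \<le> y \<Longrightarrow> ennpowr x r \<le> ennpowr y r"
  by (cases x; cases y) (auto intro!: ennreal_leI powr_mono2 simp: top_unique)

lemma ennpowr_ennpowr: "0 < r \<Longrightarrow> ennpowr (ennpowr x r) s = ennpowr x (r * s)"
  by (cases x) (auto simp: powr_powr)

lemma ennpowr_1 [simp]: "ennpowr x 1 = x"
  by (cases x) auto

lemma ennpowr_inverse: "0 < r \<Longrightarrow> ennpowr (ennpowr x r) (1 / r) = x"
  "0 < r \<Longrightarrow> ennpowr (ennpowr x (1 / r)) r = x"
  by (simp_all add: ennpowr_ennpowr)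

lemma ennpowr_le_iff: "0 < r \<Longrightarrow> ennpowr x r \<le> y \<longleftrightarrow> x \<le> ennpowr y (1 / r)"
  using ennpowr_mono[of r x "ennpowr y (1 / r)"] ennpowr_mono[of "1 / r" "ennpowr x r" y]
  by (auto simp: ennpowr_inverse)

text \<open>
  For a positive exponent the power function is an order isomorphism of \<open>[0, \<infinity>]\<close>, so it commutes
  with arbitrary suprema.
\<close>

lemma ennpowr_SUP: "0 < r \<Longrightarrow> ennpowr (SUP i\<in>I. f i) r = (SUP i\<in>I. ennpowr (f i) r)"
proof (rule antisym)
  assume r: "0 < r"
  show "ennpowr (SUP i\<in>I. f i) r \<le> (SUP i\<in>I. ennpowr (f i) r)"
    unfolding ennpowr_le_iff[OF r]
    by (rule SUP_least) (auto simp: ennpowr_le_iff[OF r, symmetric] intro: SUP_upper)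
  show "(SUP i\<in>I. ennpowr (f i) r) \<le> ennpowr (SUP i\<in>I. f i) r"
    using r by (intro SUP_least ennpowr_mono SUP_upper) auto
qed

lemma ennpowr_mult: "0 < r \<Longrightarrow> ennpowr (x * y) r = ennpowr x r * ennpowr y r"
proof -
  assume r: "0 < r"
  have top: "ennpowr (top * z) r = top * ennpowr z r" for z
    by (cases "z = 0"; cases z) (auto simp: ennreal_mult_eq_top_iff ennreal_top_mult powr_eq_0_iff)
  show ?thesis
  proof (cases x; cases y)
    fix a b assume "x = ennreal a" "0 \<le> a" "y = ennreal b" "0 \<le> b"
    then show ?thesis by (simp add: powr_mult ennreal_mult[symmetric])
  qed (use top[of x] top[of y] in \<open>auto simp: mult.commute\<close>)
qed

lemma ennpowr_add: "0 \<le> s \<Longrightarrow> 0 \<le> t \<Longrightarrow> x \<noteq> 0 \<Longrightarrow> ennpowr x (s + t) = ennpowr x s * ennpowr x t"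
  by (cases x) (auto simp: powr_add ennreal_mult[symmetric])

lemma borel_measurable_ennpowr [measurable (raw)]:
  assumes f: "f \<in> borel_measurable M"
  shows "(\<lambda>x. ennpowr (f x) r) \<in> borel_measurable M"
  unfolding ennpowr_def
proof (rule measurable_If)
  show "{x \<in> space M. f x = \<infinity>} \<in> sets M"
    using measurable_sets[OF f, of "{\<infinity>}"] by (simp add: vimage_def Int_def conj_commute)
  show "(\<lambda>x. ennreal (enn2real (f x) powr r)) \<in> borel_measurable M"
    using f by measurable
qed simp

lemma ennreal_less_eq_sup: "(x::ennreal) \<le> y \<longleftrightarrow> (\<forall>n::nat. min x (of_nat n) \<le> y)"
proof
  assume *: "\<forall>n::nat. min x (of_nat n) \<le> y"
  show "x \<le> y"
  proof (rule ccontr)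
    assume "\<not> x \<le> y"
    then have "y < x" by simp
    then obtain n :: nat where "y < of_nat n"
      using ennreal_Ex_less_of_nat[of y] by (metis less_top order_less_le_trans top_greatest)
    then have "y < min x (of_nat n)" using \<open>y < x\<close> by simp
    then show False using *[rule_format, of n] by (meson leD)
  qed
qed (auto simp: min.coboundedI1)

lemma ennreal_SUP_min_of_nat: "(SUP n::nat. min x (of_nat n)) = (x::ennreal)"
  by (rule antisym) (auto intro!: SUP_least simp: ennreal_less_eq_sup[of x] intro: SUP_upper)

lemma nn_integral_powr_deriv:
  fixes y r :: real
  assumes "0 < r" "0 \<le> y"
  shows "(\<integral>\<^sup>+t. ennreal (r * t powr (r - 1)) * indicator {0<..<y} t \<partial>lborel) = ennreal (y powr r)"
proof -
  have "((\<lambda>t. t powr (r - 1)) has_integral (y powr (r - 1 + 1) / (r - 1 + 1))) {0..y}"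
    using assms by (intro has_integral_powr_from_0) auto
  then have "((\<lambda>t. r * t powr (r - 1)) has_integral (r * (y powr r / r))) {0..y}"
    by (intro has_integral_mult_right) simp
  then have "((\<lambda>t. r * t powr (r - 1)) has_integral (y powr r)) {0<..<y}"
    using assms by (simp add: has_integral_Icc_iff_Ioo)
  then show ?thesis
    using assms by (intro nn_integral_has_integral_lebesgue') auto
qed

text \<open>
  The layer cake formula is needed with both kinds of inequality: the strict one for sets on which
  averages exceed a level, the other one (below) for levels up to an average.
\<close>

lemma ennpowr_layer_cake_strict:
  assumes "0 < r"
  shows "ennpowr y r = (\<integral>\<^sup>+t. ennreal (r * t powr (r - 1)) * indicator {t. 0 < t \<and> ennreal t < y} t \<partial>lborel)"
proof (cases y)
  case (real a)
  then have "{t. 0 < t \<and> ennreal t < y} = {0<..<a}"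
    by (auto simp: ennreal_less_iff)
  then show ?thesis using nn_integral_powr_deriv[OF assms, of a] real by simp
next
  case top
  have "ennreal (real n powr r) \<le> (\<integral>\<^sup>+t. ennreal (r * t powr (r - 1)) * indicator {t. 0 < t \<and> ennreal t < y} t \<partial>lborel)" for n
    unfolding nn_integral_powr_deriv[OF assms, of "real n", symmetric, simplified]
    by (intro nn_integral_mono) (auto simp: top indicator_def)
  then have "(SUP n::nat. ennreal (real n powr r)) \<le> (\<integral>\<^sup>+t. ennreal (r * t powr (r - 1)) * indicator {t. 0 < t \<and> ennreal t < y} t \<partial>lborel)"
    by (intro SUP_least) auto
  moreover have "(SUP n::nat. ennreal (real n powr r)) = ennpowr (SUP n::nat. of_nat n) r"
    unfolding ennpowr_SUP[OF assms] by (simp add: ennreal_of_nat_eq_real_of_nat)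
  moreover have "(SUP n::nat. of_nat n :: ennreal) = top"
    using ennreal_SUP_min_of_nat[of top] by (simp add: min_def top_unique)
  ultimately show ?thesis by (simp add: top top_unique)
qed

lemma ennpowr_layer_cake:
  assumes "0 < r"
  shows "ennpowr y r = (\<integral>\<^sup>+t. ennreal (r * t powr (r - 1)) * indicator {t. 0 < t \<and> ennreal t \<le> y} t \<partial>lborel)"
  unfolding ennpowr_layer_cake_strict[OF assms]
proof (rule nn_integral_cong_AE)
  have "AE t in lborel. t \<noteq> enn2real y" by (rule AE_lborel_singleton)
  then show "AE t in lborel. ennreal (r * t powr (r - 1)) * indicator {t. 0 < t \<and> ennreal t < y} t
      = ennreal (r * t powr (r - 1)) * indicator {t. 0 < t \<and> ennreal t \<le> y} t"
    by eventually_elim (auto simp: indicator_def less_le)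
qed

section \<open>The inequality on the half-line\<close>

text \<open>
  The functions \<open>min G n\<close> are bounded, so \<open>bliss_antitone\<close> applies to them on \<open>{0..n}\<close>; monotone
  convergence removes the truncation of the values and of the interval at once.
\<close>

lemma bliss_inequality:
  fixes p q :: real and G :: "real \<Rightarrow> ennreal"
  assumes p: "1 < p" and q: "p \<le> q" and anti: "antimono G"
  shows "(\<integral>\<^sup>+x. ennreal (q / p * x powr (q / p - 1)) * ennpowr ((\<integral>\<^sup>+y. G y * indicator {0<..<x} y \<partial>lborel) / ennreal x) q
            * indicator {0<..} x \<partial>lborel)
      \<le> ennreal (C_const p q powr q) * ennpowr (\<integral>\<^sup>+x. ennpowr (G x) p * indicator {0<..} x \<partial>lborel) (q / p)"
proof -
  define g where "g n x = enn2real (min (G x) (of_nat n))" for n :: nat and x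
  have minf: "min (G x) (of_nat n) < top" for x n
    by (simp add: min_less_iff_disj of_nat_less_top)
  have g: "ennreal (g n x) = min (G x) (of_nat n)" for n x
    unfolding g_def using minf[of x n] by (rule ennreal_enn2real)
  have g0: "0 \<le> g n x" for n x by (simp add: g_def)
  have gB: "g n x \<le> real n" for n x
  proof -
    have "ennreal (g n x) \<le> ennreal (real n)" unfolding g by (simp add: ennreal_of_nat_eq_real_of_nat)
    then show ?thesis by (simp add: ennreal_le_iff)
  qed
  have ganti: "antimono (g n)" for n
  proof (rule antimonoI)
    fix x y :: real assume "x \<le> y"
    then have "ennreal (g n y) \<le> ennreal (g n x)"
      unfolding g using antimonoD[OF anti] by (intro min.mono) auto
    then show "g n y \<le> g n x" using g0 by (simp add: ennreal_le_iff)
  qed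
  have gm: "g n \<in> borel_measurable borel" for n
  proof -
    have "mono (\<lambda>x. - g n x)" using ganti[of n] by (auto simp: mono_def antimono_def)
    then have "(\<lambda>x. - (- g n x)) \<in> borel_measurable borel" by (intro borel_measurable_uminus borel_measurable_mono)
    then show ?thesis by simp
  qed
  have Gsup: "G x = (SUP n. ennreal (g n x))" for x
    unfolding g by (simp add: ennreal_SUP_min_of_nat)
  have ginc: "g n x \<le> g m x" if "n \<le> m" for n m x
  proof -
    have "ennreal (g n x) \<le> ennreal (g m x)"
      unfolding g using that by (intro min.mono) auto
    then show ?thesis using g0 by (simp add: ennreal_le_iff)
  qed
  define Fn where "Fn n x = (\<integral>\<^sup>+y. ennreal (g n y) * indicator {0<..<x} y \<partial>lborel)" for n x
  have FG: "(\<integral>\<^sup>+y. G y * indicator {0<..<x} y \<partial>lborel) = (SUP n. Fn n x)" for x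
  proof -
    have "(\<integral>\<^sup>+y. G y * indicator {0<..<x} y \<partial>lborel) = (\<integral>\<^sup>+y. (SUP n. ennreal (g n y) * indicator {0<..<x} y) \<partial>lborel)"
      by (intro nn_integral_cong) (simp add: Gsup SUP_mult_right_ennreal)
    also have "\<dots> = (SUP n. Fn n x)"
      unfolding Fn_def
    proof (rule nn_integral_monotone_convergence_SUP)
      show "incseq (\<lambda>n y. ennreal (g n y) * indicator {0<..<x} y)"
        by (auto simp: incseq_def le_fun_def intro!: mult_right_mono ennreal_leI ginc)
      show "(\<lambda>y. ennreal (g n y) * indicator {0<..<x} y) \<in> borel_measurable lborel" for n
        using gm[of n] by measurable
    qed
    finally show ?thesis .
  qed
  have Fnm: "Fn n \<in> borel_measurable borel" for n
  proof -
    have [measurable]: "g n \<in> borel_measurable borel" by (rule gm)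
    have "(\<lambda>x. \<integral>\<^sup>+y. ennreal (g n y) * indicator {z. 0 < snd z \<and> snd z < fst z} (x, y) \<partial>lborel) \<in> borel_measurable borel"
      by measurable
    moreover have "indicator {z. 0 < snd z \<and> snd z < fst z} (x, y) = (indicator {0<..<x} y :: ennreal)" for x y :: real
      by (auto simp: indicator_def)
    ultimately show ?thesis unfolding Fn_def[abs_def] by simp
  qed
  have Fninc: "Fn n x \<le> Fn m x" if "n \<le> m" for n m x
    unfolding Fn_def by (intro nn_integral_mono mult_right_mono ennreal_leI ginc that) auto
  define \<psi> where "\<psi> n x = ennreal (q / p * x powr (q / p - 1)) * ennpowr (Fn n x / ennreal x) q * indicator {0<..real n} x" for n x
  have q0: "0 < q" using p q by simp
  have psi_inc: "incseq \<psi>"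
    unfolding incseq_def le_fun_def \<psi>_def
  proof (intro allI impI mult_mono mult_left_mono ennpowr_mono divide_right_mono_ennreal Fninc)
    show "indicator {0<..real m} x \<le> (indicator {0<..real n} x :: ennreal)" if "m \<le> n" for m n :: nat and x
      using that by (auto simp: indicator_def)
  qed (use q0 in auto)
  have psi_m: "\<psi> n \<in> borel_measurable lborel" for n
    unfolding \<psi>_def[abs_def] using Fnm[of n] by measurable
  have lhs_eq: "ennreal (q / p * x powr (q / p - 1)) * ennpowr ((\<integral>\<^sup>+y. G y * indicator {0<..<x} y \<partial>lborel) / ennreal x) q
            * indicator {0<..} x \<le> (SUP n. \<psi> n x)" for x
  proof (cases "0 < x")
    case True
    obtain N :: nat where N: "x \<le> real N" using real_arch_simple by blast
    have "(SUP n. Fn n x) / ennreal x = (SUP n. Fn n x / ennreal x)"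
      unfolding divide_ennreal_def by (rule SUP_mult_right_ennreal)
    then have "ennreal (q / p * x powr (q / p - 1)) * ennpowr ((SUP n. Fn n x) / ennreal x) q
       = (SUP n. ennreal (q / p * x powr (q / p - 1)) * ennpowr (Fn n x / ennreal x) q)"
      by (simp add: SUP_mult_left_ennreal ennpowr_SUP[OF q0])
    also have "\<dots> \<le> (SUP n. \<psi> n x)"
    proof (rule SUP_mono)
      fix n
      have "ennreal (q / p * x powr (q / p - 1)) * ennpowr (Fn n x / ennreal x) q
         \<le> ennreal (q / p * x powr (q / p - 1)) * ennpowr (Fn (max n N) x / ennreal x) q"
        using q0 by (intro mult_left_mono ennpowr_mono divide_right_mono_ennreal Fninc) auto
      also have "\<dots> = \<psi> (max n N) x"
        unfolding \<psi>_def using True N by (auto simp: indicator_def)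
      finally show "\<exists>m\<in>UNIV. ennreal (q / p * x powr (q / p - 1)) * ennpowr (Fn n x / ennreal x) q \<le> \<psi> m x" by blast
    qed
    finally show ?thesis using True by (simp add: FG)
  qed simp
  define R where "R = ennreal (C_const p q powr q) * ennpowr (\<integral>\<^sup>+x. ennpowr (G x) p * indicator {0<..} x \<partial>lborel) (q / p)"
  have step: "(\<integral>\<^sup>+x. \<psi> n x \<partial>lborel) \<le> R" for n
  proof (cases "n = 0")
    case True
    then show ?thesis by (simp add: \<psi>_def)
  next
    case False
    define X where "X = real n"
    have X: "0 < X" using False by (simp add: X_def)
    define F where "F x = integral {0..x} (g n)" for x
    have int: "g n integrable_on {0..x}" for x
      using antitone_integrable_powr[OF ganti g0 gB, of 1 n x] g0 by simp
    have ip: "(\<lambda>x. g n x powr p) integrable_on {0..X}"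
      using antitone_integrable_powr[OF ganti g0 gB, of p n X] p by simp
    have FnF: "Fn n x = ennreal (F x)" if "0 < x" for x
    proof -
      have "(g n has_integral F x) {0<..<x}"
        unfolding F_def using integrable_integral[OF int] that by (simp add: has_integral_Icc_iff_Ioo)
      then show ?thesis unfolding Fn_def using g0 by (intro nn_integral_has_integral_lebesgue') auto
    qed
    have F0: "0 \<le> F x" for x unfolding F_def using g0 by (intro Henstock_Kurzweil_Integration.integral_nonneg int) auto
    have bl: "q / p * integral {0..X} (\<lambda>x. (F x / x) powr q * x powr (q / p - 1))
          \<le> C_const p q powr q * integral {0..X} (\<lambda>x. g n x powr p) powr (q / p)"
      "(\<lambda>x. (F x / x) powr q * x powr (q / p - 1)) integrable_on {0..X}"
      unfolding F_def by (rule bliss_antitone[OF p q X ganti g0 gB])+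
    let ?f = "\<lambda>x. q / p * ((F x / x) powr q * x powr (q / p - 1))"
    have "(\<integral>\<^sup>+x. \<psi> n x \<partial>lborel) = (\<integral>\<^sup>+x. ennreal (?f x) * indicator {0..X} x \<partial>lborel)"
    proof (rule nn_integral_cong)
      fix x :: real
      show "\<psi> n x = ennreal (?f x) * indicator {0..X} x"
      proof (cases "x \<in> {0<..X}")
        case True
        then have "ennpowr (Fn n x / ennreal x) q = ennreal ((F x / x) powr q)"
          using F0[of x] by (simp add: FnF divide_ennreal)
        then show ?thesis using True p q0
          by (simp add: \<psi>_def X_def ennreal_mult[symmetric] mult_ac)
      next
        case False
        then show ?thesis by (cases "x = 0") (auto simp: \<psi>_def X_def indicator_def)
      qed
    qed
    also have "\<dots> = ennreal (q / p * integral {0..X} (\<lambda>x. (F x / x) powr q * x powr (q / p - 1)))"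
      using p q0 by (intro nn_integral_has_integral_lebesgue' has_integral_mult_right integrable_integral bl(2)) auto
    also have "\<dots> \<le> ennreal (C_const p q powr q * integral {0..X} (\<lambda>x. g n x powr p) powr (q / p))"
      by (intro ennreal_leI bl(1))
    also have "\<dots> = ennreal (C_const p q powr q) * ennpowr (ennreal (integral {0..X} (\<lambda>x. g n x powr p))) (q / p)"
      using ip by (simp add: ennreal_mult Henstock_Kurzweil_Integration.integral_nonneg)
    also have "\<dots> \<le> R"
    proof -
      have "((\<lambda>x. g n x powr p) has_integral integral {0..X} (\<lambda>x. g n x powr p)) {0<..<X}"
        using integrable_integral[OF ip] by (simp add: has_integral_Icc_iff_Ioo)
      then have "ennreal (integral {0..X} (\<lambda>x. g n x powr p)) = (\<integral>\<^sup>+x. ennreal (g n x powr p) * indicator {0<..<X} x \<partial>lborel)"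
        by (intro nn_integral_has_integral_lebesgue'[symmetric]) auto
      also have "\<dots> \<le> (\<integral>\<^sup>+x. ennpowr (G x) p * indicator {0<..} x \<partial>lborel)"
      proof (rule nn_integral_mono)
        fix x :: real
        have "ennreal (g n x powr p) = ennpowr (ennreal (g n x)) p" using g0 by simp
        also have "\<dots> \<le> ennpowr (G x) p" unfolding g using p by (intro ennpowr_mono) auto
        finally show "ennreal (g n x powr p) * indicator {0<..<X} x \<le> ennpowr (G x) p * indicator {0<..} x"
          by (auto simp: indicator_def)
      qed
      finally show ?thesis unfolding R_def using p q0 by (intro mult_left_mono ennpowr_mono) auto
    qed
    finally show ?thesis .
  qed
  have "(\<integral>\<^sup>+x. ennreal (q / p * x powr (q / p - 1)) * ennpowr ((\<integral>\<^sup>+y. G y * indicator {0<..<x} y \<partial>lborel) / ennreal x) q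
            * indicator {0<..} x \<partial>lborel) \<le> (\<integral>\<^sup>+x. (SUP n. \<psi> n x) \<partial>lborel)"
    by (intro nn_integral_mono lhs_eq)
  also have "\<dots> = (SUP n. \<integral>\<^sup>+x. \<psi> n x \<partial>lborel)"
    by (rule nn_integral_monotone_convergence_SUP[OF psi_inc psi_m])
  also have "\<dots> \<le> R" by (intro SUP_least step)
  finally show ?thesis by (simp add: R_def)
qed

section \<open>Combinatorics of trees\<close>

lemma is_treeE:
  assumes "is_tree M T"
  obtains C where "\<And>Q. Q \<in> T \<Longrightarrow> C Q \<subseteq> T \<and> finite (C Q) \<and> disjoint (C Q) \<and> (\<forall>R\<in>C Q. R \<subseteq> Q) \<and> Q = \<Union> (C Q)"
    and "T = (\<Union>m. tree_level C (space M) m)" "T \<subseteq> sets M" "space M \<in> T" "\<And>Q. Q \<in> T \<Longrightarrow> 0 < measure M Q"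
  using assms unfolding is_tree_def by (elim conjE exE) metis

text \<open>
  All combinatorial facts about trees follow from these properties of the levels: each level is a
  finite disjoint family, and it refines the earlier ones.
\<close>

lemma tree_levels:
  fixes M :: "'a measure"
  assumes "is_tree M T"
  obtains \<L> :: "nat \<Rightarrow> 'a set set" where "T = (\<Union>m. \<L> m)" "\<And>m. finite (\<L> m)" "\<And>m. disjoint (\<L> m)"
    "\<And>m n R. m \<le> n \<Longrightarrow> R \<in> \<L> n \<Longrightarrow> \<exists>Q\<in>\<L> m. R \<subseteq> Q"
proof -
  from assms obtain C where C: "\<And>Q. Q \<in> T \<Longrightarrow> C Q \<subseteq> T \<and> finite (C Q) \<and> disjoint (C Q) \<and> (\<forall>R\<in>C Q. R \<subseteq> Q) \<and> Q = \<Union> (C Q)"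
    and T: "T = (\<Union>m. tree_level C (space M) m)" by (elim is_treeE) blast
  define \<L> where "\<L> = tree_level C (space M)"
  have LT: "\<L> m \<subseteq> T" for m unfolding T \<L>_def by blast
  have S: "\<L> (Suc m) = (\<Union>Q\<in>\<L> m. C Q)" "\<L> 0 = {space M}" for m by (simp_all add: \<L>_def)
  have fin: "finite (\<L> m)" for m
    by (induction m) (use C LT in \<open>auto simp: S\<close>)
  have dis: "disjoint (\<L> m)" for m
  proof (induction m)
    case 0
    show ?case by (simp add: S)
  next
    case (Suc m)
    show ?case unfolding disjoint_def
    proof (intro ballI impI)
      fix R R' assume "R \<in> \<L> (Suc m)" "R' \<in> \<L> (Suc m)" and ne: "R \<noteq> R'"
      then obtain Q Q' where Q: "Q \<in> \<L> m" "R \<in> C Q" "Q' \<in> \<L> m" "R' \<in> C Q'" by (auto simp: S)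
      then have QT: "Q \<in> T" "Q' \<in> T" using LT by auto
      show "R \<inter> R' = {}"
      proof (cases "Q = Q'")
        case True
        have "disjoint (C Q)" using C[OF QT(1)] by simp
        then show ?thesis using True Q ne by (simp add: disjoint_def)
      next
        case False
        then have "Q \<inter> Q' = {}" using Suc Q by (auto simp: disjoint_def)
        moreover have "R \<subseteq> Q" using C[OF QT(1)] Q(2) by simp
        moreover have "R' \<subseteq> Q'" using C[OF QT(2)] Q(4) by simp
        ultimately show ?thesis by blast
      qed
    qed
  qed
  have anc: "\<exists>Q\<in>\<L> m. R \<subseteq> Q" if "m \<le> n" "R \<in> \<L> n" for m n R
    using that
  proof (induction n arbitrary: R rule: dec_induct)
    case base
    then show ?case by blast
  next
    case (step n)
    then obtain Q where Q: "Q \<in> \<L> n" "R \<in> C Q" by (auto simp: S)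
    then have "Q \<in> T" using LT by auto
    then have "R \<subseteq> Q" using C[of Q] Q by simp
    moreover obtain A where "A \<in> \<L> m" "Q \<subseteq> A" using step.IH[OF Q(1)] by auto
    ultimately show ?case by auto
  qed
  show ?thesis using that[of \<L>] T fin dis anc by (auto simp: \<L>_def)
qed

lemma tree_nonempty: "is_tree M T \<Longrightarrow> Q \<in> T \<Longrightarrow> Q \<noteq> {}"
  unfolding is_tree_def by fastforce

lemma tree_countable:
  fixes M :: "'a measure"
  assumes "is_tree M T" shows "countable T"
proof -
  obtain \<L> :: "nat \<Rightarrow> 'a set set" where "T = (\<Union>m. \<L> m)" "\<And>m. finite (\<L> m)"
    using tree_levels[OF assms] by metis
  then have "countable (\<L> m)" for m by (simp add: countable_finite)
  then have "countable (\<Union>m\<in>UNIV. \<L> m)" by (intro countable_UN) auto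
  then show ?thesis using \<open>T = (\<Union>m. \<L> m)\<close> by simp
qed

lemma tree_nested:
  fixes M :: "'a measure"
  assumes "is_tree M T" "Q \<in> T" "R \<in> T" "Q \<inter> R \<noteq> {}"
  shows "Q \<subseteq> R \<or> R \<subseteq> Q"
proof -
  obtain \<L> :: "nat \<Rightarrow> 'a set set" where L: "T = (\<Union>m. \<L> m)" "\<And>m. disjoint (\<L> m)"
    "\<And>m n R. m \<le> n \<Longrightarrow> R \<in> \<L> n \<Longrightarrow> \<exists>Q\<in>\<L> m. R \<subseteq> Q"
    using tree_levels[OF assms(1)] by metis
  have *: "R \<subseteq> Q" if h: "Q \<in> \<L> m" "R \<in> \<L> n" "m \<le> n" "Q \<inter> R \<noteq> {}" for Q R m n
  proof -
    obtain A where A: "A \<in> \<L> m" "R \<subseteq> A" using L(3)[OF h(3,2)] by auto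
    then have "A = Q" using L(2)[of m] h by (auto simp: disjoint_def)
    then show ?thesis using A by simp
  qed
  obtain m n where "Q \<in> \<L> m" "R \<in> \<L> n" using assms L(1) by auto
  then show ?thesis using *[of Q m R n] *[of R n Q m] assms(4)
    by (cases "m \<le> n") (simp_all add: Int_commute)
qed

text \<open>
  A superset of \<open>Q\<close> that sits in a level below that of \<open>Q\<close> is contained in some set of the level of
  \<open>Q\<close>, which has to be \<open>Q\<close> since it contains a point of \<open>Q\<close>. So all supersets come from finitely many
  levels.
\<close>

lemma tree_finite_supersets:
  fixes M :: "'a measure"
  assumes "is_tree M T" "Q \<in> T"
  shows "finite {R \<in> T. Q \<subseteq> R}"
proof -
  obtain \<L> :: "nat \<Rightarrow> 'a set set" where L: "T = (\<Union>m. \<L> m)" "\<And>m. finite (\<L> m)" "\<And>m. disjoint (\<L> m)"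
    "\<And>m n R. m \<le> n \<Longrightarrow> R \<in> \<L> n \<Longrightarrow> \<exists>Q\<in>\<L> m. R \<subseteq> Q"
    using tree_levels[OF assms(1)] by metis
  obtain m where m: "Q \<in> \<L> m" using assms L(1) by auto
  have "R \<in> (\<Union>j\<le>m. \<L> j)" if R: "R \<in> T" "Q \<subseteq> R" for R
  proof -
    obtain n where n: "R \<in> \<L> n" using R L(1) by auto
    show ?thesis
    proof (cases "n \<le> m")
      case False
      then obtain A where A: "A \<in> \<L> m" "R \<subseteq> A" using L(4)[of m n R] n by auto
      have "A \<inter> Q \<noteq> {}" using A R tree_nonempty[OF assms] by blast
      then have "A = Q" using L(3)[of m] A m by (auto simp: disjoint_def)
      then show ?thesis using A R m by auto
    qed (use n in auto)
  qed
  then have "{R \<in> T. Q \<subseteq> R} \<subseteq> (\<Union>j\<le>m. \<L> j)" by auto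
  then show ?thesis by (rule finite_subset) (use L(2) in auto)
qed

definition maximal_members :: "'a set set \<Rightarrow> 'a set set" where
  "maximal_members \<S> = {R \<in> \<S>. \<forall>R'\<in>\<S>. R \<subseteq> R' \<longrightarrow> R' = R}"

lemma maximal_members_subset: "maximal_members \<S> \<subseteq> \<S>"
  by (auto simp: maximal_members_def)

text \<open>
  Only finitely many sets of the tree contain \<open>Q\<close>, so among those that belong to the subfamily one
  is maximal. This provides the stopping sets for the levels of averages in an arbitrary tree.
\<close>

lemma tree_maximal_members_cover:
  assumes "is_tree M T" "\<S> \<subseteq> T" "Q \<in> \<S>"
  obtains R where "R \<in> maximal_members \<S>" "Q \<subseteq> R"
proof -
  have fin: "finite {R \<in> \<S>. Q \<subseteq> R}"
    by (rule finite_subset[OF _ tree_finite_supersets[OF assms(1), of Q]]) (use assms in auto)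
  have QQ: "Q \<in> {R \<in> \<S>. Q \<subseteq> R}" using assms by simp
  obtain R where R0: "R \<in> {R \<in> \<S>. Q \<subseteq> R}" "\<forall>b\<in>{R \<in> \<S>. Q \<subseteq> R}. R \<subseteq> b \<longrightarrow> R = b"
    using finite_has_maximal2[OF fin QQ] by metis
  then have R: "R = b" if "b \<in> \<S>" "Q \<subseteq> b" "R \<subseteq> b" for b
    using that by auto
  from R0 have R12: "R \<in> \<S>" "Q \<subseteq> R" by auto
  have "R \<in> maximal_members \<S>"
    unfolding maximal_members_def
  proof (intro CollectI conjI ballI impI)
    fix R' assume "R' \<in> \<S>" "R \<subseteq> R'"
    then show "R' = R" using R[of R'] R12 by auto
  qed (rule R12)
  then show ?thesis using that R12 by auto
qed

lemma tree_maximal_members_disjoint: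
  assumes "is_tree M T" "\<S> \<subseteq> T" "R \<in> maximal_members \<S>" "R' \<in> maximal_members \<S>" "R \<noteq> R'"
  shows "R \<inter> R' = {}"
  using tree_nested[OF assms(1), of R R'] assms(2-) unfolding maximal_members_def by blast

lemma frac_max_measurable:
  assumes "countable T" "T \<subseteq> sets M"
  shows "frac_max M T \<alpha> f \<in> borel_measurable M"
proof -
  let ?c = "\<lambda>Q. ennreal (measure M Q powr \<alpha> * (1 / measure M Q)) * (\<integral>\<^sup>+y\<in>Q. ennreal \<bar>f y\<bar> \<partial>M)"
  have "frac_max M T \<alpha> f x = (SUP Q\<in>T. ?c Q * indicator Q x)" for x
  proof (rule antisym)
    show "frac_max M T \<alpha> f x \<le> (SUP Q\<in>T. ?c Q * indicator Q x)"
      unfolding frac_max_def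
    proof (rule SUP_least)
      fix Q assume "Q \<in> {Q \<in> T. x \<in> Q}"
      then show "?c Q \<le> (SUP Q\<in>T. ?c Q * indicator Q x)" by (intro SUP_upper2[of Q]) auto
    qed
    show "(SUP Q\<in>T. ?c Q * indicator Q x) \<le> frac_max M T \<alpha> f x"
    proof (rule SUP_least)
      fix Q assume "Q \<in> T"
      then show "?c Q * indicator Q x \<le> frac_max M T \<alpha> f x"
        unfolding frac_max_def by (cases "x \<in> Q") (auto intro: SUP_upper)
    qed
  qed
  then have "frac_max M T \<alpha> f = (\<lambda>x. SUP Q\<in>T. ?c Q * indicator Q x)" by auto
  moreover have "\<dots> \<in> borel_measurable M"
  proof (rule borel_measurable_SUP[OF assms(1)])
    fix Q assume "Q \<in> T"
    then have [measurable]: "Q \<in> sets M" using assms(2) by auto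
    show "(\<lambda>x. ?c Q * indicator Q x) \<in> borel_measurable M" by simp
  qed
  ultimately show ?thesis by simp
qed

section \<open>Rearrangement and level sets\<close>

lemma nn_integral_Ioo_indicator_le:
  fixes s :: real and D :: ennreal
  assumes "0 \<le> s"
  shows "(\<integral>\<^sup>+x. indicator {0<..<s} x * indicator {x. ennreal x < D} x \<partial>lborel) = min (ennreal s) D"
proof (cases "ennreal s \<le> D")
  case True
  have "(\<integral>\<^sup>+x. indicator {0<..<s} x * indicator {x. ennreal x < D} x \<partial>lborel) = (\<integral>\<^sup>+x. indicator {0<..<s} x \<partial>lborel)"
  proof (rule nn_integral_cong)
    fix x
    have "ennreal x < D" if "0 < x" "x < s"
      using that True by (meson ennreal_lessI less_le_trans order.strict_trans)
    then show "indicator {0<..<s} x * indicator {x. ennreal x < D} x = (indicator {0<..<s} x :: ennreal)"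
      by (auto simp: indicator_def)
  qed
  then show ?thesis using True assms by (simp add: min_def)
next
  case False
  then have "D < top" using ennreal_less_top[of s] by (metis not_le order.strict_trans)
  then obtain d where d: "D = ennreal d" "0 \<le> d" by (cases D) auto
  then have ds: "d < s" using False by (simp add: ennreal_le_iff)
  have "(\<integral>\<^sup>+x. indicator {0<..<s} x * indicator {x. ennreal x < D} x \<partial>lborel) = (\<integral>\<^sup>+x. indicator {0<..<d} x \<partial>lborel)"
    by (rule nn_integral_cong) (use d ds in \<open>auto simp: indicator_def ennreal_less_iff\<close>)
  then show ?thesis using False d by (simp add: min_def)
qed

text \<open>
  \<open>G\<close> is the decreasing rearrangement: \<open>G x\<close> is the length of the set of levels \<open>l\<close> at which the
  distribution function \<open>D\<close> of \<open>g\<close> exceeds \<open>x\<close>. In this form both properties are Fubini's theorem.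
  The first one is the estimate of \<open>S (E \<inter> {g > l})\<close> by \<open>min (S E) (D l)\<close>, and the second one holds
  because \<open>l < G x\<close> implies \<open>x < D l\<close>.
\<close>

lemma rearrangement_exists:
  fixes g :: "'a \<Rightarrow> real"
  assumes "finite_measure S" and g [measurable]: "g \<in> borel_measurable S" and g0: "\<And>x. x \<in> space S \<Longrightarrow> 0 \<le> g x" and p: "0 < p"
  obtains G :: "real \<Rightarrow> ennreal" where "antimono G" "G \<in> borel_measurable borel"
    and "\<And>E. E \<in> sets S \<Longrightarrow> (\<integral>\<^sup>+x\<in>E. ennreal (g x) \<partial>S) \<le> (\<integral>\<^sup>+y. G y * indicator {0<..<measure S E} y \<partial>lborel)"
    and "(\<integral>\<^sup>+x. ennpowr (G x) p * indicator {0<..} x \<partial>lborel) \<le> (\<integral>\<^sup>+x. ennreal (g x powr p) \<partial>S)"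
proof -
  interpret finite_measure S by fact
  interpret pair_sigma_finite S lborel by unfold_locales
  define D where "D l = emeasure S {x \<in> space S. l < g x}" for l
  define G where "G x = (\<integral>\<^sup>+l. indicator {0<..} l * indicator {l. ennreal x < D l} l \<partial>lborel)" for x
  have Dmono: "D l' \<le> D l" if "l \<le> l'" for l l'
    unfolding D_def by (intro emeasure_mono) (use that in auto)
  have Dm [measurable]: "D \<in> borel_measurable borel"
  proof -
    have "D = (\<lambda>l. \<integral>\<^sup>+x. indicator {z \<in> space (lborel \<Otimes>\<^sub>M S). fst z < g (snd z)} (l, x) \<partial>S)"
    proof
      fix l
      have "D l = (\<integral>\<^sup>+x. indicator {x \<in> space S. l < g x} x \<partial>S)" unfolding D_def by simp
      also have "\<dots> = (\<integral>\<^sup>+x. indicator {z \<in> space (lborel \<Otimes>\<^sub>M S). fst z < g (snd z)} (l, x) \<partial>S)"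
        by (rule nn_integral_cong) (auto simp: indicator_def space_pair_measure)
      finally show "D l = \<dots>" .
    qed
    moreover have "\<dots> \<in> borel_measurable lborel" by measurable
    ultimately show ?thesis by simp
  qed
  have anti: "antimono G"
  proof (rule antimonoI)
    fix x y :: real assume "x \<le> y"
    then have "ennreal x < D l" if "ennreal y < D l" for l
      using that ennreal_leI[of x y] by (meson le_less_trans)
    then show "G y \<le> G x" unfolding G_def
      by (intro nn_integral_mono mult_left_mono) (auto simp: indicator_def)
  qed
  have m2 [measurable]: "(\<lambda>(x, l). indicator {l. ennreal x < D l} l :: ennreal) \<in> borel_measurable (lborel \<Otimes>\<^sub>M lborel)"
  proof -
    have "(\<lambda>(x, l). indicator {l. ennreal x < D l} l :: ennreal) = indicator {z \<in> space (lborel \<Otimes>\<^sub>M lborel). ennreal (fst z) < D (snd z)}"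
      by (auto simp: indicator_def space_pair_measure)
    moreover have "\<dots> \<in> borel_measurable (lborel \<Otimes>\<^sub>M lborel)" by measurable
    ultimately show ?thesis by simp
  qed
  have Gm: "G \<in> borel_measurable borel"
  proof -
    have "(\<lambda>x. \<integral>\<^sup>+l. indicator {0<..} l * indicator {l. ennreal x < D l} l \<partial>lborel) \<in> borel_measurable lborel"
      using m2 by measurable
    then show ?thesis by (simp add: G_def[abs_def])
  qed
  have swap: "(\<integral>\<^sup>+x. G x * h x \<partial>lborel) = (\<integral>\<^sup>+l. indicator {0<..} l * (\<integral>\<^sup>+x. h x * indicator {x. ennreal x < D l} x \<partial>lborel) \<partial>lborel)"
    if [measurable]: "h \<in> borel_measurable borel" for h :: "real \<Rightarrow> ennreal"
  proof -
    have "(\<integral>\<^sup>+x. G x * h x \<partial>lborel) = (\<integral>\<^sup>+x. \<integral>\<^sup>+l. indicator {0<..} l * (h x * indicator {l. ennreal x < D l} l) \<partial>lborel \<partial>lborel)"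
    proof (rule nn_integral_cong)
      fix x
      have [measurable]: "(\<lambda>l. indicator {l. ennreal x < D l} l :: ennreal) \<in> borel_measurable borel" by measurable
      show "G x * h x = (\<integral>\<^sup>+l. indicator {0<..} l * (h x * indicator {l. ennreal x < D l} l) \<partial>lborel)"
        unfolding G_def by (subst nn_integral_multc[symmetric]) (auto simp: mult_ac)
    qed
    also have "\<dots> = (\<integral>\<^sup>+l. \<integral>\<^sup>+x. indicator {0<..} l * (h x * indicator {l. ennreal x < D l} l) \<partial>lborel \<partial>lborel)"
      by (rule lborel_pair.Fubini'[symmetric]) (use m2 in measurable)
    also have "\<dots> = (\<integral>\<^sup>+l. indicator {0<..} l * (\<integral>\<^sup>+x. h x * indicator {x. ennreal x < D l} x \<partial>lborel) \<partial>lborel)"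
    proof (rule nn_integral_cong)
      fix l
      have [measurable]: "(\<lambda>x. indicator {x. ennreal x < D l} x :: ennreal) \<in> borel_measurable borel" by measurable
      have "(\<integral>\<^sup>+x. indicator {0<..} l * (h x * indicator {l. ennreal x < D l} l) \<partial>lborel)
         = (\<integral>\<^sup>+x. indicator {0<..} l * (h x * indicator {x. ennreal x < D l} x) \<partial>lborel)"
        by (intro nn_integral_cong) (auto simp: indicator_def)
      also have "\<dots> = indicator {0<..} l * (\<integral>\<^sup>+x. h x * indicator {x. ennreal x < D l} x \<partial>lborel)"
        by (rule nn_integral_cmult) measurable
      finally show "(\<integral>\<^sup>+x. indicator {0<..} l * (h x * indicator {l. ennreal x < D l} l) \<partial>lborel) = \<dots>" .
    qed
    finally show ?thesis .
  qed
  have mg [measurable]: "(\<lambda>(x, l). indicator {l. 0 < l \<and> ennreal l < ennreal (g x)} l :: ennreal) \<in> borel_measurable (S \<Otimes>\<^sub>M lborel)"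
  proof -
    have "(\<lambda>(x, l). indicator {z \<in> space (S \<Otimes>\<^sub>M lborel). 0 < snd z \<and> ennreal (snd z) < ennreal (g (fst z))} (x, l) :: ennreal) \<in> borel_measurable (S \<Otimes>\<^sub>M lborel)"
      by measurable
    then show ?thesis
      by (rule measurable_cong[THEN iffD1, rotated]) (auto simp: indicator_def space_pair_measure)
  qed
  have layer: "(\<integral>\<^sup>+x. ennpowr (ennreal (g x)) c * indicator E x \<partial>S)
      = (\<integral>\<^sup>+l. ennreal (c * l powr (c - 1)) * indicator {0<..} l * emeasure S (E \<inter> {x \<in> space S. l < g x}) \<partial>lborel)"
    if E [measurable]: "E \<in> sets S" and c: "0 < c" for E c
  proof -
    have "(\<integral>\<^sup>+x. ennpowr (ennreal (g x)) c * indicator E x \<partial>S)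
       = (\<integral>\<^sup>+x. \<integral>\<^sup>+l. ennreal (c * l powr (c - 1)) * indicator {l. 0 < l \<and> ennreal l < ennreal (g x)} l * indicator E x \<partial>lborel \<partial>S)"
    proof (rule nn_integral_cong)
      fix x
      have "{l. 0 < l \<and> ennreal l < ennreal (g x)} = {0<..<g x}" by (auto simp: ennreal_less_iff)
      then have [measurable]: "(\<lambda>l. indicator {l. 0 < l \<and> ennreal l < ennreal (g x)} l :: ennreal) \<in> borel_measurable borel"
        by simp
      show "ennpowr (ennreal (g x)) c * indicator E x = (\<integral>\<^sup>+l. ennreal (c * l powr (c - 1)) * indicator {l. 0 < l \<and> ennreal l < ennreal (g x)} l * indicator E x \<partial>lborel)"
        unfolding ennpowr_layer_cake_strict[OF c] by (rule nn_integral_multc[symmetric]) measurable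
    qed
    also have "\<dots> = (\<integral>\<^sup>+l. \<integral>\<^sup>+x. ennreal (c * l powr (c - 1)) * indicator {l. 0 < l \<and> ennreal l < ennreal (g x)} l * indicator E x \<partial>S \<partial>lborel)"
      by (rule Fubini'[symmetric]) (use mg in measurable)
    also have "\<dots> = (\<integral>\<^sup>+l. ennreal (c * l powr (c - 1)) * indicator {0<..} l * emeasure S (E \<inter> {x \<in> space S. l < g x}) \<partial>lborel)"
    proof (rule nn_integral_cong)
      fix l :: real
      have [measurable]: "E \<inter> {x \<in> space S. l < g x} \<in> sets S" by measurable
      have "(\<integral>\<^sup>+x. ennreal (c * l powr (c - 1)) * indicator {l. 0 < l \<and> ennreal l < ennreal (g x)} l * indicator E x \<partial>S)
          = (\<integral>\<^sup>+x. ennreal (c * l powr (c - 1)) * indicator {0<..} l * indicator (E \<inter> {x \<in> space S. l < g x}) x \<partial>S)"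
        by (rule nn_integral_cong) (auto simp: indicator_def ennreal_less_iff)
      also have "\<dots> = ennreal (c * l powr (c - 1)) * indicator {0<..} l * emeasure S (E \<inter> {x \<in> space S. l < g x})"
        by (rule nn_integral_cmult_indicator) measurable
      finally show "(\<integral>\<^sup>+x. ennreal (c * l powr (c - 1)) * indicator {l. 0 < l \<and> ennreal l < ennreal (g x)} l * indicator E x \<partial>S) = \<dots>" .
    qed
    finally show ?thesis .
  qed
  show ?thesis
  proof (rule that[OF anti Gm])
    fix E assume E [measurable]: "E \<in> sets S"
    have "(\<integral>\<^sup>+x\<in>E. ennreal (g x) \<partial>S) = (\<integral>\<^sup>+l. ennreal (1 * l powr (1 - 1)) * indicator {0<..} l * emeasure S (E \<inter> {x \<in> space S. l < g x}) \<partial>lborel)"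
      using layer[OF E, of 1] by simp
    also have "\<dots> \<le> (\<integral>\<^sup>+l. indicator {0<..} l * min (ennreal (measure S E)) (D l) \<partial>lborel)"
    proof (rule nn_integral_mono)
      fix l :: real
      have "emeasure S (E \<inter> {x \<in> space S. l < g x}) \<le> min (ennreal (measure S E)) (D l)"
        unfolding D_def emeasure_eq_measure[symmetric] by (intro min.boundedI emeasure_mono) auto
      then show "ennreal (1 * l powr (1 - 1)) * indicator {0<..} l * emeasure S (E \<inter> {x \<in> space S. l < g x}) \<le> indicator {0<..} l * min (ennreal (measure S E)) (D l)"
        by (auto simp: indicator_def)
    qed
    also have "\<dots> = (\<integral>\<^sup>+y. G y * indicator {0<..<measure S E} y \<partial>lborel)"
      by (subst swap) (auto simp: nn_integral_Ioo_indicator_le)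
    finally show "(\<integral>\<^sup>+x\<in>E. ennreal (g x) \<partial>S) \<le> (\<integral>\<^sup>+y. G y * indicator {0<..<measure S E} y \<partial>lborel)" .
  next
    have Gl: "ennreal x < D l" if l: "0 < l" "ennreal l < G x" for x l
    proof (rule ccontr)
      assume n: "\<not> ennreal x < D l"
      have "G x \<le> (\<integral>\<^sup>+k. indicator {0<..<l} k \<partial>lborel)"
        unfolding G_def
      proof (rule nn_integral_mono)
        fix k
        have "\<not> ennreal x < D k" if "l \<le> k" using n Dmono[OF that] by (meson less_le_trans)
        then show "indicator {0<..} k * indicator {l. ennreal x < D l} k \<le> (indicator {0<..<l} k :: ennreal)"
          by (auto simp: indicator_def not_less)
      qed
      also have "\<dots> = ennreal l" using l by simp
      finally show False using l by simp
    qed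
    have "(\<integral>\<^sup>+x. ennpowr (G x) p * indicator {0<..} x \<partial>lborel)
       \<le> (\<integral>\<^sup>+x. \<integral>\<^sup>+l. ennreal (p * l powr (p - 1)) * indicator {0<..} l * indicator {0<..} x * indicator {l. ennreal x < D l} l \<partial>lborel \<partial>lborel)"
    proof (rule nn_integral_mono)
      fix x :: real
      have "ennpowr (G x) p \<le> (\<integral>\<^sup>+l. ennreal (p * l powr (p - 1)) * indicator {0<..} l * indicator {l. ennreal x < D l} l \<partial>lborel)"
        unfolding ennpowr_layer_cake_strict[OF p]
        by (rule nn_integral_mono) (use Gl in \<open>auto simp: indicator_def\<close>)
      then show "ennpowr (G x) p * indicator {0<..} x \<le> (\<integral>\<^sup>+l. ennreal (p * l powr (p - 1)) * indicator {0<..} l * indicator {0<..} x * indicator {l. ennreal x < D l} l \<partial>lborel)"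
        by (auto simp: indicator_def)
    qed
    also have "\<dots> = (\<integral>\<^sup>+l. \<integral>\<^sup>+x. ennreal (p * l powr (p - 1)) * indicator {0<..} l * indicator {0<..} x * indicator {l. ennreal x < D l} l \<partial>lborel \<partial>lborel)"
      by (rule lborel_pair.Fubini'[symmetric]) (use m2 in measurable)
    also have "\<dots> = (\<integral>\<^sup>+l. ennreal (p * l powr (p - 1)) * indicator {0<..} l * emeasure S (space S \<inter> {x \<in> space S. l < g x}) \<partial>lborel)"
    proof (rule nn_integral_cong)
      fix l :: real
      have fin: "D l = ennreal (measure S {x \<in> space S. l < g x})" by (simp add: D_def emeasure_eq_measure)
      have "(\<integral>\<^sup>+x. ennreal (p * l powr (p - 1)) * indicator {0<..} l * indicator {0<..} x * indicator {l. ennreal x < D l} l \<partial>lborel)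
         = (\<integral>\<^sup>+x. ennreal (p * l powr (p - 1)) * indicator {0<..} l * indicator {0<..<measure S {x \<in> space S. l < g x}} x \<partial>lborel)"
        by (rule nn_integral_cong) (auto simp: indicator_def fin ennreal_less_iff)
      also have "\<dots> = ennreal (p * l powr (p - 1)) * indicator {0<..} l * D l"
        by (subst nn_integral_cmult_indicator) (auto simp: fin)
      finally show "(\<integral>\<^sup>+x. ennreal (p * l powr (p - 1)) * indicator {0<..} l * indicator {0<..} x * indicator {l. ennreal x < D l} l \<partial>lborel)
         = ennreal (p * l powr (p - 1)) * indicator {0<..} l * emeasure S (space S \<inter> {x \<in> space S. l < g x})"
        by (simp add: D_def Int_def)
    qed
    also have "\<dots> = (\<integral>\<^sup>+x. ennpowr (ennreal (g x)) p * indicator (space S) x \<partial>S)"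
      by (rule layer[symmetric]) (use p in auto)
    also have "\<dots> = (\<integral>\<^sup>+x. ennreal (g x powr p) \<partial>S)"
      by (rule nn_integral_cong) (use g0 in auto)
    finally show "(\<integral>\<^sup>+x. ennpowr (G x) p * indicator {0<..} x \<partial>lborel) \<le> (\<integral>\<^sup>+x. ennreal (g x powr p) \<partial>S)" .
  qed
qed

lemma antimono_average_ennreal:
  fixes G :: "real \<Rightarrow> ennreal"
  assumes anti: "antimono G" and [measurable]: "G \<in> borel_measurable borel" and xs: "0 < x" "x \<le> s"
  shows "(\<integral>\<^sup>+y. G y * indicator {0<..<s} y \<partial>lborel) / ennreal s \<le> (\<integral>\<^sup>+y. G y * indicator {0<..<x} y \<partial>lborel) / ennreal x"
proof -
  let ?I = "\<integral>\<^sup>+y. G y * indicator {0<..<x} y \<partial>lborel"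
  let ?J = "\<integral>\<^sup>+y. G y * indicator {0<..<s} y \<partial>lborel"
  have "(\<integral>\<^sup>+y. G x * indicator {0<..<x} y \<partial>lborel) \<le> ?I"
    using antimonoD[OF anti] by (intro nn_integral_mono) (auto simp: indicator_def)
  then have low: "G x * ennreal x \<le> ?I" using xs by (simp add: nn_integral_cmult_indicator)
  have "?J \<le> (\<integral>\<^sup>+y. G y * indicator {0<..<x} y + G x * indicator {x..<s} y \<partial>lborel)"
    using antimonoD[OF anti] by (intro nn_integral_mono) (auto simp: indicator_def)
  also have "\<dots> = ?I + G x * ennreal (s - x)"
    using xs by (simp add: nn_integral_add nn_integral_cmult_indicator)
  finally have "?J * ennreal x \<le> (?I + G x * ennreal (s - x)) * ennreal x" by (intro mult_right_mono) auto
  also have "\<dots> = ?I * ennreal x + (G x * ennreal x) * ennreal (s - x)"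
    by (simp only: distrib_right mult.assoc mult.commute[of "ennreal (s - x)" "ennreal x"])
  also have "\<dots> \<le> ?I * ennreal x + ?I * ennreal (s - x)" by (intro add_left_mono mult_right_mono low) auto
  also have "\<dots> = ?I * ennreal s"
    using xs by (simp add: distrib_left[symmetric] ennreal_plus[symmetric] del: ennreal_plus)
  finally have *: "?J * ennreal x \<le> ?I * ennreal s" .
  have x: "ennreal x \<noteq> 0" "ennreal x \<noteq> top" and s: "0 < ennreal s" using xs by auto
  have "?J = ?J * ennreal x / ennreal x" using x by (simp add: mult_divide_eq_ennreal)
  also have "\<dots> \<le> ?I * ennreal s / ennreal x" by (intro divide_right_mono_ennreal *)
  also have "\<dots> = ?I / ennreal x * ennreal s" by (simp add: divide_ennreal_def mult_ac)
  finally show ?thesis using s by (intro divide_le_posI_ennreal) (auto simp: mult.commute)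
qed

text \<open>
  Write \<open>s t powr (q / p)\<close> as an integral over \<open>0 < x < s t\<close> and exchange the integrals. The
  hypothesis says that the average of \<open>G\<close> over \<open>(0, s t)\<close> is at least \<open>t\<close>; averages of a
  decreasing function decrease, so \<open>x < s t\<close> forces \<open>t\<close> to be at most the average over \<open>(0, x)\<close>.
\<close>

lemma layer_integral_le_average:
  fixes s :: "real \<Rightarrow> real" and G :: "real \<Rightarrow> ennreal"
  assumes p: "0 < p" and q: "0 < q" and anti: "antimono G" and Gm: "G \<in> borel_measurable borel"
    and sm [measurable]: "s \<in> borel_measurable borel" and s0: "\<And>t. 0 \<le> s t"
    and s: "\<And>t. 0 < t \<Longrightarrow> ennreal t * ennreal (s t) \<le> (\<integral>\<^sup>+y. G y * indicator {0<..<s t} y \<partial>lborel)"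
  shows "(\<integral>\<^sup>+t. ennreal (q * t powr (q - 1)) * indicator {0<..} t * ennreal (s t powr (q / p)) \<partial>lborel)
    \<le> (\<integral>\<^sup>+x. ennreal (q / p * x powr (q / p - 1)) * ennpowr ((\<integral>\<^sup>+y. G y * indicator {0<..<x} y \<partial>lborel) / ennreal x) q
            * indicator {0<..} x \<partial>lborel)"
proof -
  define a where "a x = (\<integral>\<^sup>+y. G y * indicator {0<..<x} y \<partial>lborel) / ennreal x" for x
  have qp: "0 < q / p" using p q by simp
  have key: "ennreal t \<le> a x" if "0 < t" "0 < x" "x < s t" for t x
  proof -
    have "ennreal t = ennreal t * ennreal (s t) / ennreal (s t)"
      using that by (subst mult_divide_eq_ennreal) auto
    also have "\<dots> \<le> a (s t)" unfolding a_def by (intro divide_right_mono_ennreal s that)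
    also have "\<dots> \<le> a x" unfolding a_def by (rule antimono_average_ennreal[OF anti Gm]) (use that in auto)
    finally show ?thesis .
  qed
  have m: "(\<lambda>(t, x). indicator {0<..<s t} x :: ennreal) \<in> borel_measurable (lborel \<Otimes>\<^sub>M lborel)"
  proof -
    have "(\<lambda>(t, x). indicator {0<..<s t} x :: ennreal) = indicator {z \<in> space (lborel \<Otimes>\<^sub>M lborel). 0 < snd z \<and> snd z < s (fst z)}"
      by (auto simp: indicator_def space_pair_measure)
    moreover have "\<dots> \<in> borel_measurable (lborel \<Otimes>\<^sub>M lborel)" by measurable
    ultimately show ?thesis by simp
  qed
  have "(\<integral>\<^sup>+t. ennreal (q * t powr (q - 1)) * indicator {0<..} t * ennreal (s t powr (q / p)) \<partial>lborel)
     = (\<integral>\<^sup>+t. \<integral>\<^sup>+x. ennreal (q * t powr (q - 1)) * indicator {0<..} t * (ennreal (q / p * x powr (q / p - 1)) * indicator {0<..<s t} x) \<partial>lborel \<partial>lborel)"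
    using nn_integral_powr_deriv[OF qp s0] by (intro nn_integral_cong) (simp add: nn_integral_cmult)
  also have "\<dots> = (\<integral>\<^sup>+x. \<integral>\<^sup>+t. ennreal (q * t powr (q - 1)) * indicator {0<..} t * (ennreal (q / p * x powr (q / p - 1)) * indicator {0<..<s t} x) \<partial>lborel \<partial>lborel)"
    by (rule lborel_pair.Fubini'[symmetric]) (use m in measurable)
  also have "\<dots> \<le> (\<integral>\<^sup>+x. ennreal (q / p * x powr (q / p - 1)) * ennpowr (a x) q * indicator {0<..} x \<partial>lborel)"
  proof (rule nn_integral_mono)
    fix x :: real
    have [measurable]: "{t. 0 < t \<and> ennreal t \<le> a x} \<in> sets borel" by measurable
    have "(\<integral>\<^sup>+t. ennreal (q * t powr (q - 1)) * indicator {0<..} t * (ennreal (q / p * x powr (q / p - 1)) * indicator {0<..<s t} x) \<partial>lborel)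
       \<le> (\<integral>\<^sup>+t. (ennreal (q / p * x powr (q / p - 1)) * indicator {0<..} x) * (ennreal (q * t powr (q - 1)) * indicator {t. 0 < t \<and> ennreal t \<le> a x} t) \<partial>lborel)"
      by (rule nn_integral_mono) (use key in \<open>auto simp: indicator_def mult_ac\<close>)
    also have "\<dots> = (ennreal (q / p * x powr (q / p - 1)) * indicator {0<..} x) * ennpowr (a x) q"
      unfolding ennpowr_layer_cake[OF q] by (rule nn_integral_cmult) measurable
    finally show "(\<integral>\<^sup>+t. ennreal (q * t powr (q - 1)) * indicator {0<..} t * (ennreal (q / p * x powr (q / p - 1)) * indicator {0<..<s t} x) \<partial>lborel)
       \<le> ennreal (q / p * x powr (q / p - 1)) * ennpowr (a x) q * indicator {0<..} x"
      by (simp add: mult_ac)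
  qed
  finally show ?thesis unfolding a_def .
qed

section \<open>The upper bound\<close>

text \<open>
  This is where \<open>p \<le> q\<close> enters the upper bound: each factor \<open>y i powr (r - 1)\<close> is at most the same
  power of the sum.
\<close>

lemma ennpowr_superadditive_sum:
  assumes "1 \<le> r"
  shows "(\<integral>\<^sup>+i. ennpowr (y i) r \<partial>count_space I) \<le> ennpowr (\<integral>\<^sup>+i. y i \<partial>count_space I) r"
proof -
  let ?Y = "\<integral>\<^sup>+i. y i \<partial>count_space I"
  have "(\<integral>\<^sup>+i. ennpowr (y i) r \<partial>count_space I) \<le> (\<integral>\<^sup>+i. y i * ennpowr ?Y (r - 1) \<partial>count_space I)"
  proof (rule nn_integral_mono)
    fix i assume "i \<in> space (count_space I)"
    then have le: "y i \<le> ?Y" by (intro nn_integral_ge_point) auto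
    show "ennpowr (y i) r \<le> y i * ennpowr ?Y (r - 1)"
    proof (cases "y i = 0")
      case False
      then have "ennpowr (y i) r = y i * ennpowr (y i) (r - 1)"
        using ennpowr_add[of 1 "r - 1" "y i"] assms by simp
      then show ?thesis using le assms by (auto intro!: mult_left_mono ennpowr_mono)
    qed simp
  qed
  also have "\<dots> = ?Y * ennpowr ?Y (r - 1)" by (rule nn_integral_multc) auto
  also have "\<dots> = ennpowr ?Y r"
  proof (cases "?Y = 0")
    case False
    then show ?thesis using ennpowr_add[of 1 "r - 1" ?Y] assms by simp
  qed simp
  finally show ?thesis .
qed

lemma tree_emeasure_Union:
  assumes tree: "is_tree M T" and S: "\<S> \<subseteq> T" and N: "sets N = sets M"
  shows "emeasure N (\<Union>\<S>) = (\<integral>\<^sup>+R. emeasure N R \<partial>count_space (maximal_members \<S>))"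
proof -
  have TM: "T \<subseteq> sets M" using tree by (simp add: is_tree_def)
  have cM: "countable (maximal_members \<S>)"
    by (rule countable_subset[OF _ tree_countable[OF tree]]) (use maximal_members_subset S in blast)
  have eq: "\<Union>\<S> = (\<Union>R\<in>maximal_members \<S>. R)"
  proof
    show "\<Union>\<S> \<subseteq> (\<Union>R\<in>maximal_members \<S>. R)"
    proof
      fix x assume "x \<in> \<Union>\<S>"
      then obtain Q where Q: "Q \<in> \<S>" "x \<in> Q" by auto
      obtain R where "R \<in> maximal_members \<S>" "Q \<subseteq> R"
        using tree_maximal_members_cover[OF tree S Q(1)] by metis
      then show "x \<in> (\<Union>R\<in>maximal_members \<S>. R)" using Q by auto
    qed
  qed (use maximal_members_subset in fastforce)
  show ?thesis unfolding eq
  proof (rule emeasure_UN_countable[OF _ cM])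
    show "R \<in> sets N" if "R \<in> maximal_members \<S>" for R
      using that maximal_members_subset[of \<S>] S TM N by auto
    show "disjoint_family_on (\<lambda>R. R) (maximal_members \<S>)"
      using tree_maximal_members_disjoint[OF tree S] by (auto simp: disjoint_family_on_def)
  qed
qed

text \<open>
  Each \<open>Q\<close> in the family lies in a maximal member \<open>R\<close>, and for a subset \<open>Q\<close> of \<open>R\<close> the bracket is one of
  the quantities whose supremum is the maximal function of \<open>\<sigma>\<close> restricted to \<open>R\<close>. So one application
  of the testing condition for each \<open>R\<close> suffices, and the \<open>R\<close> are disjoint.
\<close>

lemma frac_max_sublevel_testing:
  fixes M :: "'a measure" and u v :: "'a \<Rightarrow> real"
  assumes tree: "is_tree M T" and p: "1 < p" and q: "p \<le> q" and L: "0 < L"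
    and um [measurable]: "u \<in> borel_measurable M"
    and sm [measurable]: "(\<lambda>x. v x powr (1 - conj_exp p)) \<in> borel_measurable M"
    and test: "testing_condition M T \<alpha> p q L u v"
    and S: "\<S> \<subseteq> T"
  defines "\<sigma> \<equiv> \<lambda>x. v x powr (1 - conj_exp p)"
  shows "(\<integral>\<^sup>+x. (SUP Q\<in>\<S>. ennpowr (ennreal (measure M Q powr \<alpha> * (1 / measure M Q)) * emeasure (density M \<sigma>) Q) q * indicator Q x) * ennreal (u x) \<partial>M)
      \<le> ennreal (L powr q) * ennpowr (emeasure (density M \<sigma>) (\<Union>\<S>)) (q / p)"
proof -
  define W where "W = density M \<sigma>"
  have sm' [measurable]: "\<sigma> \<in> borel_measurable M" using sm by (simp add: \<sigma>_def)
  define \<M> where "\<M> = maximal_members \<S>"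
  have MS: "\<M> \<subseteq> \<S>" by (simp add: \<M>_def maximal_members_subset)
  have TM: "T \<subseteq> sets M" using tree by (simp add: is_tree_def)
  have cT: "countable T" by (rule tree_countable[OF tree])
  have cM: "countable \<M>" by (rule countable_subset[OF _ cT]) (use MS S in auto)
  have Mm: "R \<in> sets M" if "R \<in> \<M>" for R using that MS S TM by auto
  have q0: "0 < q" using p q by simp
  define h where "h R x = ennpowr (frac_max M T \<alpha> (\<lambda>y. indicator R y * \<sigma> y) x) q * ennreal (u x) * indicator R x" for R x
  have hm [measurable]: "h R \<in> borel_measurable M" if "R \<in> \<M>" for R
  proof -
    have [measurable]: "R \<in> sets M" by (rule Mm[OF that])
    have [measurable]: "frac_max M T \<alpha> (\<lambda>y. indicator R y * \<sigma> y) \<in> borel_measurable M"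
      by (rule frac_max_measurable[OF cT TM])
    show ?thesis unfolding h_def by measurable
  qed
  have emW: "emeasure W Q = (\<integral>\<^sup>+x\<in>Q. ennreal (\<sigma> x) \<partial>M)" if "Q \<in> sets M" for Q
    unfolding W_def using that by (simp add: emeasure_density)
  have pt: "(SUP Q\<in>\<S>. ennpowr (ennreal (measure M Q powr \<alpha> * (1 / measure M Q)) * emeasure W Q) q * indicator Q x) * ennreal (u x)
      \<le> (\<integral>\<^sup>+R. h R x \<partial>count_space \<M>)" for x
  proof -
    have "ennpowr (ennreal (measure M Q powr \<alpha> * (1 / measure M Q)) * emeasure W Q) q * indicator Q x * ennreal (u x)
      \<le> (\<integral>\<^sup>+R. h R x \<partial>count_space \<M>)" if Q: "Q \<in> \<S>" for Q
    proof (cases "x \<in> Q")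
      case True
      obtain R where R: "R \<in> maximal_members \<S>" "Q \<subseteq> R"
        using tree_maximal_members_cover[OF tree S Q] by metis
      have QT: "Q \<in> T" "Q \<in> sets M" using Q S TM by auto
      have "emeasure W Q = (\<integral>\<^sup>+y\<in>Q. ennreal \<bar>indicator R y * \<sigma> y\<bar> \<partial>M)"
        unfolding emW[OF QT(2)]
        by (rule nn_integral_cong) (use R in \<open>auto simp: indicator_def \<sigma>_def\<close>)
      then have "ennreal (measure M Q powr \<alpha> * (1 / measure M Q)) * emeasure W Q \<le> frac_max M T \<alpha> (\<lambda>y. indicator R y * \<sigma> y) x"
        unfolding frac_max_def using QT True by (intro SUP_upper2[of Q]) auto
      then have "ennpowr (ennreal (measure M Q powr \<alpha> * (1 / measure M Q)) * emeasure W Q) q \<le> ennpowr (frac_max M T \<alpha> (\<lambda>y. indicator R y * \<sigma> y) x) q"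
        using q0 by (intro ennpowr_mono) auto
      then have "ennpowr (ennreal (measure M Q powr \<alpha> * (1 / measure M Q)) * emeasure W Q) q * indicator Q x * ennreal (u x) \<le> h R x"
        unfolding h_def using True subsetD[OF R(2) True] by (simp add: mult_right_mono)
      also have "\<dots> \<le> (\<integral>\<^sup>+R. h R x \<partial>count_space \<M>)"
        by (rule nn_integral_ge_point) (use R in \<open>simp add: \<M>_def\<close>)
      finally show ?thesis .
    qed simp
    then show ?thesis
      unfolding SUP_mult_right_ennreal by (intro SUP_least)
  qed
  have each: "(\<integral>\<^sup>+x. h R x \<partial>M) \<le> ennreal (L powr q) * ennpowr (emeasure W R) (q / p)" if "R \<in> \<M>" for R
  proof -
    have RT: "R \<in> T" using that MS S by auto
    then have "ennpowr (\<integral>\<^sup>+x. h R x \<partial>M) (1 / q) \<le> ennreal L * ennpowr (emeasure W R) (1 / p)"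
      using test TM unfolding testing_condition_def h_def \<sigma>_def[symmetric] by (simp add: emW \<sigma>_def subset_eq)
    then have "ennpowr (ennpowr (\<integral>\<^sup>+x. h R x \<partial>M) (1 / q)) q \<le> ennpowr (ennreal L * ennpowr (emeasure W R) (1 / p)) q"
      using q0 by (intro ennpowr_mono) auto
    then show ?thesis
      using q0 p L by (simp add: ennpowr_inverse ennpowr_mult ennpowr_ennpowr)
  qed
  have "(\<integral>\<^sup>+x. (SUP Q\<in>\<S>. ennpowr (ennreal (measure M Q powr \<alpha> * (1 / measure M Q)) * emeasure W Q) q * indicator Q x) * ennreal (u x) \<partial>M)
      \<le> (\<integral>\<^sup>+x. \<integral>\<^sup>+R. h R x \<partial>count_space \<M> \<partial>M)"
    by (intro nn_integral_mono pt)
  also have "\<dots> = (\<integral>\<^sup>+R. \<integral>\<^sup>+x. h R x \<partial>M \<partial>count_space \<M>)"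
    by (rule nn_integral_count_space_nn_integral[OF cM hm])
  also have "\<dots> \<le> (\<integral>\<^sup>+R. ennreal (L powr q) * ennpowr (emeasure W R) (q / p) \<partial>count_space \<M>)"
    by (intro nn_integral_mono each) simp
  also have "\<dots> = ennreal (L powr q) * (\<integral>\<^sup>+R. ennpowr (emeasure W R) (q / p) \<partial>count_space \<M>)"
    by (rule nn_integral_cmult) simp
  also have "\<dots> \<le> ennreal (L powr q) * ennpowr (\<integral>\<^sup>+R. emeasure W R \<partial>count_space \<M>) (q / p)"
    using p q by (intro mult_left_mono ennpowr_superadditive_sum) auto
  also have "(\<integral>\<^sup>+R. emeasure W R \<partial>count_space \<M>) = emeasure W (\<Union>\<S>)"
    unfolding \<M>_def by (rule tree_emeasure_Union[OF tree S, symmetric]) (simp add: W_def)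
  finally show ?thesis unfolding W_def .
qed

text \<open>
  The slicing argument described at the beginning. \<open>W\<close> and \<open>F\<close> are the measures with densities
  \<open>\<sigma>\<close> and \<open>\<bar>f\<bar>\<close>, so \<open>A Q = F Q / W Q\<close> is the \<open>\<sigma>\<close>-average of \<open>\<bar>f\<bar> / \<sigma>\<close>, and \<open>s t\<close> is the \<open>W\<close>-measure of the
  union of all \<open>Q\<close> with \<open>A Q > t\<close>.
\<close>

lemma frac_max_strong_type:
  fixes M :: "'a measure" and u v f :: "'a \<Rightarrow> real"
  assumes "prob_space M" and tree: "is_tree M T" and p: "1 < p" and q: "p \<le> q" and L: "0 < L"
    and wu: "weight M u" and wv: "weight M v" and ws: "weight M (\<lambda>x. v x powr (1 - conj_exp p))"
    and test: "testing_condition M T \<alpha> p q L u v"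
    and fm [measurable]: "f \<in> borel_measurable M"
  shows "(\<integral>\<^sup>+x. ennpowr (frac_max M T \<alpha> f x) q * ennreal (u x) \<partial>M)
     \<le> ennreal ((C_const p q * L) powr q) * ennpowr (\<integral>\<^sup>+x. ennpowr (ennreal \<bar>f x\<bar>) p * ennreal (v x) \<partial>M) (q / p)"
proof -
  interpret M: prob_space M by fact
  define \<sigma> where "\<sigma> = (\<lambda>x. v x powr (1 - conj_exp p))"
  have q0: "0 < q" using p q by simp
  have TM: "T \<subseteq> sets M" using tree by (simp add: is_tree_def)
  have cT: "countable T" by (rule tree_countable[OF tree])
  have um [measurable]: "u \<in> borel_measurable M" and vm [measurable]: "v \<in> borel_measurable M"
    and sm [measurable]: "\<sigma> \<in> borel_measurable M" and sint: "integrable M \<sigma>"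
    using wu wv ws by (auto simp: weight_def \<sigma>_def)
  have vpos: "v x > 0" and spos: "\<sigma> x > 0" if "x \<in> space M" for x
    using wv ws that by (auto simp: weight_def \<sigma>_def)
  define W where "W = density M (\<lambda>x. ennreal (\<sigma> x))"
  have setsW [simp]: "sets W = sets M" and spaceW [simp]: "space W = space M" by (simp_all add: W_def)
  have W: "emeasure W Q = (\<integral>\<^sup>+x\<in>Q. ennreal (\<sigma> x) \<partial>M)" if "Q \<in> sets M" for Q
    unfolding W_def using that by (simp add: emeasure_density)
  interpret W: finite_measure W
  proof
    have "emeasure W (space W) = (\<integral>\<^sup>+x. ennreal (\<sigma> x) \<partial>M)"
      by (simp add: W)
    also have "\<dots> < \<infinity>" using sint by (simp add: \<sigma>_def integrable_iff_bounded)
    finally show "emeasure W (space W) \<noteq> \<infinity>" by simp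
  qed
  define F where "F = density M (\<lambda>x. ennreal \<bar>f x\<bar>)"
  have setsF [simp]: "sets F = sets M" by (simp add: F_def)
  have F: "emeasure F Q = (\<integral>\<^sup>+x\<in>Q. ennreal \<bar>f x\<bar> \<partial>M)" if "Q \<in> sets M" for Q
    unfolding F_def using that by (simp add: emeasure_density)
  define A where "A Q = emeasure F Q / emeasure W Q" for Q
  define c where "c Q = ennreal (measure M Q powr \<alpha> * (1 / measure M Q))" for Q
  define b where "b Q = ennpowr (c Q * emeasure W Q) q" for Q
  have W0: "emeasure W Q \<noteq> 0" "emeasure W Q \<noteq> top" if "Q \<in> T" for Q
  proof -
    have Q: "Q \<in> sets M" "0 < measure M Q" using that tree by (auto simp: is_tree_def)
    show "emeasure W Q \<noteq> top" by (simp add: W.emeasure_eq_measure)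
    show "emeasure W Q \<noteq> 0"
    proof
      assume "emeasure W Q = 0"
      then have "AE x in M. ennreal (\<sigma> x) * indicator Q x = 0"
        using Q by (simp add: W nn_integral_0_iff_AE)
      then have "AE x in M. x \<notin> Q"
      proof (rule AE_mp, intro AE_I2 impI notI)
        fix x assume x: "x \<in> space M" "ennreal (\<sigma> x) * indicator Q x = 0" "x \<in> Q"
        then have "\<sigma> x \<le> 0" by (simp add: ennreal_eq_0_iff)
        then show False using spos[OF x(1)] by simp
      qed
      then have "measure M Q = 0" using Q M.prob_eq_0 by blast
      then show False using Q by simp
    qed
  qed
  define K where "K t = ennreal (q * t powr (q - 1)) * indicator {0<..} t" for t :: real
  have Km [measurable]: "K \<in> borel_measurable borel" unfolding K_def by measurable
  define H where "H x t = (SUP Q\<in>T. b Q * indicator Q x * indicator {t. ennreal t < A Q} t)" for x and t :: real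
  have Hm [measurable]: "(\<lambda>(x, t). H x t) \<in> borel_measurable (M \<Otimes>\<^sub>M lborel)"
  proof -
    have "(\<lambda>z. SUP Q\<in>T. b Q * indicator Q (fst z) * indicator {t. ennreal t < A Q} (snd z)) \<in> borel_measurable (M \<Otimes>\<^sub>M lborel)"
    proof (rule borel_measurable_SUP[OF cT])
      fix Q assume "Q \<in> T"
      then have [measurable]: "Q \<in> sets M" using TM by auto
      have [measurable]: "{t. ennreal t < A Q} \<in> sets borel" by measurable
      show "(\<lambda>z. b Q * indicator Q (fst z) * indicator {t. ennreal t < A Q} (snd z)) \<in> borel_measurable (M \<Otimes>\<^sub>M lborel)"
        by measurable
    qed
    then show ?thesis by (simp add: H_def case_prod_unfold)
  qed
  have ptw: "ennpowr (frac_max M T \<alpha> f x) q \<le> (\<integral>\<^sup>+t. K t * H x t \<partial>lborel)" for x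
  proof -
    have "ennpowr (c Q * (\<integral>\<^sup>+y\<in>Q. ennreal \<bar>f y\<bar> \<partial>M)) q \<le> (\<integral>\<^sup>+t. K t * H x t \<partial>lborel)" if Q: "Q \<in> T" "x \<in> Q" for Q
    proof -
      have [measurable]: "{t. 0 < t \<and> ennreal t < A Q} \<in> sets borel" by measurable
      have "emeasure F Q = emeasure W Q * A Q"
        unfolding A_def using W0[OF Q(1)] by (simp add: ennreal_times_divide mult.commute mult_divide_eq_ennreal)
      then have "c Q * (\<integral>\<^sup>+y\<in>Q. ennreal \<bar>f y\<bar> \<partial>M) = (c Q * emeasure W Q) * A Q"
        using F[of Q] Q TM by (auto simp: mult.assoc)
      then have "ennpowr (c Q * (\<integral>\<^sup>+y\<in>Q. ennreal \<bar>f y\<bar> \<partial>M)) q = b Q * ennpowr (A Q) q"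
        using q0 by (simp add: ennpowr_mult b_def)
      also have "\<dots> = (\<integral>\<^sup>+t. b Q * (ennreal (q * t powr (q - 1)) * indicator {t. 0 < t \<and> ennreal t < A Q} t) \<partial>lborel)"
        unfolding ennpowr_layer_cake_strict[OF q0] by (rule nn_integral_cmult[symmetric]) measurable
      also have "\<dots> \<le> (\<integral>\<^sup>+t. K t * H x t \<partial>lborel)"
      proof (rule nn_integral_mono)
        fix t :: real
        have "b Q * indicator Q x * indicator {t. ennreal t < A Q} t \<le> H x t"
          unfolding H_def using Q by (intro SUP_upper)
        then have "K t * (b Q * indicator Q x * indicator {t. ennreal t < A Q} t) \<le> K t * H x t"
          by (intro mult_left_mono) auto
        moreover have "b Q * (ennreal (q * t powr (q - 1)) * indicator {t. 0 < t \<and> ennreal t < A Q} t)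
            = K t * (b Q * indicator Q x * indicator {t. ennreal t < A Q} t)"
          using Q by (auto simp: K_def indicator_def mult_ac)
        ultimately show "b Q * (ennreal (q * t powr (q - 1)) * indicator {t. 0 < t \<and> ennreal t < A Q} t) \<le> K t * H x t" by simp
      qed
      finally show ?thesis .
    qed
    then show ?thesis
      unfolding frac_max_def ennpowr_SUP[OF q0] c_def[symmetric] by (intro SUP_least) auto
  qed
  define \<S> where "\<S> t = {Q \<in> T. ennreal t < A Q}" for t
  have ST: "\<S> t \<subseteq> T" for t by (auto simp: \<S>_def)
  have US: "\<Union>(\<S> t) \<in> sets M" for t
    using countable_subset[OF ST cT] ST TM by (intro sets.countable_Union) auto
  have Hint: "(\<integral>\<^sup>+x. H x t * ennreal (u x) \<partial>M) \<le> ennreal (L powr q) * ennpowr (emeasure W (\<Union>(\<S> t))) (q / p)" for t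
  proof -
    have "H x t \<le> (SUP Q\<in>\<S> t. b Q * indicator Q x)" for x
      unfolding H_def
    proof (rule SUP_least)
      fix Q assume "Q \<in> T"
      then show "b Q * indicator Q x * indicator {t. ennreal t < A Q} t \<le> (SUP Q\<in>\<S> t. b Q * indicator Q x)"
        by (cases "Q \<in> \<S> t") (auto simp: \<S>_def intro: SUP_upper2)
    qed
    then have "(\<integral>\<^sup>+x. H x t * ennreal (u x) \<partial>M) \<le> (\<integral>\<^sup>+x. (SUP Q\<in>\<S> t. b Q * indicator Q x) * ennreal (u x) \<partial>M)"
      by (intro nn_integral_mono mult_right_mono) auto
    also have "\<dots> \<le> ennreal (L powr q) * ennpowr (emeasure W (\<Union>(\<S> t))) (q / p)"
      unfolding b_def c_def W_def \<sigma>_def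
      by (rule frac_max_sublevel_testing[OF tree p q L um _ test ST]) (use sm in \<open>simp add: \<sigma>_def\<close>)
    finally show ?thesis .
  qed
  define s where "s t = measure W (\<Union>(\<S> t))" for t
  have es: "emeasure W (\<Union>(\<S> t)) = ennreal (s t)" for t by (simp add: s_def W.emeasure_eq_measure)
  have s0: "0 \<le> s t" for t by (simp add: s_def)
  have "mono (\<lambda>t. - s t)"
  proof (rule monoI)
    fix t t' :: real assume "t \<le> t'"
    then have "\<S> t' \<subseteq> \<S> t" unfolding \<S>_def using ennreal_leI[of t t'] by (auto intro: le_less_trans)
    then have "s t' \<le> s t" unfolding s_def using US by (intro W.finite_measure_mono) auto
    then show "- s t \<le> - s t'" by simp
  qed
  then have "(\<lambda>t. - (- s t)) \<in> borel_measurable borel" by (intro borel_measurable_uminus borel_measurable_mono)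
  then have sm: "s \<in> borel_measurable borel" by simp
  define g where "g x = \<bar>f x\<bar> / \<sigma> x" for x
  have g0: "0 \<le> g x" if "x \<in> space W" for x using spos[of x] that by (simp add: g_def)
  have gm: "g \<in> borel_measurable W" unfolding g_def W_def by measurable
  obtain G where G: "antimono G" "G \<in> borel_measurable borel"
    "\<And>E. E \<in> sets W \<Longrightarrow> (\<integral>\<^sup>+x\<in>E. ennreal (g x) \<partial>W) \<le> (\<integral>\<^sup>+y. G y * indicator {0<..<measure W E} y \<partial>lborel)"
    "(\<integral>\<^sup>+x. ennpowr (G x) p * indicator {0<..} x \<partial>lborel) \<le> (\<integral>\<^sup>+x. ennreal (g x powr p) \<partial>W)"
    using rearrangement_exists[OF W.finite_measure_axioms gm g0, of p] p by auto
  have weak: "ennreal t * ennreal (s t) \<le> (\<integral>\<^sup>+y. G y * indicator {0<..<s t} y \<partial>lborel)" for t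
  proof -
    have "ennreal t * ennreal (s t) = ennreal t * (\<integral>\<^sup>+R. emeasure W R \<partial>count_space (maximal_members (\<S> t)))"
      unfolding es[symmetric] by (subst tree_emeasure_Union[OF tree ST]) auto
    also have "\<dots> = (\<integral>\<^sup>+R. ennreal t * emeasure W R \<partial>count_space (maximal_members (\<S> t)))"
      by (rule nn_integral_cmult[symmetric]) simp
    also have "\<dots> \<le> (\<integral>\<^sup>+R. emeasure F R \<partial>count_space (maximal_members (\<S> t)))"
    proof (rule nn_integral_mono)
      fix R assume "R \<in> space (count_space (maximal_members (\<S> t)))"
      then have R: "R \<in> T" "ennreal t < A R" using maximal_members_subset[of "\<S> t"] by (auto simp: \<S>_def)
      have "emeasure F R = A R * emeasure W R"
        unfolding A_def using W0[OF R(1)] by (simp add: ennreal_times_divide mult.commute mult_divide_eq_ennreal)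
      then show "ennreal t * emeasure W R \<le> emeasure F R" using R by (auto intro!: mult_right_mono)
    qed
    also have "\<dots> = emeasure F (\<Union>(\<S> t))" by (rule tree_emeasure_Union[OF tree ST, symmetric]) simp
    also have "\<dots> = (\<integral>\<^sup>+x\<in>\<Union>(\<S> t). ennreal (g x) \<partial>W)"
    proof -
      have [measurable]: "\<Union>(\<S> t) \<in> sets M" by (rule US)
      have [measurable]: "g \<in> borel_measurable M" using gm by (simp add: W_def)
      have "(\<integral>\<^sup>+x\<in>\<Union>(\<S> t). ennreal (g x) \<partial>W) = (\<integral>\<^sup>+x. ennreal (\<sigma> x) * (ennreal (g x) * indicator (\<Union>(\<S> t)) x) \<partial>M)"
        unfolding W_def by (rule nn_integral_density) measurable
      also have "\<dots> = (\<integral>\<^sup>+x\<in>\<Union>(\<S> t). ennreal \<bar>f x\<bar> \<partial>M)"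
      proof (rule nn_integral_cong)
        fix x assume "x \<in> space M"
        then have "ennreal (\<sigma> x) * ennreal (g x) = ennreal \<bar>f x\<bar>"
          using spos[of x] by (simp add: g_def ennreal_mult[symmetric])
        then show "ennreal (\<sigma> x) * (ennreal (g x) * indicator (\<Union>(\<S> t)) x) = ennreal \<bar>f x\<bar> * indicator (\<Union>(\<S> t)) x"
          by (simp add: mult.assoc[symmetric])
      qed
      finally show ?thesis by (simp add: F US)
    qed
    also have "\<dots> \<le> (\<integral>\<^sup>+y. G y * indicator {0<..<s t} y \<partial>lborel)"
      unfolding s_def by (rule G(3)) (use US in simp)
    finally show ?thesis .
  qed
  have energy: "(\<integral>\<^sup>+x. ennreal (g x powr p) \<partial>W) = (\<integral>\<^sup>+x. ennpowr (ennreal \<bar>f x\<bar>) p * ennreal (v x) \<partial>M)"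
  proof -
    have [measurable]: "g \<in> borel_measurable M" using gm by (simp add: W_def)
    have "(\<integral>\<^sup>+x. ennreal (g x powr p) \<partial>W) = (\<integral>\<^sup>+x. ennreal (\<sigma> x) * ennreal (g x powr p) \<partial>M)"
      unfolding W_def by (rule nn_integral_density) measurable
    also have "\<dots> = (\<integral>\<^sup>+x. ennpowr (ennreal \<bar>f x\<bar>) p * ennreal (v x) \<partial>M)"
    proof (rule nn_integral_cong)
      fix x assume x: "x \<in> space M"
      have e: "(1 - conj_exp p) * (1 - p) = 1" using p by (simp add: conj_exp_def field_simps)
      have "\<sigma> x * g x powr p = \<bar>f x\<bar> powr p * (\<sigma> x / \<sigma> x powr p)"
        using spos[OF x] by (simp add: g_def powr_divide)
      also have "\<sigma> x / \<sigma> x powr p = \<sigma> x powr (1 - p)" using spos[OF x] by (simp add: powr_diff)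
      also have "\<dots> = v x" using vpos[OF x] e by (simp add: \<sigma>_def powr_powr)
      finally show "ennreal (\<sigma> x) * ennreal (g x powr p) = ennpowr (ennreal \<bar>f x\<bar>) p * ennreal (v x)"
        using spos[OF x] vpos[OF x] by (simp add: ennreal_mult[symmetric])
    qed
    finally show ?thesis .
  qed
  interpret pair_sigma_finite M lborel by unfold_locales
  have "(\<integral>\<^sup>+x. ennpowr (frac_max M T \<alpha> f x) q * ennreal (u x) \<partial>M) \<le> (\<integral>\<^sup>+x. \<integral>\<^sup>+t. K t * H x t * ennreal (u x) \<partial>lborel \<partial>M)"
  proof (rule nn_integral_mono)
    fix x assume x: "x \<in> space M"
    have [measurable]: "H x \<in> borel_measurable borel" using measurable_Pair2[OF Hm, of x] x by simp
    have "(\<integral>\<^sup>+t. K t * H x t * ennreal (u x) \<partial>lborel) = (\<integral>\<^sup>+t. K t * H x t \<partial>lborel) * ennreal (u x)"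
      by (rule nn_integral_multc) measurable
    then show "ennpowr (frac_max M T \<alpha> f x) q * ennreal (u x) \<le> (\<integral>\<^sup>+t. K t * H x t * ennreal (u x) \<partial>lborel)"
      using ptw[of x] by (simp add: mult_right_mono)
  qed
  also have "\<dots> = (\<integral>\<^sup>+t. \<integral>\<^sup>+x. K t * H x t * ennreal (u x) \<partial>M \<partial>lborel)"
    by (rule Fubini'[symmetric]) measurable
  also have "\<dots> \<le> (\<integral>\<^sup>+t. ennreal (L powr q) * (K t * ennreal (s t powr (q / p))) \<partial>lborel)"
  proof (rule nn_integral_mono)
    fix t :: real
    have [measurable]: "(\<lambda>x. H x t) \<in> borel_measurable M" using measurable_Pair1[OF Hm, of t] by simp
    have "(\<integral>\<^sup>+x. K t * H x t * ennreal (u x) \<partial>M) = K t * (\<integral>\<^sup>+x. H x t * ennreal (u x) \<partial>M)"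
      by (subst nn_integral_cmult[symmetric]) (auto simp: mult.assoc)
    also have "\<dots> \<le> K t * (ennreal (L powr q) * ennpowr (emeasure W (\<Union>(\<S> t))) (q / p))"
      by (intro mult_left_mono Hint) auto
    also have "\<dots> = ennreal (L powr q) * (K t * ennreal (s t powr (q / p)))"
      using s0 by (simp add: es mult_ac)
    finally show "(\<integral>\<^sup>+x. K t * H x t * ennreal (u x) \<partial>M) \<le> ennreal (L powr q) * (K t * ennreal (s t powr (q / p)))" .
  qed
  also have "\<dots> = ennreal (L powr q) * (\<integral>\<^sup>+t. K t * ennreal (s t powr (q / p)) \<partial>lborel)"
    using sm by (intro nn_integral_cmult) measurable
  also have "\<dots> \<le> ennreal (L powr q) * (ennreal (C_const p q powr q) * ennpowr (\<integral>\<^sup>+x. ennpowr (ennreal \<bar>f x\<bar>) p * ennreal (v x) \<partial>M) (q / p))"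
  proof (rule mult_left_mono)
    have p0: "0 < p" using p by simp
    have "(\<integral>\<^sup>+t. K t * ennreal (s t powr (q / p)) \<partial>lborel) \<le> (\<integral>\<^sup>+x. ennreal (q / p * x powr (q / p - 1)) * ennpowr ((\<integral>\<^sup>+y. G y * indicator {0<..<x} y \<partial>lborel) / ennreal x) q
            * indicator {0<..} x \<partial>lborel)"
      unfolding K_def by (rule layer_integral_le_average[OF p0 q0 G(1,2) sm s0 weak])
    also have "\<dots> \<le> ennreal (C_const p q powr q) * ennpowr (\<integral>\<^sup>+x. ennpowr (G x) p * indicator {0<..} x \<partial>lborel) (q / p)"
      by (rule bliss_inequality[OF p q G(1)])
    also have "\<dots> \<le> ennreal (C_const p q powr q) * ennpowr (\<integral>\<^sup>+x. ennpowr (ennreal \<bar>f x\<bar>) p * ennreal (v x) \<partial>M) (q / p)"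
      using p q0 G(4) unfolding energy by (intro mult_left_mono ennpowr_mono) auto
    finally show "(\<integral>\<^sup>+t. K t * ennreal (s t powr (q / p)) \<partial>lborel) \<le> ennreal (C_const p q powr q) * ennpowr (\<integral>\<^sup>+x. ennpowr (ennreal \<bar>f x\<bar>) p * ennreal (v x) \<partial>M) (q / p)" .
  qed simp
  also have "\<dots> = ennreal ((C_const p q * L) powr q) * ennpowr (\<integral>\<^sup>+x. ennpowr (ennreal \<bar>f x\<bar>) p * ennreal (v x) \<partial>M) (q / p)"
  proof -
    have "ennreal ((C_const p q * L) powr q) = ennreal (L powr q) * ennreal (C_const p q powr q)"
      using less_imp_le[OF C_const_pos[OF p q]] L by (simp add: powr_mult ennreal_mult[symmetric] mult.commute)
    then show ?thesis by (simp add: mult.assoc)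
  qed
  finally show ?thesis .
qed

lemma frac_max_norm_upper_bound:
  fixes M :: "'a measure"
  assumes "prob_space M" "is_tree M T" and p: "1 < p" and q: "p \<le> q" and L: "0 < L"
    and "weight M u" "weight M v" "weight M (\<lambda>x. v x powr (1 - conj_exp p))"
    and "testing_condition M T \<alpha> p q L u v"
  shows "frac_max_norm M T \<alpha> p v q u \<le> ennreal (C_const p q * L)"
  unfolding frac_max_norm_def
proof (rule Inf_lower, rule CollectI, rule ballI)
  fix f assume "f \<in> wLp M v p"
  then have fm: "f \<in> borel_measurable M" by (simp add: wLp_def)
  have q0: "0 < q" using p q by simp
  have CL: "0 \<le> C_const p q * L" using less_imp_le[OF C_const_pos[OF p q]] L by simp
  have "wnorm M u q (frac_max M T \<alpha> f) \<le> ennpowr (ennreal ((C_const p q * L) powr q) * ennpowr (\<integral>\<^sup>+x. ennpowr (ennreal \<bar>f x\<bar>) p * ennreal (v x) \<partial>M) (q / p)) (1 / q)"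
    unfolding wnorm_def using q0 frac_max_strong_type[OF assms fm] by (intro ennpowr_mono) auto
  also have "\<dots> = ennreal (C_const p q * L) * wnorm M v p (\<lambda>x. ennreal \<bar>f x\<bar>)"
    using q0 p CL by (simp add: ennpowr_mult ennpowr_ennpowr wnorm_def powr_powr)
  finally show "wnorm M u q (frac_max M T \<alpha> f) \<le> ennreal (C_const p q * L) * wnorm M v p (\<lambda>x. ennreal \<bar>f x\<bar>)" .
qed

section \<open>Nearly extremal functions\<close>

lemma bliss_avg_antimono: "0 < r \<Longrightarrow> 0 \<le> x \<Longrightarrow> x \<le> y \<Longrightarrow> bliss_avg r y \<le> bliss_avg r x"
  unfolding bliss_avg_def by (intro powr_mono2') (auto intro!: powr_mono2)

lemma antitone_deriv_increment:
  fixes F g :: "real \<Rightarrow> real"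
  assumes der: "\<And>x. 0 < x \<Longrightarrow> (F has_real_derivative g x) (at x)" and g0: "\<And>x. 0 \<le> g x"
    and anti: "\<And>x y. 0 < x \<Longrightarrow> x \<le> y \<Longrightarrow> g y \<le> g x" and xy: "0 < x" "x \<le> y"
  shows "F x \<le> F y \<and> F y - F x \<le> g x * (y - x)"
proof (cases "x = y")
  case False
  then have "x < y" using xy by simp
  then obtain z where z: "x < z" "z < y" "F y - F x = (y - x) * g z"
    using MVT2[of x y F g] der xy by (metis less_le_trans)
  have "0 \<le> (y - x) * g z" using \<open>x < y\<close> g0[of z] by simp
  moreover have "(y - x) * g z \<le> (y - x) * g x" using anti[of x z] xy z by (intro mult_left_mono) auto
  ultimately show ?thesis using z by (simp add: mult.commute)
qed auto

text \<open>
  \<open>F\<close> plays the role of the primitive of \<open>g\<close> with \<open>F 0 = 0\<close>; the increment bound is the form in which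
  sampling at a sequence of points uses that \<open>g\<close> is its slope. \<open>E\<close> is the energy and \<open>J\<close> the left-hand side
  of the inequality on the half-line, both restricted to the unit interval.
\<close>

definition near_extremal :: "real \<Rightarrow> real \<Rightarrow> (real \<Rightarrow> real) \<Rightarrow> (real \<Rightarrow> real) \<Rightarrow> real \<Rightarrow> real \<Rightarrow> bool" where
  "near_extremal p q g F E J \<longleftrightarrow>
     (\<forall>x. 0 < x \<and> x \<le> 1 \<longrightarrow> 0 < g x \<and> 0 \<le> F x) \<and>
     (\<forall>x y. 0 < x \<and> x \<le> y \<and> y \<le> 1 \<longrightarrow> g y \<le> g x \<and> F x \<le> F y \<and> F y - F x \<le> g x * (y - x)) \<and>
     g \<in> borel_measurable borel \<and> F \<in> borel_measurable borel \<and>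
     (F \<longlongrightarrow> 0) (at_right 0) \<and> 0 < E \<and> 0 < J \<and>
     ((\<lambda>x. g x powr p) has_integral E) {0<..<1} \<and>
     ((\<lambda>x. q / p * x powr (q / p - 1) * (F x / x) powr q) has_integral J) {0<..<1}"

text \<open>
  Dilating the extremal by \<open>l\<close> moves the interval \<open>{0..l}\<close> to the unit interval; the
  inequality is invariant under dilations, so for large \<open>l\<close> almost nothing is lost by restricting it.
\<close>

lemma near_extremal_bliss:
  fixes p q l :: real
  assumes p: "1 < p" and q: "p < q" and r: "r = q / p - 1" and l: "0 < l"
  shows "near_extremal p q (\<lambda>x. bliss_avg r (l * x) powr (1 + r)) (\<lambda>x. x * bliss_avg r (l * x))
     (bliss_energy q r l / l) (q / p * (bliss_mass q r l / l powr (1 + r)))"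
proof -
  have r0: "r > 0" unfolding r using p q by (simp add: field_simps)
  have rp: "(1 + r) * p = q" using p by (simp add: r field_simps)
  define F where "F x = x * bliss_avg r (l * x)" for x
  define g where "g x = bliss_avg r (l * x) powr (1 + r)" for x
  have a0: "0 < bliss_avg r y" for y by (rule bliss_avg_pos)
  have der: "(F has_real_derivative g x) (at x)" if "0 < x" for x
  proof -
    have 1: "((\<lambda>y. y * bliss_avg r y powr 1 / 1) has_real_derivative bliss_avg r (l * x) powr (1 + r) - (1 - 1) / 1 * bliss_avg r (l * x) powr 1) (at (l * x))"
      by (rule deriv_bliss_boundary) (use r0 l that in auto)
    have 2: "((\<lambda>x. l * x) has_real_derivative l) (at x)" by (auto intro!: derivative_eq_intros)
    have "((\<lambda>x. (l * x) * bliss_avg r (l * x) powr 1 / 1) has_real_derivative (bliss_avg r (l * x) powr (1 + r) - (1 - 1) / 1 * bliss_avg r (l * x) powr 1) * l) (at x)"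
      by (rule DERIV_chain2[OF 1 2])
    then have "((\<lambda>x. (l * x) * bliss_avg r (l * x) powr 1 / 1 / l) has_real_derivative (bliss_avg r (l * x) powr (1 + r) - (1 - 1) / 1 * bliss_avg r (l * x) powr 1) * l / l) (at x)"
      by (rule DERIV_cdivide)
    moreover have "(\<lambda>x. (l * x) * bliss_avg r (l * x) powr 1 / 1 / l) = F"
      using l by (simp add: F_def[abs_def] abs_of_pos[OF a0])
    ultimately show ?thesis using l by (simp add: g_def)
  qed
  have ganti: "g y \<le> g x" if "0 < x" "x \<le> y" for x y
    unfolding g_def using that r0 l a0 by (intro powr_mono2 bliss_avg_antimono) (auto simp: less_imp_le)
  note mv0 = antitone_deriv_increment[OF der _ ganti]
  have mv: "F x \<le> F y \<and> F y - F x \<le> g x * (y - x)" if "0 < x" "x \<le> y" for x y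
    by (rule mv0) (use that in \<open>auto simp: g_def\<close>)
  have lim: "(F \<longlongrightarrow> 0) (at_right 0)"
  proof (rule tendsto_sandwich[OF _ _ tendsto_const])
    show "eventually (\<lambda>x. 0 \<le> F x) (at_right 0)"
      using eventually_at_right_less[of "0::real"] by eventually_elim (auto simp: F_def a0 less_imp_le)
    show "eventually (\<lambda>x. F x \<le> x) (at_right 0)"
      using eventually_at_right_less[of "0::real"]
      by eventually_elim (auto simp: F_def bliss_avg_le_1[OF r0] intro!: mult_right_le_one_le less_imp_le[OF a0])
    show "((\<lambda>x::real. x) \<longlongrightarrow> 0) (at_right 0)" by (rule tendsto_ident_at)
  qed
  have cont: "continuous_on {0..1} (\<lambda>x. h (l * x))" if "\<And>y. continuous_on {0..y} h" for h :: "real \<Rightarrow> real"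
    by (rule continuous_on_compose2[OF that[of l]]) (use l in \<open>auto intro!: continuous_intros mult_left_le\<close>)
  have IE: "((\<lambda>x. g x powr p) has_integral bliss_energy q r l / l) {0<..<1}"
  proof -
    have "((\<lambda>x. g x powr p) has_integral (bliss_energy q r (l * 1) / l - bliss_energy q r (l * 0) / l)) {0..1}"
    proof (rule fundamental_theorem_of_calculus_interior)
      show "continuous_on {0..1} (\<lambda>x. bliss_energy q r (l * x) / l)"
        using l by (intro continuous_intros cont continuous_on_bliss_energy r0) auto
      fix x :: real assume "x \<in> {0<..<1}"
      then have x: "0 < l * x" using l by simp
      have 2: "((\<lambda>x. l * x) has_real_derivative l) (at x)" by (auto intro!: derivative_eq_intros)
      have "((\<lambda>x. bliss_energy q r (l * x) / l) has_real_derivative bliss_avg r (l * x) powr q * l / l) (at x)"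
        by (intro DERIV_cdivide DERIV_chain2[OF bliss_energy_deriv[OF r0 x] 2])
      moreover have "bliss_avg r (l * x) powr q * l / l = g x powr p"
        using l by (simp add: g_def powr_powr rp)
      ultimately show "((\<lambda>x. bliss_energy q r (l * x) / l) has_vector_derivative g x powr p) (at x)"
        by (simp add: has_real_derivative_iff_has_vector_derivative)
    qed simp
    then show ?thesis by (simp add: bliss_energy_def has_integral_Icc_iff_Ioo)
  qed
  have IJ: "((\<lambda>x. q / p * x powr (q / p - 1) * (F x / x) powr q) has_integral q / p * (bliss_mass q r l / l powr (1 + r))) {0<..<1}"
  proof -
    have "((\<lambda>x. q / p * (x powr r * bliss_avg r (l * x) powr q)) has_integral
       (q / p * (bliss_mass q r (l * 1) / l powr (1 + r)) - q / p * (bliss_mass q r (l * 0) / l powr (1 + r)))) {0..1}"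
    proof (rule fundamental_theorem_of_calculus_interior)
      show "continuous_on {0..1} (\<lambda>x. q / p * (bliss_mass q r (l * x) / l powr (1 + r)))"
        using l p by (intro continuous_intros cont continuous_on_bliss_mass r0) auto
      fix x :: real assume "x \<in> {0<..<1}"
      then have x: "0 < l * x" "0 < x" using l by auto
      have 2: "((\<lambda>x. l * x) has_real_derivative l) (at x)" by (auto intro!: derivative_eq_intros)
      have "((\<lambda>x. q / p * (bliss_mass q r (l * x) / l powr (1 + r))) has_real_derivative q / p * ((bliss_avg r (l * x) powr q * (l * x) powr r) * l / l powr (1 + r))) (at x)"
        by (intro DERIV_cmult DERIV_cdivide DERIV_chain2[OF bliss_mass_deriv[OF r0 x(1)] 2])
      moreover have "(bliss_avg r (l * x) powr q * (l * x) powr r) * l / l powr (1 + r) = x powr r * bliss_avg r (l * x) powr q"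
        using l x by (simp add: powr_mult powr_add)
      ultimately show "((\<lambda>x. q / p * (bliss_mass q r (l * x) / l powr (1 + r))) has_vector_derivative q / p * (x powr r * bliss_avg r (l * x) powr q)) (at x)"
        by (simp add: has_real_derivative_iff_has_vector_derivative)
    qed simp
    then have "((\<lambda>x. q / p * (x powr r * bliss_avg r (l * x) powr q)) has_integral q / p * (bliss_mass q r l / l powr (1 + r))) {0<..<1}"
      by (simp add: bliss_mass_def has_integral_Icc_iff_Ioo)
    then show ?thesis
      by (rule has_integral_eq[rotated]) (auto simp: F_def r)
  qed
  have "bliss_mass q r 0 < bliss_mass q r l" by (rule bliss_mass_strict_mono) (use r0 l in auto)
  then have H0: "bliss_mass q r l > 0" by (simp add: bliss_mass_def)
  have E0: "bliss_energy q r l > 0"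
  proof -
    have "bliss_energy q r 0 < bliss_energy q r l"
    proof (rule DERIV_pos_imp_increasing_open[OF l])
      show "continuous_on {0..l} (bliss_energy q r)" by (rule continuous_on_bliss_energy[OF r0])
      fix z assume "0 < z" "z < l"
      then show "\<exists>D. (bliss_energy q r has_real_derivative D) (at z) \<and> D > 0"
        using bliss_energy_deriv[OF r0, of z q] a0[of z] by (intro exI[of _ "bliss_avg r z powr q"]) auto
    qed
    then show ?thesis by (simp add: bliss_energy_def)
  qed
  have q0: "0 < q" using p q by simp
  have gm: "g \<in> borel_measurable borel" "F \<in> borel_measurable borel"
    unfolding g_def[abs_def] F_def[abs_def] bliss_avg_def by measurable
  have gpos: "0 < g x" for x using a0[of "l * x"] by (simp add: g_def)
  have F0: "0 \<le> F x" if "0 < x" for x using a0[of "l * x"] that by (simp add: F_def)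
  have E1: "0 < bliss_energy q r l / l" "0 < q / p * (bliss_mass q r l / l powr (1 + r))"
    using E0 H0 p q0 l by simp_all
  have "near_extremal p q g F (bliss_energy q r l / l) (q / p * (bliss_mass q r l / l powr (1 + r)))"
    unfolding near_extremal_def using gpos F0 ganti mv lim IE IJ E1 gm by simp
  then show ?thesis by (simp add: g_def[abs_def] F_def[abs_def])
qed

text \<open>
  For \<open>p = q\<close> the slopes \<open>x powr (- b)\<close> with \<open>b\<close> slightly below \<open>1 / p\<close> have finite energy on the unit
  interval, and their averages exceed them by the factor \<open>1 / (1 - b)\<close>, close to \<open>p / (p - 1)\<close>.
\<close>

lemma near_extremal_power:
  fixes p b :: real
  assumes p: "1 < p" and b: "0 < b" "b * p < 1"
  shows "near_extremal p p (\<lambda>x. x powr (- b)) (\<lambda>x. x powr (1 - b) / (1 - b)) (1 / (1 - b * p)) ((1 / (1 - b)) powr p * (1 / (1 - b * p)))"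
proof -
  have b1: "b < 1" using b p by (smt (verit) mult_less_cancel_left2)
  define F where "F x = x powr (1 - b) / (1 - b)" for x :: real
  define g where "g x = x powr (- b)" for x :: real
  have der: "(F has_real_derivative g x) (at x)" if "0 < x" for x
  proof -
    have "((\<lambda>x. x powr (1 - b)) has_real_derivative (1 - b) * x powr (1 - b - 1)) (at x)"
      using has_real_derivative_powr[OF that, of "1 - b"] .
    then have "(F has_real_derivative (1 - b) * x powr (1 - b - 1) / (1 - b)) (at x)"
      unfolding F_def by (rule DERIV_cdivide)
    then show ?thesis using b1 by (simp add: g_def)
  qed
  have ganti: "g y \<le> g x" if "0 < x" "x \<le> y" for x y
    unfolding g_def using that b by (intro powr_mono2') auto
  note mv0 = antitone_deriv_increment[OF der _ ganti]
  have mv: "F x \<le> F y \<and> F y - F x \<le> g x * (y - x)" if "0 < x" "x \<le> y" for x y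
    by (rule mv0) (use that in \<open>auto simp: g_def\<close>)
  have lim: "(F \<longlongrightarrow> 0) (at_right 0)"
  proof -
    have "continuous_on {0..} (\<lambda>x::real. x powr (1 - b))" using b1 by (intro continuous_on_powr_nonneg) auto
    then have "((\<lambda>x::real. x powr (1 - b)) \<longlongrightarrow> 0 powr (1 - b)) (at 0 within {0..})"
      unfolding continuous_on_def by (rule bspec) auto
    then have "((\<lambda>x::real. x powr (1 - b)) \<longlongrightarrow> 0 powr (1 - b)) (at_right 0)"
      by (rule tendsto_within_subset) auto
    then have "((\<lambda>x::real. x powr (1 - b) / (1 - b)) \<longlongrightarrow> 0 powr (1 - b) / (1 - b)) (at_right 0)"
      by (rule tendsto_divide[OF _ tendsto_const]) (use b1 in simp)
    then show ?thesis by (simp add: F_def[abs_def])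
  qed
  have I: "((\<lambda>x. x powr (- b * p)) has_integral 1 / (1 - b * p)) {0<..<1}"
    using has_integral_powr_from_0[of "- b * p" 1] b by (simp add: has_integral_Icc_iff_Ioo)
  have IE: "((\<lambda>x. g x powr p) has_integral 1 / (1 - b * p)) {0<..<1}"
    using I by (simp add: g_def powr_powr)
  have "((\<lambda>x. (1 / (1 - b)) powr p * x powr (- b * p)) has_integral (1 / (1 - b)) powr p * (1 / (1 - b * p))) {0<..<1}"
    by (intro has_integral_mult_right I)
  then have IJ: "((\<lambda>x. p / p * x powr (p / p - 1) * (F x / x) powr p) has_integral (1 / (1 - b)) powr p * (1 / (1 - b * p))) {0<..<1}"
  proof (rule has_integral_eq[rotated])
    fix x :: real assume "x \<in> {0<..<1}"
    then have x: "0 < x" by simp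
    have "F x / x = (1 / (1 - b)) * x powr (- b)"
      using x by (simp add: F_def powr_diff powr_minus_divide)
    then have "(F x / x) powr p = (1 / (1 - b)) powr p * (x powr (- b)) powr p"
      using b1 by (simp only:) (subst powr_mult, auto)
    then show "(1 / (1 - b)) powr p * x powr (- b * p) = p / p * x powr (p / p - 1) * (F x / x) powr p"
      using x p by (simp add: powr_powr)
  qed
  have gm: "g \<in> borel_measurable borel" "F \<in> borel_measurable borel"
    unfolding g_def[abs_def] F_def[abs_def] by measurable
  have gpos: "0 < g x" if "0 < x" for x using that by (simp add: g_def)
  have F0: "0 \<le> F x" for x using b1 by (simp add: F_def)
  have E1: "0 < 1 / (1 - b * p)" "0 < (1 / (1 - b)) powr p * (1 / (1 - b * p))"
    using b b1 by simp_all
  have ne: "near_extremal p p g F (1 / (1 - b * p)) ((1 / (1 - b)) powr p * (1 / (1 - b * p)))"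
    unfolding near_extremal_def using gpos F0 ganti mv lim IE IJ E1 gm by simp
  show ?thesis
    using ne by (simp add: g_def[abs_def] F_def[abs_def])
qed

lemma near_extremal_exists:
  fixes p q c :: real
  assumes p: "1 < p" and q: "p \<le> q" and c: "c < C_const p q"
  obtains g F E J where "near_extremal p q g F E J" "c * E powr (1 / p) < J powr (1 / q)"
proof (cases "p = q")
  case True
  have C: "C_const p q = 1 / (1 - 1 / p)" using True p by (simp add: C_const_def field_simps)
  have "((\<lambda>b. 1 / (1 - b)) \<longlongrightarrow> 1 / (1 - 1 / p)) (at_left (1 / p))"
    using p by (intro tendsto_intros) auto
  then have "eventually (\<lambda>b. c < 1 / (1 - b)) (at_left (1 / p))"
    using c unfolding C by (rule order_tendstoD(1))
  moreover have "eventually (\<lambda>b. b \<in> {0<..<1/p}) (at_left (1 / p))"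
    using p by (intro eventually_at_left_real) auto
  ultimately have "eventually (\<lambda>b. c < 1 / (1 - b) \<and> b \<in> {0<..<1/p}) (at_left (1 / p))" by (rule eventually_conj)
  then obtain b where b: "c < 1 / (1 - b)" "0 < b" "b < 1 / p"
    using eventually_happens[of _ "at_left (1 / p)"] by (auto simp: trivial_limit_at_left_real)
  have bp: "b * p < 1" using b p by (simp add: field_simps)
  have b1: "b < 1" using b p by (smt (verit) divide_less_eq_1_pos)
  define E where "E = 1 / (1 - b * p)"
  have E0: "E > 0" using bp by (simp add: E_def)
  have "c * E powr (1 / p) < 1 / (1 - b) * E powr (1 / p)" using b E0 by (intro mult_strict_right_mono) auto
  also have "\<dots> = ((1 / (1 - b)) powr p * E) powr (1 / q)"
    using True p b1 E0 by (simp add: powr_mult powr_powr powr_divide)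
  finally have "c * E powr (1 / p) < ((1 / (1 - b)) powr p * E) powr (1 / q)" .
  moreover have "near_extremal p q (\<lambda>x. x powr (- b)) (\<lambda>x. x powr (1 - b) / (1 - b)) E ((1 / (1 - b)) powr p * E)"
    using near_extremal_power[OF p b(2) bp] True by (simp add: E_def)
  ultimately show ?thesis using that by blast
next
  case False
  then have q: "p < q" using q by simp
  define r where "r = q / p - 1"
  have r0: "r > 0" unfolding r_def using p q by (simp add: field_simps)
  have q0: "0 < q" using p q by simp
  have pq: "q - r - 1 = q / p * (p - 1)" using p by (simp add: r_def field_simps)
  have "0 < q / p * (p - 1)" using p q by (intro mult_pos_pos divide_pos_pos) auto
  then have n1: "q - r > 1" using pq by linarith
  define E where "E = Beta (1 / r) ((q - 1) / r) / r"
  have E0: "E > 0" unfolding E_def using r0 p q by (intro bliss_energy_limit_pos) auto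
  have limE: "(bliss_energy q r \<longlongrightarrow> E) at_top"
    unfolding E_def using r0 p q by (intro bliss_energy_tendsto) auto
  note limH = bliss_mass_tendsto[OF r0 n1 limE]
  have "((\<lambda>l. (q / p * bliss_mass q r l) powr (1 / q) - c * bliss_energy q r l powr (1 / p)) \<longlongrightarrow> (q / p * (E / (q - r - 1))) powr (1 / q) - c * E powr (1 / p)) at_top"
    using E0 n1 p q by (intro tendsto_intros limE limH) auto
  moreover have "c * E powr (1 / p) < (q / p * (E / (q - r - 1))) powr (1 / q)"
  proof -
    have "q / p * (E / (q - r - 1)) = E / (p - 1)" unfolding pq using p q0 by simp
    also have "\<dots> = C_const p q powr q * E powr (q / p)"
      unfolding C_const_powr[OF p q r_def] E_def[symmetric] using E0
      by (simp add: powr_add[symmetric] r_def)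
    also have "\<dots> powr (1 / q) = C_const p q * E powr (1 / p)"
      using less_imp_le[OF C_const_pos[OF p less_imp_le[OF q]]] q0 p E0 by (simp add: powr_mult powr_powr)
    finally show ?thesis using c E0 by simp
  qed
  ultimately have "eventually (\<lambda>l. 0 < (q / p * bliss_mass q r l) powr (1 / q) - c * bliss_energy q r l powr (1 / p)) at_top"
    by (intro order_tendstoD(1)) auto
  then have "eventually (\<lambda>l. 0 < (q / p * bliss_mass q r l) powr (1 / q) - c * bliss_energy q r l powr (1 / p) \<and> 0 < l) at_top"
    using eventually_gt_at_top[of 0] by (rule eventually_conj)
  then obtain l where l: "c * bliss_energy q r l powr (1 / p) < (q / p * bliss_mass q r l) powr (1 / q)" "0 < l"
    using eventually_happens[of _ "at_top :: real filter"] by auto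
  note ne = near_extremal_bliss[OF p q r_def l(2)]
  have pos: "0 < bliss_energy q r l / l" "0 < q / p * (bliss_mass q r l / l powr (1 + r))"
    using ne by (auto simp: near_extremal_def)
  have pos': "0 < bliss_energy q r l" "0 < bliss_mass q r l"
  proof -
    show "0 < bliss_energy q r l" using pos(1) l by (simp add: zero_less_divide_iff)
    have "bliss_mass q r 0 < bliss_mass q r l" by (rule bliss_mass_strict_mono) (use r0 l in auto)
    then show "0 < bliss_mass q r l" by (simp add: bliss_mass_def)
  qed
  have "(1 + r) * (1 / q) = 1 / p" using p q0 by (simp add: r_def)
  then have e: "(l powr (1 + r)) powr (1 / q) = l powr (1 / p)" by (simp only: powr_powr)
  have "c * (bliss_energy q r l / l) powr (1 / p) = c * bliss_energy q r l powr (1 / p) / l powr (1 / p)"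
    using pos' l by (simp add: powr_divide)
  also have "\<dots> < (q / p * bliss_mass q r l) powr (1 / q) / l powr (1 / p)"
    using l by (intro divide_strict_right_mono) auto
  also have "\<dots> = ((q / p * bliss_mass q r l) / l powr (1 + r)) powr (1 / q)"
    using pos' l q0 p by (subst powr_divide) (auto simp: e)
  also have "\<dots> = (q / p * (bliss_mass q r l / l powr (1 + r))) powr (1 / q)" by simp
  finally show ?thesis by (rule that[OF ne])
qed

section \<open>Sampling at a geometric sequence\<close>

lemma nn_integral_powr_deriv_Icc:
  fixes a b c :: real
  assumes "0 < a" "a \<le> b" "0 < c"
  shows "(\<integral>\<^sup>+t. ennreal (c * t powr (c - 1)) * indicator {a..b} t \<partial>lborel) = ennreal (b powr c - a powr c)"
proof (rule nn_integral_has_integral_lebesgue')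
  show "((\<lambda>t. c * t powr (c - 1)) has_integral b powr c - a powr c) {a..b}"
  proof (rule fundamental_theorem_of_calculus[OF assms(2)])
    fix x assume "x \<in> {a..b}"
    then have "((\<lambda>t. t powr c) has_real_derivative c * x powr (c - 1)) (at x)"
      using assms by (intro has_real_derivative_powr) auto
    then show "((\<lambda>t. t powr c) has_vector_derivative c * x powr (c - 1)) (at x within {a..b})"
      by (simp add: has_real_derivative_iff_has_vector_derivative has_vector_derivative_at_within)
  qed
qed (use assms in auto)

lemma geometric_partition:
  fixes t :: real
  assumes "0 < t" "t < 1" and x: "0 < x" "x \<le> 1"
  obtains k where "t ^ Suc k < x" "x \<le> t ^ k"
proof -
  obtain n where n: "t ^ n < x" using real_arch_pow_inv[of x t] assms by auto
  define k where "k = (LEAST k. t ^ k < x)"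
  have k: "t ^ k < x" unfolding k_def by (rule LeastI[of _ n]) (rule n)
  have "k \<noteq> 0" using k x by (intro notI) simp
  then obtain j where j: "k = Suc j" by (cases k) auto
  have "\<not> t ^ j < x" using not_less_Least[of j "\<lambda>k. t ^ k < x"] j by (simp add: k_def)
  then show ?thesis using that[of j] k j by simp
qed

lemma geometric_partition_indicator:
  fixes t :: real
  assumes t: "0 < t" "t < 1"
  shows "(\<Sum>k. indicator {t ^ Suc k<..t ^ k} x) = (indicator {0<..1} x :: ennreal)"
proof -
  have "disjoint_family (\<lambda>k. {t ^ Suc k<..t ^ k})"
    unfolding disjoint_family_on_def
  proof (intro ballI impI)
    have *: "{t ^ Suc m<..t ^ m} \<inter> {t ^ Suc n<..t ^ n} = {}" if "m < n" for m n
    proof -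
      have "t ^ n \<le> t ^ Suc m" using that t by (intro power_decreasing) auto
      then show ?thesis by auto
    qed
    fix m n :: nat assume "m \<noteq> n"
    then show "{t ^ Suc m<..t ^ m} \<inter> {t ^ Suc n<..t ^ n} = {}"
      using *[of m n] *[of n m] by (cases "m < n") (auto simp: Int_commute)
  qed
  then have "(\<Sum>k. indicator {t ^ Suc k<..t ^ k} x) = (indicator (\<Union>k. {t ^ Suc k<..t ^ k}) x :: ennreal)"
    by (rule suminf_indicator)
  also have "(\<Union>k. {t ^ Suc k<..t ^ k}) = {0<..1}"
  proof
    show "(\<Union>k. {t ^ Suc k<..t ^ k}) \<subseteq> {0<..1}"
    proof (intro UN_least subsetI)
      fix k x assume "x \<in> {t ^ Suc k<..t ^ k}"
      moreover have "0 < t ^ Suc k" "t ^ k \<le> 1" using t by (auto intro: power_le_one)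
      ultimately show "x \<in> {0<..1}" by (auto intro: less_trans order_trans)
    qed
    show "{0<..1} \<subseteq> (\<Union>k. {t ^ Suc k<..t ^ k})"
    proof
      fix x assume "x \<in> {0<..(1::real)}"
      then obtain k where "t ^ Suc k < x" "x \<le> t ^ k" using geometric_partition[OF t, of x] by auto
      then show "x \<in> (\<Union>k. {t ^ Suc k<..t ^ k})" by auto
    qed
  qed
  finally show ?thesis .
qed

lemma nn_integral_geometric_partition:
  fixes t :: real and f :: "real \<Rightarrow> ennreal"
  assumes t: "0 < t" "t < 1" and [measurable]: "f \<in> borel_measurable borel"
  shows "(\<integral>\<^sup>+x. f x * indicator {0<..1} x \<partial>lborel) = (\<Sum>k. \<integral>\<^sup>+x. f x * indicator {t ^ Suc k<..t ^ k} x \<partial>lborel)"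
proof -
  have "(\<integral>\<^sup>+x. f x * indicator {0<..1} x \<partial>lborel) = (\<integral>\<^sup>+x. (\<Sum>k. f x * indicator {t ^ Suc k<..t ^ k} x) \<partial>lborel)"
    by (rule nn_integral_cong) (simp only: ennreal_suminf_cmult geometric_partition_indicator[OF t])
  also have "\<dots> = (\<Sum>k. \<integral>\<^sup>+x. f x * indicator {t ^ Suc k<..t ^ k} x \<partial>lborel)"
    by (rule nn_integral_suminf) measurable
  finally show ?thesis .
qed

text \<open>
  The counterpart on the points \<open>t\<^sup>k\<close> of the two integrals in \<open>near_extremal\<close>. In the first sum each
  interval carries the smallest value of \<open>g\<close>. In the second sum, taking the value of \<open>g\<close> at the
  right endpoint costs a factor \<open>t\<close> in the sum over \<open>j\<close> (the ratio of the lengths of neighbouring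
  intervals), and replacing \<open>F x / x\<close> by its value at \<open>t\<^sup>k\<close> costs another one.
\<close>

lemma near_extremal_discrete:
  fixes p q t :: real
  assumes ne: "near_extremal p q g F E J" and p: "1 < p" and q: "p \<le> q" and t: "0 < t" "t < 1"
  shows "(\<Sum>k. ennreal (g (t ^ k) powr p * (t ^ k - t ^ Suc k))) \<le> ennreal E" (is ?A)
    and "ennreal (t powr (2 * q) * J) \<le> (\<Sum>k. ennpowr (\<Sum>j. ennreal (g (t ^ (k + j)) * (t ^ (k + j) - t ^ Suc (k + j)))) q
          * ennreal ((t ^ k) powr (- q) * ((t ^ k) powr (q / p) - (t ^ Suc k) powr (q / p))))" (is ?B)
proof -
  have q0: "0 < q" "0 < q / p" using p q by auto
  have gpos: "0 < g x" and F0: "0 \<le> F x" if "0 < x" "x \<le> 1" for x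
    using ne that unfolding near_extremal_def by auto
  have ganti: "g y \<le> g x" and Fmono: "F x \<le> F y" and Fconc: "F y - F x \<le> g x * (y - x)" if "0 < x" "x \<le> y" "y \<le> 1" for x y
    using ne that unfolding near_extremal_def by auto
  have gm [measurable]: "g \<in> borel_measurable borel" and Fm [measurable]: "F \<in> borel_measurable borel"
    and lim: "(F \<longlongrightarrow> 0) (at_right 0)" and EJ: "0 < E" "0 < J"
    and IE: "((\<lambda>x. g x powr p) has_integral E) {0<..<1}"
    and IJ: "((\<lambda>x. q / p * x powr (q / p - 1) * (F x / x) powr q) has_integral J) {0<..<1}"
    using ne unfolding near_extremal_def by auto
  have tk: "0 < t ^ k" "t ^ k \<le> 1" "t ^ Suc k < t ^ k" for k
    using t by (auto simp: power_le_one)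
  show ?A
  proof -
    have "(\<Sum>k. ennreal (g (t ^ k) powr p * (t ^ k - t ^ Suc k))) \<le> (\<Sum>k. \<integral>\<^sup>+x. ennreal (g x powr p) * indicator {0<..<1} x * indicator {t ^ Suc k<..t ^ k} x \<partial>lborel)"
    proof (intro suminf_le summableI)
      fix k
      have "ennreal (g (t ^ k) powr p * (t ^ k - t ^ Suc k)) = ennreal (g (t ^ k) powr p) * emeasure lborel {t ^ Suc k<..<t ^ k}"
        using tk(3)[of k] by (subst emeasure_lborel_Ioo) (auto simp: ennreal_mult)
      also have "\<dots> = (\<integral>\<^sup>+x. ennreal (g (t ^ k) powr p) * indicator {t ^ Suc k<..<t ^ k} x \<partial>lborel)"
        by (rule nn_integral_cmult_indicator[symmetric]) simp
      also have "\<dots> \<le> (\<integral>\<^sup>+x. ennreal (g x powr p) * indicator {0<..<1} x * indicator {t ^ Suc k<..t ^ k} x \<partial>lborel)"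
      proof (rule nn_integral_mono)
        fix x :: real
        show "ennreal (g (t ^ k) powr p) * indicator {t ^ Suc k<..<t ^ k} x \<le> ennreal (g x powr p) * indicator {0<..<1} x * indicator {t ^ Suc k<..t ^ k} x"
        proof (cases "x \<in> {t ^ Suc k<..<t ^ k}")
          case True
          then have x: "0 < x" "x < 1" "x \<le> t ^ k" using tk(1)[of "Suc k"] tk(2)[of k] by auto
          then have "g (t ^ k) powr p \<le> g x powr p"
            using ganti[of x "t ^ k"] gpos[of "t ^ k"] tk[of k] p by (intro powr_mono2) auto
          then show ?thesis using True x by (simp add: ennreal_leI)
        qed simp
      qed
      finally show "ennreal (g (t ^ k) powr p * (t ^ k - t ^ Suc k)) \<le> (\<integral>\<^sup>+x. ennreal (g x powr p) * indicator {0<..<1} x * indicator {t ^ Suc k<..t ^ k} x \<partial>lborel)" .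
    qed
    also have "\<dots> = (\<integral>\<^sup>+x. ennreal (g x powr p) * indicator {0<..<1} x * indicator {0<..1} x \<partial>lborel)"
      by (rule nn_integral_geometric_partition[OF t, symmetric]) measurable
    also have "\<dots> = (\<integral>\<^sup>+x. ennreal (g x powr p) * indicator {0<..<1} x \<partial>lborel)"
      by (rule nn_integral_cong) (auto simp: indicator_def)
    also have "\<dots> = ennreal E" by (rule nn_integral_has_integral_lebesgue'[OF _ IE]) auto
    finally show ?thesis .
  qed
  have limF: "(\<lambda>n. F (t ^ (k + n))) \<longlonglongrightarrow> 0" for k
  proof -
    have "(\<lambda>n. t ^ n) \<longlonglongrightarrow> 0" using t by (intro LIMSEQ_realpow_zero) auto
    then have "(\<lambda>n. t ^ (n + k)) \<longlonglongrightarrow> 0" by (rule LIMSEQ_ignore_initial_segment)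
    then have "filterlim (\<lambda>n. t ^ (k + n)) (at_right 0) sequentially"
      using t by (simp add: filterlim_at add.commute)
    from filterlim_compose[OF lim this] show ?thesis .
  qed
  \<comment> \<open>dropping the first summand makes room for the comparison with the increments of F\<close>
  have sumF: "ennreal (t * F (t ^ k)) \<le> (\<Sum>j. ennreal (g (t ^ (k + j)) * (t ^ (k + j) - t ^ Suc (k + j))))" for k
  proof -
    let ?a = "\<lambda>j. ennreal (g (t ^ (k + j)) * (t ^ (k + j) - t ^ Suc (k + j)))"
    have "(\<lambda>j. F (t ^ (k + j)) - F (t ^ (k + Suc j))) sums (F (t ^ (k + 0)) - 0)"
      by (rule telescope_sums'[OF limF])
    then have "(\<lambda>j. t * (F (t ^ (k + j)) - F (t ^ (k + Suc j)))) sums (t * (F (t ^ (k + 0)) - 0))"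
      by (rule sums_mult)
    then have s: "(\<lambda>j. t * (F (t ^ (k + j)) - F (t ^ (k + Suc j)))) sums (t * F (t ^ k))" by simp
    have nn: "0 \<le> t * (F (t ^ (k + j)) - F (t ^ (k + Suc j)))" for j
      using Fmono[of "t ^ (k + Suc j)" "t ^ (k + j)"] tk[of "k + j"] tk[of "k + Suc j"] t by simp
    have "ennreal (t * F (t ^ k)) = (\<Sum>j. ennreal (t * (F (t ^ (k + j)) - F (t ^ (k + Suc j)))))"
      by (rule suminf_ennreal_eq[symmetric, OF nn s])
    also have "\<dots> \<le> (\<Sum>j. ?a (j + 1))"
    proof (intro suminf_le summableI ennreal_leI)
      fix j
      have "t * (F (t ^ (k + j)) - F (t ^ (k + Suc j))) \<le> t * (g (t ^ (k + Suc j)) * (t ^ (k + j) - t ^ (k + Suc j)))"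
        using Fconc[of "t ^ (k + Suc j)" "t ^ (k + j)"] tk[of "k + j"] tk[of "k + Suc j"] t by (intro mult_left_mono) auto
      also have "\<dots> = g (t ^ (k + (j + 1))) * (t ^ (k + (j + 1)) - t ^ Suc (k + (j + 1)))" by (simp add: algebra_simps)
      finally show "t * (F (t ^ (k + j)) - F (t ^ (k + Suc j))) \<le> g (t ^ (k + (j + 1))) * (t ^ (k + (j + 1)) - t ^ Suc (k + (j + 1)))" .
    qed
    also have "\<dots> \<le> (\<Sum>j. ?a j)"
      using suminf_offset[of ?a 1] by (simp add: summableI)
    finally show ?thesis .
  qed
  show ?B
  proof -
    let ?\<phi> = "\<lambda>x. ennreal (q / p * x powr (q / p - 1) * (F x / x) powr q)"
    have "ennreal J = (\<integral>\<^sup>+x. ?\<phi> x * indicator {0<..<1} x \<partial>lborel)"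
      using q0 p by (intro nn_integral_has_integral_lebesgue'[symmetric] IJ) auto
    also have "\<dots> \<le> (\<integral>\<^sup>+x. ?\<phi> x * indicator {0<..1} x \<partial>lborel)"
      by (rule nn_integral_mono) (auto simp: indicator_def)
    also have "\<dots> = (\<Sum>k. \<integral>\<^sup>+x. ?\<phi> x * indicator {t ^ Suc k<..t ^ k} x \<partial>lborel)"
      by (rule nn_integral_geometric_partition[OF t]) measurable
    also have "\<dots> \<le> (\<Sum>k. ennreal (t powr (- (2 * q))) * (ennreal ((t * F (t ^ k)) powr q) * ennreal ((t ^ k) powr (- q) * ((t ^ k) powr (q / p) - (t ^ Suc k) powr (q / p)))))"
    proof (intro suminf_le summableI)
      fix k
      define B where "B = (F (t ^ k) / t ^ Suc k) powr q"
      have Fk: "0 \<le> F (t ^ k)" using F0 tk by auto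
      have "(\<integral>\<^sup>+x. ?\<phi> x * indicator {t ^ Suc k<..t ^ k} x \<partial>lborel)
         \<le> (\<integral>\<^sup>+x. ennreal B * (ennreal (q / p * x powr (q / p - 1)) * indicator {t ^ Suc k..t ^ k} x) \<partial>lborel)"
      proof (rule nn_integral_mono)
        fix x :: real
        show "?\<phi> x * indicator {t ^ Suc k<..t ^ k} x \<le> ennreal B * (ennreal (q / p * x powr (q / p - 1)) * indicator {t ^ Suc k..t ^ k} x)"
        proof (cases "x \<in> {t ^ Suc k<..t ^ k}")
          case True
          then have x: "0 < x" "t ^ Suc k < x" "x \<le> t ^ k" "x \<le> 1" using tk(1)[of "Suc k"] tk(2)[of k] by auto
          have "F x / x \<le> F (t ^ k) / t ^ Suc k"
            using x Fmono[of x "t ^ k"] F0[of x] F0[of "t ^ k"] tk(1)[of "Suc k"] tk(1,2)[of k] by (intro frac_le) auto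
          then have "(F x / x) powr q \<le> B"
            unfolding B_def using F0[of x] x q0 by (intro powr_mono2) auto
          then have "(F x / x) powr q * (q / p * x powr (q / p - 1)) \<le> B * (q / p * x powr (q / p - 1))"
            using q0 p by (intro mult_right_mono) auto
          then have "q / p * x powr (q / p - 1) * (F x / x) powr q \<le> B * (q / p * x powr (q / p - 1))"
            by (simp only: mult_ac)
          then have "?\<phi> x \<le> ennreal (B * (q / p * x powr (q / p - 1)))" by (rule ennreal_leI)
          also have "\<dots> = ennreal B * ennreal (q / p * x powr (q / p - 1))"
            using q0 p by (intro ennreal_mult) (auto simp: B_def)
          finally show ?thesis using True by simp
        qed simp
      qed
      also have "\<dots> = ennreal B * (\<integral>\<^sup>+x. ennreal (q / p * x powr (q / p - 1)) * indicator {t ^ Suc k..t ^ k} x \<partial>lborel)"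
        by (rule nn_integral_cmult) measurable
      also have "(\<integral>\<^sup>+x. ennreal (q / p * x powr (q / p - 1)) * indicator {t ^ Suc k..t ^ k} x \<partial>lborel) = ennreal ((t ^ k) powr (q / p) - (t ^ Suc k) powr (q / p))"
        using q0 tk(1)[of "Suc k"] tk(3)[of k] by (intro nn_integral_powr_deriv_Icc less_imp_le) auto
      also have "ennreal B * ennreal ((t ^ k) powr (q / p) - (t ^ Suc k) powr (q / p))
        = ennreal (t powr (- (2 * q))) * (ennreal ((t * F (t ^ k)) powr q) * ennreal ((t ^ k) powr (- q) * ((t ^ k) powr (q / p) - (t ^ Suc k) powr (q / p))))"
      proof -
        have D: "0 \<le> (t ^ k) powr (q / p) - (t ^ Suc k) powr (q / p)"
          using tk[of k] tk[of "Suc k"] q0 by (simp add: powr_mono2 less_imp_le)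
        have "F (t ^ k) / t ^ Suc k = (t * F (t ^ k)) * (t powr (-2) * (t ^ k) powr (-1))"
          using t tk(1)[of k] by (simp add: powr_minus_divide power2_eq_square)
        then have "B = ((t * F (t ^ k)) * (t powr (-2) * (t ^ k) powr (-1))) powr q" by (simp add: B_def)
        also have "\<dots> = (t * F (t ^ k)) powr q * (t powr (-2) * (t ^ k) powr (-1)) powr q"
          using Fk t by (subst powr_mult) auto
        also have "(t powr (-2) * (t ^ k) powr (-1)) powr q = t powr (- (2 * q)) * (t ^ k) powr (- q)"
          by (subst powr_mult) (simp_all only: powr_powr powr_ge_zero, simp)
        finally have "B * ((t ^ k) powr (q / p) - (t ^ Suc k) powr (q / p))
          = t powr (- (2 * q)) * ((t * F (t ^ k)) powr q * ((t ^ k) powr (- q) * ((t ^ k) powr (q / p) - (t ^ Suc k) powr (q / p))))"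
          by (simp only: mult_ac)
        moreover have "0 \<le> B" by (simp add: B_def)
        ultimately show ?thesis using D by (simp only: ennreal_mult[symmetric] powr_ge_zero mult_nonneg_nonneg)
      qed
      finally show "(\<integral>\<^sup>+x. ?\<phi> x * indicator {t ^ Suc k<..t ^ k} x \<partial>lborel) \<le> \<dots>" .
    qed
    also have "\<dots> = ennreal (t powr (- (2 * q))) * (\<Sum>k. ennreal ((t * F (t ^ k)) powr q) * ennreal ((t ^ k) powr (- q) * ((t ^ k) powr (q / p) - (t ^ Suc k) powr (q / p))))"
      by (rule ennreal_suminf_cmult)
    also have "\<dots> \<le> ennreal (t powr (- (2 * q))) * (\<Sum>k. ennpowr (\<Sum>j. ennreal (g (t ^ (k + j)) * (t ^ (k + j) - t ^ Suc (k + j)))) q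
          * ennreal ((t ^ k) powr (- q) * ((t ^ k) powr (q / p) - (t ^ Suc k) powr (q / p))))"
    proof (intro mult_left_mono suminf_le summableI mult_right_mono)
      fix k
      have "ennreal ((t * F (t ^ k)) powr q) = ennpowr (ennreal (t * F (t ^ k))) q"
        using F0[of "t ^ k"] tk t by simp
      also have "\<dots> \<le> ennpowr (\<Sum>j. ennreal (g (t ^ (k + j)) * (t ^ (k + j) - t ^ Suc (k + j)))) q"
        using q0 by (intro ennpowr_mono sumF) auto
      finally show "ennreal ((t * F (t ^ k)) powr q) \<le> ennpowr (\<Sum>j. ennreal (g (t ^ (k + j)) * (t ^ (k + j) - t ^ Suc (k + j)))) q" .
    qed auto
    finally have "ennreal (t powr (2 * q)) * ennreal J \<le> ennreal (t powr (2 * q)) * (ennreal (t powr (- (2 * q))) * (\<Sum>k. ennpowr (\<Sum>j. ennreal (g (t ^ (k + j)) * (t ^ (k + j) - t ^ Suc (k + j)))) q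
          * ennreal ((t ^ k) powr (- q) * ((t ^ k) powr (q / p) - (t ^ Suc k) powr (q / p)))))"
      by (rule mult_left_mono) simp
    moreover have "ennreal (t powr (2 * q)) * ennreal (t powr (- (2 * q))) = 1"
      using t by (simp add: ennreal_mult[symmetric] powr_add[symmetric])
    ultimately show ?thesis using EJ by (simp add: mult.assoc[symmetric] ennreal_mult)
  qed
qed

section \<open>The dyadic tree of the unit interval\<close>

abbreviation unit_space :: "real measure" where
  "unit_space \<equiv> restrict_space lborel {0<..1}"

definition dyadic :: "nat \<Rightarrow> nat \<Rightarrow> real set" where
  "dyadic n i = {real i / 2 ^ n <.. real (Suc i) / 2 ^ n}"

definition dyadic_tree :: "real set set" where
  "dyadic_tree = {dyadic n i | n i. i < 2 ^ n}"

text \<open>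
  Children have to be a function of the set alone, so the endpoints are recovered as infimum and
  supremum.
\<close>

definition dyadic_children :: "real set \<Rightarrow> real set set" where
  "dyadic_children Q = {{Inf Q <.. (Inf Q + Sup Q) / 2}, {(Inf Q + Sup Q) / 2 <.. Sup Q}}"

lemma dyadic_less: "real i / 2 ^ n < real (Suc i) / 2 ^ n"
  by (intro divide_strict_right_mono) auto

lemma dyadic_children_eq: "dyadic_children (dyadic n i) = {dyadic (Suc n) (2 * i), dyadic (Suc n) (2 * i + 1)}"
proof -
  define a b m where ab: "a = real i / 2 ^ n" "b = real (Suc i) / 2 ^ n" "m = real (Suc (2 * i)) / 2 ^ Suc n"
  have D: "dyadic n i = {a<..b}" by (simp only: dyadic_def ab)
  have "a < b" unfolding ab by (rule dyadic_less)
  then have "Inf (dyadic n i) = a" "Sup (dyadic n i) = b" by (simp_all add: D)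
  moreover have "(a + b) / 2 = m" unfolding ab by (simp add: field_simps)
  ultimately have "dyadic_children (dyadic n i) = {{a<..m}, {m<..b}}"
    unfolding dyadic_children_def by (simp only:)
  moreover have "real (2 * i) / 2 ^ Suc n = a" "real (Suc (2 * i + 1)) / 2 ^ Suc n = b" "real (2 * i + 1) / 2 ^ Suc n = m"
    unfolding ab by (simp_all add: field_simps)
  then have "dyadic (Suc n) (2 * i) = {a<..m}" "dyadic (Suc n) (2 * i + 1) = {m<..b}"
    unfolding dyadic_def ab(3)[symmetric] by (simp_all only:)
  ultimately show ?thesis by (simp only:)
qed

lemma dyadic_subset_unit:
  assumes "i < 2 ^ n" shows "dyadic n i \<subseteq> {0<..1}"
proof
  fix x assume "x \<in> dyadic n i"
  then have "real i / 2 ^ n < x" "x \<le> real (Suc i) / 2 ^ n" by (auto simp: dyadic_def)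
  moreover have "real (Suc i) \<le> 2 ^ n" using assms by (metis Suc_leI of_nat_le_iff of_nat_numeral of_nat_power)
  then have "real (Suc i) / 2 ^ n \<le> 1" by simp
  moreover have "0 \<le> real i / 2 ^ n" by simp
  ultimately show "x \<in> {0<..1}" unfolding greaterThanAtMost_iff by linarith
qed

lemma sets_unit_spaceI: "A \<in> sets borel \<Longrightarrow> A \<subseteq> {0<..1} \<Longrightarrow> A \<in> sets unit_space"
  by (subst sets_restrict_space_iff) auto

lemma emeasure_unit_space: "A \<subseteq> {0<..1} \<Longrightarrow> emeasure unit_space A = emeasure lborel A"
  by (rule emeasure_restrict_space) auto

lemma measure_unit_space: "A \<subseteq> {0<..1} \<Longrightarrow> measure unit_space A = measure lborel A"
  by (simp add: measure_def emeasure_unit_space)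

lemma prob_space_unit_space: "prob_space unit_space"
  by (rule prob_spaceI) (simp add: emeasure_unit_space)

lemma measure_dyadic:
  assumes "i < 2 ^ n" shows "measure unit_space (dyadic n i) = 1 / 2 ^ n"
proof -
  have "measure unit_space (dyadic n i) = measure lborel (dyadic n i)"
    by (rule measure_unit_space[OF dyadic_subset_unit[OF assms]])
  also have "\<dots> = real (Suc i) / 2 ^ n - real i / 2 ^ n"
    unfolding dyadic_def using dyadic_less[of i n] by (intro measure_lborel_Ioc) auto
  also have "\<dots> = 1 / 2 ^ n" by (simp add: diff_divide_distrib[symmetric])
  finally show ?thesis .
qed

lemma is_tree_dyadic: "is_tree unit_space dyadic_tree"
proof -
  have sp: "space unit_space = dyadic 0 0" by (simp add: dyadic_def)
  have sets: "dyadic_tree \<subseteq> sets unit_space"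
    unfolding dyadic_tree_def using dyadic_subset_unit by (auto intro!: sets_unit_spaceI simp: dyadic_def)
  have lev: "tree_level dyadic_children (space unit_space) n = {dyadic n i | i. i < 2 ^ n}" for n
  proof (induction n)
    case 0
    show ?case by (simp only: tree_level.simps sp) auto
  next
    case (Suc n)
    have "{dyadic (Suc n) i | i. i < 2 ^ Suc n} = (\<Union>i<2 ^ n. {dyadic (Suc n) (2 * i), dyadic (Suc n) (2 * i + 1)})"
    proof (intro equalityI subsetI)
      fix Q assume "Q \<in> {dyadic (Suc n) i | i. i < 2 ^ Suc n}"
      then obtain i where i: "Q = dyadic (Suc n) i" "i < 2 ^ Suc n" by auto
      then have "i div 2 < 2 ^ n" by simp
      moreover have "i = 2 * (i div 2) \<or> i = 2 * (i div 2) + 1" by presburger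
      ultimately show "Q \<in> (\<Union>i<2 ^ n. {dyadic (Suc n) (2 * i), dyadic (Suc n) (2 * i + 1)})"
        using i by (intro UN_I[of "i div 2"]) auto
    next
      fix Q assume "Q \<in> (\<Union>i<2 ^ n. {dyadic (Suc n) (2 * i), dyadic (Suc n) (2 * i + 1)})"
      then obtain i where i: "i < 2 ^ n" "Q = dyadic (Suc n) (2 * i) \<or> Q = dyadic (Suc n) (2 * i + 1)" by auto
      have "2 * i < 2 ^ Suc n" "2 * i + 1 < 2 ^ Suc n" using i by auto
      then show "Q \<in> {dyadic (Suc n) i | i. i < 2 ^ Suc n}" using i by auto
    qed
    moreover have "tree_level dyadic_children (space unit_space) (Suc n) = (\<Union>Q\<in>{dyadic n i | i. i < 2 ^ n}. dyadic_children Q)"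
      by (simp only: tree_level.simps Suc)
    moreover have "\<dots> = (\<Union>i<2 ^ n. dyadic_children (dyadic n i))" by blast
    ultimately show ?case by (simp only: dyadic_children_eq)
  qed
  have T: "dyadic_tree = (\<Union>n. tree_level dyadic_children (space unit_space) n)"
    unfolding lev dyadic_tree_def by auto
  have ch: "dyadic_children Q \<subseteq> dyadic_tree \<and> finite (dyadic_children Q) \<and> 2 \<le> card (dyadic_children Q) \<and>
     disjoint (dyadic_children Q) \<and> (\<forall>R\<in>dyadic_children Q. R \<subseteq> Q) \<and> Q = \<Union> (dyadic_children Q)" if "Q \<in> dyadic_tree" for Q
  proof -
    obtain n i where Q: "Q = dyadic n i" "i < 2 ^ n" using \<open>Q \<in> dyadic_tree\<close> by (auto simp: dyadic_tree_def)
    define a b where ab: "a = real i / 2 ^ n" "b = real (Suc i) / 2 ^ n"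
    have "a < b" unfolding ab by (rule dyadic_less)
    define m where "m = (a + b) / 2"
    have m: "a < m" "m < b" using \<open>a < b\<close> by (auto simp: m_def)
    have Qe: "Q = {a<..b}" by (simp only: Q dyadic_def ab)
    have C: "dyadic_children {a<..b} = {{a<..m}, {m<..b}}"
      unfolding dyadic_children_def using \<open>a < b\<close> by (simp add: m_def)
    have sub: "dyadic_children Q \<subseteq> dyadic_tree"
    proof -
      have "2 * i < 2 ^ Suc n" "2 * i + 1 < 2 ^ Suc n" using Q by auto
      then show ?thesis unfolding Q(1) dyadic_children_eq dyadic_tree_def by blast
    qed
    have ne: "{a<..m} \<noteq> {m<..b}"
    proof
      assume "{a<..m} = {m<..b}"
      moreover have "m \<in> {a<..m}" "m \<notin> {m<..b}" using m by auto
      ultimately show False by simp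
    qed
    have dj: "{a<..m} \<inter> {m<..b} = {}" by auto
    have un: "{a<..b} = {a<..m} \<union> {m<..b}" using m by auto
    have "disjoint (dyadic_children Q)" unfolding Qe C disjoint_def using dj by auto
    moreover have "Q = \<Union> (dyadic_children Q)" unfolding Qe C using un by simp
    moreover have "2 \<le> card (dyadic_children Q)" unfolding Qe C using ne by simp
    moreover have "\<forall>R\<in>dyadic_children Q. R \<subseteq> Q" unfolding Qe C using m by auto
    moreover have "finite (dyadic_children Q)" by (simp add: Qe C)
    ultimately show ?thesis using sub by blast
  qed
  have pos: "\<forall>Q\<in>dyadic_tree. 0 < measure unit_space Q"
    by (auto simp: dyadic_tree_def measure_dyadic)
  have "space unit_space \<in> dyadic_tree" unfolding sp dyadic_tree_def by (intro CollectI exI[of _ 0]) auto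
  then show ?thesis
    unfolding is_tree_def
  proof (intro conjI sets pos)
    show "\<exists>C. (\<forall>Q\<in>dyadic_tree. C Q \<subseteq> dyadic_tree \<and> finite (C Q) \<and> 2 \<le> card (C Q) \<and> disjoint (C Q)
          \<and> (\<forall>R\<in>C Q. R \<subseteq> Q) \<and> Q = \<Union> (C Q)) \<and> dyadic_tree = (\<Union>m. tree_level C (space unit_space) m)"
      by (rule exI[of _ dyadic_children], rule conjI, rule ballI, rule ch, assumption, rule T)
  qed
qed

text \<open>
  With \<open>2 ^ e \<le> i < 2 ^ (e + 1)\<close>, the dyadic interval with index \<open>i > 0\<close> does not cross any
  power of \<open>1 / 2\<close>. This dichotomy reduces the testing condition to corners and to subsets of one
  ring.
\<close>

lemma dyadic_cases:
  assumes "S \<in> dyadic_tree"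
  obtains (corner) j where "S = {0<..(1 / 2) ^ j}" | (ring) k where "S \<subseteq> {(1 / 2) ^ Suc k<..(1 / 2) ^ k}"
proof -
  obtain n i where S: "S = dyadic n i" "i < 2 ^ n" using assms by (auto simp: dyadic_tree_def)
  show ?thesis
  proof (cases "i = 0")
    case True
    then show ?thesis using corner[of n] S by (simp add: dyadic_def power_one_over)
  next
    case False
    then obtain e where e: "2 ^ e \<le> i" "i < 2 ^ (e + 1)" using ex_power_ivl1[of 2 i] by auto
    have "(2::nat) ^ e < 2 ^ n" using e S by linarith
    then have "e < n" by (rule power_less_imp_less_exp[rotated]) simp
    then obtain k where k: "n = Suc (k + e)" by (metis less_imp_Suc_add add.commute)
    have 1: "(1 / 2) ^ Suc k \<le> real i / 2 ^ n"
    proof -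
      have "(2::real) ^ e \<le> real i" using e(1) by (metis of_nat_le_iff of_nat_numeral of_nat_power)
      then have "2 ^ e / 2 ^ n \<le> real i / 2 ^ n" by (intro divide_right_mono) auto
      moreover have "(2::real) ^ e / 2 ^ n = (1 / 2) ^ Suc k" by (simp add: k power_add power_one_over)
      ultimately show ?thesis by simp
    qed
    have 2: "real (Suc i) / 2 ^ n \<le> (1 / 2) ^ k"
    proof -
      have "real (Suc i) \<le> (2::real) ^ (e + 1)" using e(2) by (metis Suc_leI of_nat_le_iff of_nat_numeral of_nat_power)
      then have "real (Suc i) / 2 ^ n \<le> 2 ^ (e + 1) / 2 ^ n" by (intro divide_right_mono) auto
      moreover have "(2::real) ^ (e + 1) / 2 ^ n = (1 / 2) ^ k" by (simp add: k power_add power_one_over)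
      ultimately show ?thesis by simp
    qed
    have "S \<subseteq> {(1 / 2) ^ Suc k<..(1 / 2) ^ k}"
      unfolding S(1) dyadic_def using 1 2 by (auto simp del: power_Suc of_nat_Suc)
    then show ?thesis by (rule ring)
  qed
qed

lemma corner_in_dyadic_tree: "{0<..(1 / 2) ^ j} \<in> dyadic_tree"
proof -
  have "{0<..(1 / 2) ^ j} = dyadic j 0" by (simp add: dyadic_def power_one_over)
  moreover have "dyadic j 0 \<in> dyadic_tree"
    unfolding dyadic_tree_def by (rule CollectI, rule exI[of _ j], rule exI[of _ 0]) simp
  ultimately show ?thesis by (simp only:)
qed

text \<open>
  For \<open>x\<close> in the unit interval, the number \<open>k\<close> of the ring \<open>((1/2)\<^bsup>k+1\<^esup>, (1/2)\<^sup>k]\<close> that contains \<open>x\<close>.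
\<close>

definition ring_index :: "real \<Rightarrow> nat" where
  "ring_index x = (LEAST k. (1 / 2) ^ Suc k < x)"

lemma ring_index_eq:
  assumes "(1 / 2) ^ Suc k < x" "x \<le> (1 / 2) ^ k"
  shows "ring_index x = k"
  unfolding ring_index_def
proof (rule Least_equality)
  fix j assume j: "(1 / 2) ^ Suc j < x"
  show "k \<le> j"
  proof (rule ccontr)
    assume "\<not> k \<le> j"
    then have "(1 / 2 :: real) ^ k \<le> (1 / 2) ^ Suc j" by (intro power_decreasing) auto
    then show False using j assms by linarith
  qed
qed (rule assms)

lemma ring_index_bounds:
  assumes "0 < x" "x \<le> 1"
  shows "(1 / 2) ^ Suc (ring_index x) < x" "x \<le> (1 / 2) ^ ring_index x"
proof -
  obtain k where k: "(1 / 2) ^ Suc k < x" "x \<le> (1 / 2) ^ k"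
    using geometric_partition[of "1 / 2" x] assms by auto
  then have "ring_index x = k" by (rule ring_index_eq)
  then show "(1 / 2) ^ Suc (ring_index x) < x" "x \<le> (1 / 2) ^ ring_index x" using k by auto
qed

lemma ring_index_ge_iff:
  assumes "0 < x" "x \<le> 1"
  shows "j \<le> ring_index x \<longleftrightarrow> x \<le> (1 / 2) ^ j"
proof
  assume "j \<le> ring_index x"
  then have "(1 / 2 :: real) ^ ring_index x \<le> (1 / 2) ^ j" by (intro power_decreasing) auto
  then show "x \<le> (1 / 2) ^ j" using ring_index_bounds[OF assms] by linarith
next
  assume x: "x \<le> (1 / 2) ^ j"
  show "j \<le> ring_index x"
  proof (rule ccontr)
    assume "\<not> j \<le> ring_index x"
    then have "(1 / 2 :: real) ^ j \<le> (1 / 2) ^ Suc (ring_index x)" by (intro power_decreasing) auto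
    then show False using x ring_index_bounds[OF assms] by linarith
  qed
qed

lemma ring_subset_unit: "{(1 / 2) ^ Suc k<..(1 / 2 :: real) ^ k} \<subseteq> {0<..1}"
proof
  fix x :: real assume "x \<in> {(1 / 2) ^ Suc k<..(1 / 2) ^ k}"
  moreover have "(0::real) < (1 / 2) ^ Suc k" "(1 / 2 :: real) ^ k \<le> 1" by (auto intro: power_le_one simp del: power_Suc)
  ultimately show "x \<in> {0<..1}" unfolding greaterThanAtMost_iff by linarith
qed

lemma measurable_ring_index [measurable]: "ring_index \<in> measurable unit_space (count_space UNIV)"
  unfolding measurable_count_space_eq2_countable
proof (intro conjI ballI)
  fix k :: nat
  have "ring_index -` {k} \<inter> space unit_space = {(1 / 2) ^ Suc k<..(1 / 2) ^ k}"
  proof (intro equalityI subsetI)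
    fix x assume "x \<in> ring_index -` {k} \<inter> space unit_space"
    then show "x \<in> {(1 / 2) ^ Suc k<..(1 / 2) ^ k}" using ring_index_bounds[of x] by auto
  next
    fix x :: real assume x: "x \<in> {(1 / 2) ^ Suc k<..(1 / 2) ^ k}"
    then have "x \<in> {0<..1}" using ring_subset_unit by blast
    then show "x \<in> ring_index -` {k} \<inter> space unit_space" using x ring_index_eq[of k x] by auto
  qed
  then show "ring_index -` {k} \<inter> space unit_space \<in> sets unit_space"
    using ring_subset_unit[of k] by (auto intro!: sets_unit_spaceI simp del: power_Suc)
qed auto

lemma nn_integral_ring_index:
  "(\<integral>\<^sup>+x\<in>{0<..(1 / 2) ^ j}. \<phi> (ring_index x) \<partial>unit_space) = (\<Sum>k. \<phi> (k + j) * ennreal ((1 / 2) ^ Suc (k + j)))"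
proof -
  have meas: "{(1 / 2) ^ Suc k<..(1 / 2) ^ k} \<in> sets unit_space" for k
    using ring_subset_unit[of k] by (intro sets_unit_spaceI) auto
  have "(\<integral>\<^sup>+x\<in>{0<..(1 / 2) ^ j}. \<phi> (ring_index x) \<partial>unit_space)
     = (\<integral>\<^sup>+x. (\<Sum>k. \<phi> (k + j) * indicator {(1 / 2) ^ Suc (k + j)<..(1 / 2) ^ (k + j)} x) \<partial>unit_space)"
  proof (rule nn_integral_cong)
    fix x assume "x \<in> space unit_space"
    then have x: "0 < x" "x \<le> 1" by auto
    have ind: "indicator {(1 / 2) ^ Suc (k + j)<..(1 / 2) ^ (k + j)} x = (if ring_index x = k + j then 1 else 0 :: ennreal)" for k
      using ring_index_bounds[OF x] ring_index_eq[of "k + j" x] by (auto simp: indicator_def simp del: power_Suc)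
    show "\<phi> (ring_index x) * indicator {0<..(1 / 2) ^ j} x = (\<Sum>k. \<phi> (k + j) * indicator {(1 / 2) ^ Suc (k + j)<..(1 / 2) ^ (k + j)} x)"
    proof (cases "j \<le> ring_index x")
      case True
      then have "(\<Sum>k. \<phi> (k + j) * indicator {(1 / 2) ^ Suc (k + j)<..(1 / 2) ^ (k + j)} x)
         = (\<Sum>k\<in>{ring_index x - j}. \<phi> (k + j) * indicator {(1 / 2) ^ Suc (k + j)<..(1 / 2) ^ (k + j)} x)"
        unfolding ind by (intro suminf_finite) auto
      then show ?thesis using True x ring_index_ge_iff[OF x, of j] unfolding ind by simp
    next
      case False
      then have "(\<Sum>k. \<phi> (k + j) * indicator {(1 / 2) ^ Suc (k + j)<..(1 / 2) ^ (k + j)} x) = (\<Sum>k. 0)"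
        unfolding ind by (intro suminf_cong) auto
      then show ?thesis using False ring_index_ge_iff[OF x, of j] by simp
    qed
  qed
  also have "\<dots> = (\<Sum>k. \<integral>\<^sup>+x. \<phi> (k + j) * indicator {(1 / 2) ^ Suc (k + j)<..(1 / 2) ^ (k + j)} x \<partial>unit_space)"
    using meas by (intro nn_integral_suminf borel_measurable_times_ennreal borel_measurable_const borel_measurable_indicator)
  also have "\<dots> = (\<Sum>k. \<phi> (k + j) * ennreal ((1 / 2) ^ Suc (k + j)))"
  proof (intro suminf_cong)
    fix k
    have "emeasure unit_space {(1 / 2) ^ Suc (k + j)<..(1 / 2) ^ (k + j)} = ennreal ((1 / 2) ^ (k + j) - (1 / 2) ^ Suc (k + j))"
      unfolding emeasure_unit_space[OF ring_subset_unit] by (rule emeasure_lborel_Ioc) simp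
    also have "(1 / 2 :: real) ^ (k + j) - (1 / 2) ^ Suc (k + j) = (1 / 2) ^ Suc (k + j)" by simp
    finally show "(\<integral>\<^sup>+x. \<phi> (k + j) * indicator {(1 / 2) ^ Suc (k + j)<..(1 / 2) ^ (k + j)} x \<partial>unit_space) = \<phi> (k + j) * ennreal ((1 / 2) ^ Suc (k + j))"
      using meas[of "k + j"] by (subst nn_integral_cmult_indicator) auto
  qed
  finally show ?thesis .
qed

section \<open>Weights for which the constant is attained in the limit\<close>

text \<open>
  The last conditions say that \<open>t\<close> is close to 1. The one with \<open>2 powr q\<close> makes the testing
  condition hold on a whole ring, and the one with \<open>2 powr (1 - \<alpha>)\<close> makes
  \<open>height\<close> nondecreasing.
\<close>

locale sharp_example =
  fixes p q \<alpha> L t :: real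
  assumes p: "1 < p" and q: "p \<le> q" and a0: "0 \<le> \<alpha>" and a1: "\<alpha> < 1" and apq: "1 / p - 1 / q \<le> \<alpha>" and L: "0 < L"
    and t: "1 / 2 \<le> t" "t < 1"
    and tq: "2 powr q * (q / p) * (1 - t) \<le> 1"
    and ta: "1 \<le> 2 powr (1 - \<alpha>) * t"
begin

text \<open>
  \<open>dens k\<close> is the density of \<open>\<sigma>\<close> on ring \<open>k\<close>; it gives the corner \<open>(0, (1/2)\<^sup>k]\<close> the mass \<open>t\<^sup>k\<close>.
  \<open>height k\<close> is the value \<open>\<mu>(Q)\<^bsup>\<alpha>-1\<^esup> \<sigma>(Q)\<close> of that corner, and
  the density \<open>udens\<close> of \<open>u\<close> is chosen such that ring \<open>k\<close> contributes \<open>L powr q * gap k\<close> to the integral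
  in the testing condition; these contributions telescope to the right-hand side.
\<close>

definition dens :: "nat \<Rightarrow> real" where
  "dens k = 2 ^ Suc k * (t ^ k - t ^ Suc k)"

definition height :: "nat \<Rightarrow> real" where
  "height k = 2 powr ((1 - \<alpha>) * real k) * t ^ k"

definition gap :: "nat \<Rightarrow> real" where
  "gap k = (t ^ k) powr (q / p) - (t ^ Suc k) powr (q / p)"

definition udens :: "nat \<Rightarrow> real" where
  "udens k = L powr q * height k powr (- q) * gap k * 2 ^ Suc k"

lemma t0: "0 < t" using t by simp

lemma q0: "0 < q" "1 \<le> q / p" "0 < q / p" "q / p \<le> q" using p q by (auto simp: field_simps)

lemma dens_half: "dens k * (1 / 2) ^ Suc k = t ^ k - t ^ Suc k"
proof -
  have "(2::real) ^ Suc k * (1 / 2) ^ Suc k = 1" by (simp only: power_mult_distrib[symmetric]) simp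
  then show ?thesis unfolding dens_def by (metis mult.commute mult.left_commute mult_1)
qed

lemma dens_pos: "0 < dens k"
  unfolding dens_def using t t0 by (intro mult_pos_pos) auto

lemma height_pos: "0 < height k" using t0 by (simp add: height_def)

lemma powr_Suc_exponent: "2 powr ((1 - \<alpha>) * real (Suc k)) = 2 powr (1 - \<alpha>) * 2 powr ((1 - \<alpha>) * real k)"
proof -
  have "(1 - \<alpha>) * real (Suc k) = (1 - \<alpha>) + (1 - \<alpha>) * real k" by (simp add: algebra_simps)
  then show ?thesis by (simp only: powr_add)
qed

lemma height_Suc: "height (Suc k) = height k * (2 powr (1 - \<alpha>) * t)"
  unfolding height_def powr_Suc_exponent by simp

lemma height_mono: "j \<le> k \<Longrightarrow> height j \<le> height k"
proof (induction k rule: dec_induct)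
  case (step n)
  have "height n * 1 \<le> height n * (2 powr (1 - \<alpha>) * t)"
    using ta height_pos[of n] by (intro mult_left_mono) auto
  then show ?case using step by (simp add: height_Suc)
qed simp

lemma gap_pos: "0 < gap k"
  unfolding gap_def using t t0 q0 by (auto intro!: powr_less_mono2)

lemma udens_pos: "0 < udens k"
  unfolding udens_def using L height_pos[of k] gap_pos[of k] by (intro mult_pos_pos) auto

lemma udens_half: "udens k * (1 / 2) ^ Suc k = L powr q * height k powr (- q) * gap k"
proof -
  have "(2::real) ^ Suc k * (1 / 2) ^ Suc k = 1" by (simp only: power_mult_distrib[symmetric]) simp
  then show ?thesis unfolding udens_def by (metis mult.assoc mult.right_neutral)
qed

lemma tlim: "(\<lambda>n. t ^ (n + j)) \<longlonglongrightarrow> 0"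
  using t t0 by (intro LIMSEQ_ignore_initial_segment LIMSEQ_realpow_zero) auto

lemma suminf_mass: "(\<Sum>k. ennreal (t ^ (k + j) - t ^ Suc (k + j))) = ennreal (t ^ j)"
proof -
  have "(\<lambda>n. t ^ (n + j) - t ^ (Suc n + j)) sums (t ^ (0 + j) - 0)" by (rule telescope_sums'[OF tlim])
  then show ?thesis using t t0 by (intro suminf_ennreal_eq) auto
qed

lemma suminf_gap: "(\<Sum>k. ennreal (L powr q * gap (k + j))) = ennreal (L powr q * (t ^ j) powr (q / p))"
proof -
  have "continuous_on {0..} (\<lambda>x::real. x powr (q / p))" using q0 by (intro continuous_on_powr_nonneg)
  then have "((\<lambda>x::real. x powr (q / p)) \<longlongrightarrow> 0 powr (q / p)) (at 0 within {0..})"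
    unfolding continuous_on_def by (rule bspec) auto
  moreover have "filterlim (\<lambda>n. t ^ (n + j)) (at 0 within {0..}) sequentially"
    using tlim[of j] t0 by (simp add: filterlim_at)
  ultimately have "(\<lambda>n. (t ^ (n + j)) powr (q / p)) \<longlonglongrightarrow> 0 powr (q / p)" by (rule filterlim_compose)
  then have "(\<lambda>n. (t ^ (n + j)) powr (q / p) - (t ^ (Suc n + j)) powr (q / p)) sums ((t ^ (0 + j)) powr (q / p) - 0 powr (q / p))"
    by (rule telescope_sums')
  then have "(\<lambda>n. L powr q * (gap (n + j))) sums (L powr q * ((t ^ (0 + j)) powr (q / p) - 0 powr (q / p)))"
    unfolding gap_def by (intro sums_mult) simp
  then show ?thesis using gap_pos by (intro suminf_ennreal_eq) (auto simp: less_imp_le)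
qed

abbreviation \<sigma> :: "real \<Rightarrow> real" where "\<sigma> x \<equiv> dens (ring_index x)"
abbreviation u :: "real \<Rightarrow> real" where "u x \<equiv> udens (ring_index x)"
abbreviation v :: "real \<Rightarrow> real" where "v x \<equiv> dens (ring_index x) powr (1 - p)"

lemma v_dual: "v x powr (1 - conj_exp p) = \<sigma> x"
proof -
  have "(1 - p) * (1 - conj_exp p) = 1" using p by (simp add: conj_exp_def field_simps)
  then show ?thesis using dens_pos[of "ring_index x"] by (simp add: powr_powr)
qed

lemma measurable_ring_comp [measurable]: "(\<lambda>x. \<phi> (ring_index x) :: real) \<in> borel_measurable unit_space"
  by (rule measurable_compose[OF measurable_ring_index]) simp

lemma integral_sigma_corner: "(\<integral>\<^sup>+x\<in>{0<..(1 / 2) ^ j}. ennreal (\<sigma> x) \<partial>unit_space) = ennreal (t ^ j)"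
proof -
  have "(\<integral>\<^sup>+x\<in>{0<..(1 / 2) ^ j}. ennreal (\<sigma> x) \<partial>unit_space) = (\<Sum>k. ennreal (dens (k + j)) * ennreal ((1 / 2) ^ Suc (k + j)))"
    by (rule nn_integral_ring_index)
  also have "\<dots> = (\<Sum>k. ennreal (t ^ (k + j) - t ^ Suc (k + j)))"
  proof (intro suminf_cong)
    fix k
    have "ennreal (dens (k + j)) * ennreal ((1 / 2) ^ Suc (k + j)) = ennreal (dens (k + j) * (1 / 2) ^ Suc (k + j))"
      using dens_pos[of "k + j"] by (intro ennreal_mult[symmetric]) auto
    then show "ennreal (dens (k + j)) * ennreal ((1 / 2) ^ Suc (k + j)) = ennreal (t ^ (k + j) - t ^ Suc (k + j))"
      by (simp only: dens_half)
  qed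
  also have "\<dots> = ennreal (t ^ j)" by (rule suminf_mass)
  finally show ?thesis .
qed

lemma nn_integral_unit_space_restrict: "(\<integral>\<^sup>+x. h x \<partial>unit_space) = (\<integral>\<^sup>+x\<in>{0<..(1 / 2) ^ 0}. h x \<partial>unit_space)"
  by (rule nn_integral_cong) simp

lemma nn_integral_ring:
  assumes "S \<subseteq> {(1 / 2) ^ Suc k<..(1 / 2) ^ k}" "S \<in> sets unit_space"
  shows "(\<integral>\<^sup>+x\<in>S. \<phi> (ring_index x) \<partial>unit_space) = \<phi> k * ennreal (measure unit_space S)"
proof -
  interpret prob_space unit_space by (rule prob_space_unit_space)
  have "(\<integral>\<^sup>+x\<in>S. \<phi> (ring_index x) \<partial>unit_space) = (\<integral>\<^sup>+x. \<phi> k * indicator S x \<partial>unit_space)"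
  proof (rule nn_integral_cong)
    fix x
    show "\<phi> (ring_index x) * indicator S x = \<phi> k * indicator S x"
    proof (cases "x \<in> S")
      case True
      then have "ring_index x = k" using assms(1) by (intro ring_index_eq) (auto simp del: power_Suc)
      then show ?thesis by simp
    qed simp
  qed
  also have "\<dots> = \<phi> k * ennreal (measure unit_space S)"
    using assms(2) by (subst nn_integral_cmult_indicator) (auto simp: emeasure_eq_measure)
  finally show ?thesis .
qed

lemma tree_sets: "Q \<in> dyadic_tree \<Longrightarrow> Q \<in> sets unit_space"
  using is_tree_dyadic by (auto simp: is_tree_def)

lemma tree_pos: "Q \<in> dyadic_tree \<Longrightarrow> 0 < measure unit_space Q"
  using is_tree_dyadic by (auto simp: is_tree_def)

lemma measure_corner: "measure unit_space {0<..(1 / 2) ^ j} = (1 / 2) ^ j"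
proof -
  have "(1 / 2 :: real) ^ j \<le> 1" by (rule power_le_one) auto
  then have "measure unit_space {0<..(1 / 2) ^ j} = measure lborel {0<..(1 / 2 :: real) ^ j}"
    by (intro measure_unit_space) auto
  then show ?thesis by simp
qed

lemma measure_ring_le:
  assumes "S \<subseteq> {(1 / 2) ^ Suc k<..(1 / 2) ^ k}" "S \<in> sets unit_space"
  shows "measure unit_space S \<le> (1 / 2) ^ Suc k"
proof -
  interpret prob_space unit_space by (rule prob_space_unit_space)
  have "measure unit_space S \<le> measure unit_space {(1 / 2) ^ Suc k<..(1 / 2) ^ k}"
    using ring_subset_unit[of k] assms by (intro finite_measure_mono sets_unit_spaceI) auto
  also have "\<dots> = measure lborel {(1 / 2) ^ Suc k<..(1 / 2 :: real) ^ k}"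
    by (rule measure_unit_space[OF ring_subset_unit])
  also have "\<dots> = (1 / 2) ^ k - (1 / 2) ^ Suc k" by (rule measure_lborel_Ioc) simp
  finally show ?thesis by simp
qed

lemma half_powr: "((1 / 2) ^ k) powr \<alpha> * (1 / (1 / 2) ^ k) = 2 powr ((1 - \<alpha>) * real k)"
proof -
  have h: "(1 / 2 :: real) ^ k = 2 powr (- real k)"
    by (simp add: powr_minus powr_realpow power_one_over inverse_eq_divide)
  have "((1 / 2 :: real) ^ k) powr \<alpha> * (1 / (1 / 2) ^ k) = 2 powr (- real k * \<alpha>) * 2 powr (real k)"
  proof -
    have "1 / (1 / 2 :: real) ^ k = 2 powr (real k)" by (simp add: powr_realpow power_one_over)
    moreover have "((1 / 2 :: real) ^ k) powr \<alpha> = 2 powr (- real k * \<alpha>)" unfolding h by (simp only: powr_powr)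
    ultimately show ?thesis by (simp only:)
  qed
  also have "\<dots> = 2 powr (- real k * \<alpha> + real k)" by (simp only: powr_add)
  finally show ?thesis by (simp add: algebra_simps)
qed

lemma ring_height: "((1 / 2) ^ Suc k) powr \<alpha> * dens k = 2 powr (1 - \<alpha>) * (1 - t) * height k"
proof -
  have "((1 / 2) ^ Suc k) powr \<alpha> * dens k = (((1 / 2) ^ Suc k) powr \<alpha> * (1 / (1 / 2) ^ Suc k)) * (dens k * (1 / 2) ^ Suc k)"
    by simp
  also have "\<dots> = 2 powr ((1 - \<alpha>) * real (Suc k)) * (t ^ k - t ^ Suc k)"
    by (simp only: half_powr dens_half)
  also have "\<dots> = 2 powr (1 - \<alpha>) * (1 - t) * height k"
    unfolding height_def powr_Suc_exponent by (simp add: algebra_simps)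
  finally show ?thesis .
qed

text \<open>
  On ring \<open>k\<close> the best competitor is the corner of level \<open>k\<close>: larger corners have smaller height, and
  an interval inside the ring has at most the value of the ring, which carries only the fraction
  \<open>1 - t\<close> of the mass of its corner.
\<close>

lemma frac_max_corner_le:
  assumes x: "0 < x" "x \<le> (1 / 2) ^ j"
  shows "frac_max unit_space dyadic_tree \<alpha> (\<lambda>y. indicator {0<..(1 / 2) ^ j} y * \<sigma> y) x \<le> ennreal (height (ring_index x))"
  unfolding frac_max_def
proof (rule SUP_least)
  fix Q assume "Q \<in> {Q \<in> dyadic_tree. x \<in> Q}"
  then have Q: "Q \<in> dyadic_tree" "x \<in> Q" by auto
  have "(1 / 2 :: real) ^ j \<le> 1" by (rule power_le_one) auto
  then have x1: "x \<le> 1" using x by linarith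
  define k where "k = ring_index x"
  have jk: "j \<le> k" unfolding k_def using ring_index_ge_iff[OF x(1) x1] x by simp
  have int: "(\<integral>\<^sup>+y\<in>Q. ennreal \<bar>indicator {0<..(1 / 2) ^ j} y * \<sigma> y\<bar> \<partial>unit_space) = (\<integral>\<^sup>+y\<in>Q \<inter> {0<..(1 / 2) ^ j}. ennreal (\<sigma> y) \<partial>unit_space)"
    by (rule nn_integral_cong) (use dens_pos in \<open>auto simp: indicator_def abs_of_pos\<close>)
  show "ennreal (measure unit_space Q powr \<alpha> * (1 / measure unit_space Q)) * (\<integral>\<^sup>+y\<in>Q. ennreal \<bar>indicator {0<..(1 / 2) ^ j} y * \<sigma> y\<bar> \<partial>unit_space) \<le> ennreal (height (ring_index x))"
    using Q(1)
  proof (cases rule: dyadic_cases)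
    case (corner i)
    have ik: "i \<le> k" unfolding k_def using ring_index_ge_iff[OF x(1) x1] Q corner by simp
    define m where "m = max i j"
    have mk: "m \<le> k" "i \<le> m" using ik jk by (auto simp: m_def)
    have "Q \<inter> {0<..(1 / 2) ^ j} = {0<..(1 / 2) ^ m}"
    proof (cases "i \<le> j")
      case True
      then have "(1 / 2 :: real) ^ j \<le> (1 / 2) ^ i" by (intro power_decreasing) auto
      then show ?thesis using True corner by (auto simp: m_def max_def)
    next
      case False
      then have "(1 / 2 :: real) ^ i \<le> (1 / 2) ^ j" by (intro power_decreasing) auto
      then show ?thesis using False corner by (auto simp: m_def max_def)
    qed
    then have "ennreal (measure unit_space Q powr \<alpha> * (1 / measure unit_space Q)) * (\<integral>\<^sup>+y\<in>Q. ennreal \<bar>indicator {0<..(1 / 2) ^ j} y * \<sigma> y\<bar> \<partial>unit_space)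
       = ennreal (2 powr ((1 - \<alpha>) * real i)) * ennreal (t ^ m)"
      unfolding int by (simp only: integral_sigma_corner corner measure_corner half_powr)
    also have "\<dots> = ennreal (2 powr ((1 - \<alpha>) * real i) * t ^ m)" using t0 by (simp add: ennreal_mult)
    also have "\<dots> \<le> ennreal (height m)"
      unfolding height_def using mk a1 t0 by (intro ennreal_leI mult_right_mono) (auto intro!: mult_left_mono)
    also have "\<dots> \<le> ennreal (height k)" by (intro ennreal_leI height_mono mk)
    finally show ?thesis by (simp add: k_def)
  next
    case (ring l)
    have "ring_index x = l" using ring Q by (intro ring_index_eq) (auto simp del: power_Suc)
    then have lk: "l = k" by (simp add: k_def)
    define m where "m = measure unit_space Q"
    have m: "0 < m" "m \<le> (1 / 2) ^ Suc k" using tree_pos[OF Q(1)] measure_ring_le[OF ring tree_sets[OF Q(1)]] by (simp_all only: m_def lk)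
    have "(\<integral>\<^sup>+y\<in>Q \<inter> {0<..(1 / 2) ^ j}. ennreal (\<sigma> y) \<partial>unit_space) \<le> (\<integral>\<^sup>+y\<in>Q. ennreal (\<sigma> y) \<partial>unit_space)"
      by (rule nn_integral_mono) (auto simp: indicator_def)
    also have "\<dots> = ennreal (dens k) * ennreal m" unfolding m_def lk[symmetric] by (rule nn_integral_ring[OF ring tree_sets[OF Q(1)]])
    finally have "ennreal (measure unit_space Q powr \<alpha> * (1 / measure unit_space Q)) * (\<integral>\<^sup>+y\<in>Q. ennreal \<bar>indicator {0<..(1 / 2) ^ j} y * \<sigma> y\<bar> \<partial>unit_space)
       \<le> ennreal (m powr \<alpha> * (1 / m)) * (ennreal (dens k) * ennreal m)"
      unfolding int m_def by (rule mult_left_mono) simp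
    also have "\<dots> = ennreal (m powr \<alpha> * dens k)" using m dens_pos[of k] by (simp add: ennreal_mult[symmetric])
    also have "\<dots> \<le> ennreal (((1 / 2) ^ Suc k) powr \<alpha> * dens k)"
      using m dens_pos[of k] a0 by (intro ennreal_leI mult_right_mono powr_mono2) auto
    also have "\<dots> \<le> ennreal (height k)"
    proof (rule ennreal_leI)
      have "2 powr (1 - \<alpha>) \<le> 2 powr (1::real)" using a0 by (intro powr_mono) auto
      then have "2 powr (1 - \<alpha>) * (1 - t) \<le> 2 * (1 - t)" using t by (intro mult_right_mono) auto
      also have "\<dots> \<le> 1" using t by simp
      finally show "((1 / 2) ^ Suc k) powr \<alpha> * dens k \<le> height k"
        unfolding ring_height using height_pos[of k] by (intro mult_left_le_one_le) (use t in auto)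
    qed
    finally show ?thesis by (simp add: k_def)
  qed
qed

text \<open>
  The density is constant on the ring, so \<open>\<mu>(Q)\<^bsup>\<alpha>-1\<^esup> \<sigma>(Q \<inter> S)\<close> is largest for \<open>Q = S\<close>: inside \<open>S\<close> because
  \<open>\<alpha> \<ge> 0\<close>, and for larger \<open>Q\<close> because \<open>\<alpha> < 1\<close>.
\<close>

lemma frac_max_ring_le:
  assumes S: "S \<in> dyadic_tree" "S \<subseteq> {(1 / 2) ^ Suc k<..(1 / 2) ^ k}" and x: "x \<in> S"
  shows "frac_max unit_space dyadic_tree \<alpha> (\<lambda>y. indicator S y * \<sigma> y) x \<le> ennreal (measure unit_space S powr \<alpha> * dens k)"
  unfolding frac_max_def
proof (rule SUP_least)
  interpret prob_space unit_space by (rule prob_space_unit_space)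
  fix Q assume "Q \<in> {Q \<in> dyadic_tree. x \<in> Q}"
  then have Q: "Q \<in> dyadic_tree" "x \<in> Q" by auto
  have int: "(\<integral>\<^sup>+y\<in>Q. ennreal \<bar>indicator S y * \<sigma> y\<bar> \<partial>unit_space) = (\<integral>\<^sup>+y\<in>Q \<inter> S. ennreal (\<sigma> y) \<partial>unit_space)"
    by (rule nn_integral_cong) (use dens_pos in \<open>auto simp: indicator_def abs_of_pos\<close>)
  have QS: "Q \<inter> S \<in> sets unit_space" using tree_sets Q S by auto
  have QSk: "Q \<inter> S \<subseteq> {(1 / 2) ^ Suc k<..(1 / 2) ^ k}" using S by auto
  define a b where ab: "a = measure unit_space Q" "b = measure unit_space S"
  have pos: "0 < a" "0 < b" unfolding ab using tree_pos Q S by auto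
  define c where "c = measure unit_space (Q \<inter> S)"
  have c0: "0 \<le> c" by (simp add: c_def)
  have key: "a powr \<alpha> * (1 / a) * c \<le> b powr \<alpha>"
  proof (cases "Q \<subseteq> S")
    case True
    then have "c = a" by (simp add: c_def ab Int_absorb2)
    moreover have "a \<le> b" unfolding ab using True tree_sets[OF S(1)] by (intro finite_measure_mono) auto
    ultimately show ?thesis using pos a0 by (auto intro!: powr_mono2)
  next
    case False
    then have SQ: "S \<subseteq> Q" using tree_nested[OF is_tree_dyadic Q(1) S(1)] Q x by auto
    then have "c = b" by (simp add: c_def ab Int_absorb1)
    have "b \<le> a" unfolding ab using SQ tree_sets[OF Q(1)] by (intro finite_measure_mono) auto
    then have "a powr (\<alpha> - 1) \<le> b powr (\<alpha> - 1)" using pos a1 by (intro powr_mono2') auto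
    then have "a powr (\<alpha> - 1) * b \<le> b powr (\<alpha> - 1) * b" using pos by (intro mult_right_mono) auto
    then show ?thesis using pos \<open>c = b\<close> by (simp add: powr_diff)
  qed
  have "ennreal (measure unit_space Q powr \<alpha> * (1 / measure unit_space Q)) * (\<integral>\<^sup>+y\<in>Q. ennreal \<bar>indicator S y * \<sigma> y\<bar> \<partial>unit_space)
      = ennreal (a powr \<alpha> * (1 / a)) * (ennreal (dens k) * ennreal c)"
    unfolding int nn_integral_ring[OF QSk QS, of "\<lambda>k. ennreal (dens k)"] by (simp only: ab c_def)
  also have "\<dots> = ennreal ((a powr \<alpha> * (1 / a) * c) * dens k)"
    using pos c0 dens_pos[of k] by (simp add: ennreal_mult[symmetric] mult_ac)
  also have "\<dots> \<le> ennreal (b powr \<alpha> * dens k)"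
    using dens_pos[of k] key by (intro ennreal_leI mult_right_mono) auto
  finally show "ennreal (measure unit_space Q powr \<alpha> * (1 / measure unit_space Q)) * (\<integral>\<^sup>+y\<in>Q. ennreal \<bar>indicator S y * \<sigma> y\<bar> \<partial>unit_space)
      \<le> ennreal (measure unit_space S powr \<alpha> * dens k)" by (simp add: ab)
qed

text \<open>
  The testing condition for a subset of measure \<open>m\<close> of a ring. The quotient of the two sides is a
  multiple of \<open>m powr e\<close> with \<open>e = \<alpha> * q + 1 - q / p\<close>, and \<open>e \<ge> 0\<close> is the hypothesis
  \<open>\<alpha> \<ge> 1 / p - 1 / q\<close>. So the worst case is the whole ring, and there the closeness of \<open>t\<close> to 1 helps.
\<close>

lemma ring_inequality:
  assumes m: "0 < m" "m \<le> (1 / 2) ^ Suc k"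
  shows "(m powr \<alpha> * dens k) powr q * udens k * m \<le> L powr q * (dens k * m) powr (q / p)"
proof -
  define h where "h = (1 / 2 :: real) ^ Suc k"
  have h: "0 < h" "m \<le> h" using m by (auto simp: h_def)
  define \<theta> where "\<theta> = 1 - t"
  have th: "0 < \<theta>" "\<theta> \<le> 1" using t by (auto simp: \<theta>_def)
  have at_h: "(h powr \<alpha> * dens k) powr q * (udens k * h) \<le> L powr q * (dens k * h) powr (q / p)"
  proof -
    have A: "h powr \<alpha> * dens k = 2 powr (1 - \<alpha>) * \<theta> * height k" unfolding h_def \<theta>_def by (rule ring_height)
    have B: "udens k * h = L powr q * height k powr (- q) * gap k" unfolding h_def by (rule udens_half)
    have "dens k * h = t ^ k - t ^ Suc k" unfolding h_def by (rule dens_half)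
    then have C: "dens k * h = \<theta> * t ^ k" by (simp add: \<theta>_def algebra_simps)
    have G: "gap k = (t ^ k) powr (q / p) * (1 - t powr (q / p))"
      using t0 by (simp add: gap_def powr_mult algebra_simps)
    have bern: "1 - t powr (q / p) \<le> q / p * \<theta>"
    proof (cases "q = p")
      case True
      then show ?thesis using t0 p by (simp add: \<theta>_def)
    next
      case False
      then have "1 < q / p" using p q by simp
      then show ?thesis unfolding \<theta>_def using t0 by (intro Bernoulli_powr) auto
    qed
    have "(2 powr (1 - \<alpha>) * \<theta>) powr q * (1 - t powr (q / p)) \<le> (2 powr q * \<theta> powr (q / p)) * (q / p * \<theta>)"
    proof (rule mult_mono)
      have "(2 powr (1 - \<alpha>) * \<theta>) powr q = 2 powr ((1 - \<alpha>) * q) * \<theta> powr q"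
        using th by (simp add: powr_mult powr_powr)
      also have "\<dots> \<le> 2 powr q * \<theta> powr (q / p)"
        using th q0 a0 by (intro mult_mono powr_mono powr_mono') (auto simp: mult_left_le_one_le algebra_simps)
      finally show "(2 powr (1 - \<alpha>) * \<theta>) powr q \<le> 2 powr q * \<theta> powr (q / p)" .
      show "0 \<le> 1 - t powr (q / p)" using t t0 q0 by (simp add: powr_le1)
    qed (use bern in auto)
    also have "\<dots> = \<theta> powr (q / p) * (2 powr q * (q / p) * \<theta>)" by simp
    also have "\<dots> \<le> \<theta> powr (q / p) * 1" using tq by (intro mult_left_mono) (auto simp: \<theta>_def)
    finally have D: "(2 powr (1 - \<alpha>) * \<theta>) powr q * (1 - t powr (q / p)) \<le> \<theta> powr (q / p)" by simp
    have "(h powr \<alpha> * dens k) powr q * (udens k * h) = L powr q * (t ^ k) powr (q / p) * ((2 powr (1 - \<alpha>) * \<theta>) powr q * (1 - t powr (q / p)))"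
    proof -
      have "(2 powr (1 - \<alpha>) * \<theta> * height k) powr q = (2 powr (1 - \<alpha>) * \<theta>) powr q * height k powr q"
        using th height_pos[of k] by (subst powr_mult) auto
      moreover have "height k powr q * height k powr (- q) = 1" using height_pos[of k] by (simp add: powr_minus)
      ultimately show ?thesis unfolding A B G by (simp add: mult_ac) 
    qed
    also have "\<dots> \<le> L powr q * (t ^ k) powr (q / p) * \<theta> powr (q / p)"
      using D L t0 by (intro mult_left_mono) auto
    also have "\<dots> = L powr q * (dens k * h) powr (q / p)"
      unfolding C using th t0 by (subst powr_mult) auto
    finally show ?thesis .
  qed
  \<comment> \<open>the exponent of m in the quotient of the two sides\<close>
  define e where "e = \<alpha> * q + 1 - q / p"
  have "(1 / p - 1 / q) * q \<le> \<alpha> * q" using apq q0 by (intro mult_right_mono) auto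
  then have e0: "0 \<le> e" using q0 p by (simp add: e_def left_diff_distrib)
  have split: "(z powr \<alpha> * dens k) powr q * udens k * z = z powr e * (z powr (q / p) * (dens k powr q * udens k))" if "0 < z" for z
  proof -
    have "z powr e * z powr (q / p) = z powr (\<alpha> * q) * z"
      using that by (simp add: powr_add[symmetric] e_def) (simp add: powr_add)
    moreover have "(z powr \<alpha> * dens k) powr q = z powr (\<alpha> * q) * dens k powr q"
      using dens_pos[of k] that by (subst powr_mult) (auto simp: powr_powr)
    ultimately show ?thesis by (simp add: mult_ac)
  qed
  have "(h powr \<alpha> * dens k) powr q * (udens k * h) = h powr (q / p) * (h powr e * (dens k powr q * udens k))"
    using split[OF h(1)] by (simp only: mult.assoc mult.left_commute)
  moreover have "L powr q * (dens k * h) powr (q / p) = h powr (q / p) * (L powr q * dens k powr (q / p))"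
    using h dens_pos[of k] by (simp add: powr_mult)
  ultimately have "h powr (q / p) * (h powr e * (dens k powr q * udens k)) \<le> h powr (q / p) * (L powr q * dens k powr (q / p))"
    using at_h by (simp only:)
  then have H: "h powr e * (dens k powr q * udens k) \<le> L powr q * dens k powr (q / p)"
    using h by (simp add: mult_le_cancel_left_pos)
  have "(m powr \<alpha> * dens k) powr q * udens k * m = m powr (q / p) * (m powr e * (dens k powr q * udens k))"
    using split[OF m(1)] by (simp add: mult_ac)
  also have "\<dots> \<le> m powr (q / p) * (h powr e * (dens k powr q * udens k))"
    using m h e0 dens_pos[of k] udens_pos[of k] by (intro mult_left_mono mult_right_mono powr_mono2) auto
  also have "\<dots> \<le> m powr (q / p) * (L powr q * dens k powr (q / p))" by (intro mult_left_mono H) auto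
  also have "\<dots> = L powr q * (dens k * m) powr (q / p)" using m dens_pos[of k] by (simp add: powr_mult mult_ac)
  finally show ?thesis .
qed


lemma weight_sigma: "weight unit_space \<sigma>"
  unfolding weight_def
proof (intro conjI ballI dens_pos)
  have "(\<integral>\<^sup>+x. ennreal (\<sigma> x) \<partial>unit_space) = ennreal (t ^ 0)"
    by (rule trans[OF nn_integral_unit_space_restrict integral_sigma_corner])
  then show "integrable unit_space \<sigma>"
    using dens_pos by (intro integrableI_nonneg) (auto simp: less_imp_le)
qed

lemma weight_u: "weight unit_space u"
  unfolding weight_def
proof (intro conjI ballI udens_pos)
  have "(\<integral>\<^sup>+x. ennreal (u x) \<partial>unit_space) = (\<Sum>k. ennreal (udens (k + 0)) * ennreal ((1 / 2) ^ Suc (k + 0)))"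
    by (rule trans[OF nn_integral_unit_space_restrict nn_integral_ring_index])
  also have "\<dots> \<le> (\<Sum>k. ennreal (L powr q * gap (k + 0)))"
  proof (intro suminf_le summableI)
    fix k
    have "ennreal (udens (k + 0)) * ennreal ((1 / 2) ^ Suc (k + 0)) = ennreal (udens k * (1 / 2) ^ Suc k)"
      unfolding add_0_right using udens_pos[of k] by (intro ennreal_mult[symmetric]) auto
    also have "\<dots> = ennreal (L powr q * height k powr (- q) * gap k)" by (simp only: udens_half)
    also have "\<dots> \<le> ennreal (L powr q * gap (k + 0))"
    proof (rule ennreal_leI)
      have "height 0 = 1" by (simp add: height_def)
      then have "1 \<le> height k" using height_mono[of 0 k] by simp
      then have "height k powr (- q) \<le> 1 powr (- q)" using q0 by (intro powr_mono2') auto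
      then have "height k powr (- q) \<le> 1" by simp
      then have "L powr q * gap k * height k powr (- q) \<le> L powr q * gap k * 1"
        using gap_pos[of k] by (intro mult_left_mono) auto
      then show "L powr q * height k powr (- q) * gap k \<le> L powr q * gap (k + 0)" by (simp add: mult_ac)
    qed
    finally show "ennreal (udens (k + 0)) * ennreal ((1 / 2) ^ Suc (k + 0)) \<le> ennreal (L powr q * gap (k + 0))" .
  qed
  also have "\<dots> < \<infinity>" unfolding suminf_gap by simp
  finally show "integrable unit_space u"
    using udens_pos by (intro integrableI_nonneg) (auto simp: less_imp_le)
qed

lemma weight_v: "weight unit_space v"
  unfolding weight_def
proof (intro conjI ballI)
  interpret prob_space unit_space by (rule prob_space_unit_space)
  have "2 * (1 - t) \<le> dens k" for k
  proof -
    have "1 \<le> 2 * t" using t by simp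
    then have "1 \<le> (2 * t) ^ k" by (rule one_le_power)
    moreover have "dens k = (2 * (1 - t)) * (2 * t) ^ k" by (simp add: dens_def power_mult_distrib algebra_simps)
    ultimately show ?thesis using t by (simp add: mult_le_cancel_left1)
  qed
  then have "v x \<le> (2 * (1 - t)) powr (1 - p)" for x
    using p t by (intro powr_mono2') auto
  then show "integrable unit_space v"
    by (intro integrable_const_bound[where B = "(2 * (1 - t)) powr (1 - p)"]) auto
  show "0 < v x" for x using dens_pos[of "ring_index x"] by simp
qed

text \<open>
  On corners the bound by \<open>height\<close> makes the integral a telescoping sum with value exactly
  \<open>L powr q * (t ^ j) powr (q / p)\<close>; the other sets are covered by \<open>ring_inequality\<close>.
\<close>

lemma testing: "testing_condition unit_space dyadic_tree \<alpha> p q L u v"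
  unfolding testing_condition_def v_dual
proof
  fix S assume S: "S \<in> dyadic_tree"
  let ?N = "frac_max unit_space dyadic_tree \<alpha> (\<lambda>y. indicator S y * \<sigma> y)"
  have suff: "ennpowr I (1 / q) \<le> ennreal L * ennpowr (ennreal w) (1 / p)"
    if "I \<le> ennreal (L powr q * w powr (q / p))" "0 \<le> w" for I w
  proof -
    have "ennpowr I (1 / q) \<le> ennpowr (ennreal (L powr q * w powr (q / p))) (1 / q)"
      using q0 that by (intro ennpowr_mono) auto
    also have "\<dots> = ennreal ((L powr q * w powr (q / p)) powr (1 / q))" by simp
    also have "(L powr q * w powr (q / p)) powr (1 / q) = L * w powr (1 / p)"
      using q0 L p by (simp add: powr_mult powr_powr)
    also have "ennreal (L * w powr (1 / p)) = ennreal L * ennpowr (ennreal w) (1 / p)"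
      using L that by (simp add: ennreal_mult)
    finally show ?thesis .
  qed
  show "ennpowr (\<integral>\<^sup>+x\<in>S. (ennpowr (?N x) q * ennreal (u x)) \<partial>unit_space) (1 / q)
     \<le> ennreal L * ennpowr (\<integral>\<^sup>+x\<in>S. ennreal (\<sigma> x) \<partial>unit_space) (1 / p)"
    using S
  proof (cases rule: dyadic_cases)
    case (corner j)
    have "(\<integral>\<^sup>+x\<in>S. (ennpowr (?N x) q * ennreal (u x)) \<partial>unit_space)
       \<le> (\<integral>\<^sup>+x\<in>{0<..(1 / 2) ^ j}. ennreal (height (ring_index x) powr q * udens (ring_index x)) \<partial>unit_space)"
    proof (rule nn_integral_mono)
      fix x
      show "ennpowr (?N x) q * ennreal (u x) * indicator S x \<le> ennreal (height (ring_index x) powr q * udens (ring_index x)) * indicator {0<..(1 / 2) ^ j} x"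
      proof (cases "x \<in> S")
        case True
        then have x: "0 < x" "x \<le> (1 / 2) ^ j" using corner by auto
        have "ennpowr (?N x) q \<le> ennpowr (ennreal (height (ring_index x))) q"
          using frac_max_corner_le[OF x] q0 corner by (intro ennpowr_mono) auto
        also have "\<dots> = ennreal (height (ring_index x) powr q)" using height_pos[of "ring_index x"] by simp
        finally have "ennpowr (?N x) q * ennreal (u x) \<le> ennreal (height (ring_index x) powr q) * ennreal (u x)"
          by (rule mult_right_mono) simp
        then show ?thesis using True corner udens_pos[of "ring_index x"] by (simp add: ennreal_mult)
      qed simp
    qed
    also have "\<dots> = (\<Sum>k. ennreal (height (k + j) powr q * udens (k + j)) * ennreal ((1 / 2) ^ Suc (k + j)))"
      by (rule nn_integral_ring_index)
    also have "\<dots> = (\<Sum>k. ennreal (L powr q * gap (k + j)))"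
    proof (intro suminf_cong)
      fix k
      have "ennreal (height (k + j) powr q * udens (k + j)) * ennreal ((1 / 2) ^ Suc (k + j))
        = ennreal (height (k + j) powr q * (udens (k + j) * (1 / 2) ^ Suc (k + j)))"
        using udens_pos[of "k + j"] by (subst ennreal_mult[symmetric]) (auto simp: mult.assoc)
      also have "height (k + j) powr q * (udens (k + j) * (1 / 2) ^ Suc (k + j)) = L powr q * gap (k + j)"
        unfolding udens_half using height_pos[of "k + j"] by (simp add: powr_minus field_simps)
      finally show "ennreal (height (k + j) powr q * udens (k + j)) * ennreal ((1 / 2) ^ Suc (k + j)) = ennreal (L powr q * gap (k + j))" .
    qed
    also have "\<dots> = ennreal (L powr q * (t ^ j) powr (q / p))" by (rule suminf_gap)
    finally have "(\<integral>\<^sup>+x\<in>S. (ennpowr (?N x) q * ennreal (u x)) \<partial>unit_space) \<le> ennreal (L powr q * (t ^ j) powr (q / p))" .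
    from suff[OF this] show ?thesis using t0 unfolding corner integral_sigma_corner by simp
  next
    case (ring k)
    let ?m = "measure unit_space S"
    have m: "0 < ?m" "?m \<le> (1 / 2) ^ Suc k" using tree_pos[OF S] measure_ring_le[OF ring tree_sets[OF S]] by auto
    have "(\<integral>\<^sup>+x\<in>S. (ennpowr (?N x) q * ennreal (u x)) \<partial>unit_space)
       \<le> (\<integral>\<^sup>+x\<in>S. ennreal ((?m powr \<alpha> * dens k) powr q * udens (ring_index x)) \<partial>unit_space)"
    proof (rule nn_integral_mono)
      fix x
      show "ennpowr (?N x) q * ennreal (u x) * indicator S x \<le> ennreal ((?m powr \<alpha> * dens k) powr q * udens (ring_index x)) * indicator S x"
      proof (cases "x \<in> S")
        case True
        have "ennpowr (?N x) q \<le> ennpowr (ennreal (?m powr \<alpha> * dens k)) q"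
          using frac_max_ring_le[OF S ring True] q0 by (intro ennpowr_mono) auto
        also have "\<dots> = ennreal ((?m powr \<alpha> * dens k) powr q)" using dens_pos[of k] by simp
        finally have "ennpowr (?N x) q * ennreal (u x) \<le> ennreal ((?m powr \<alpha> * dens k) powr q) * ennreal (u x)"
          by (rule mult_right_mono) simp
        then show ?thesis using True udens_pos[of "ring_index x"] by (simp add: ennreal_mult)
      qed simp
    qed
    also have "\<dots> = ennreal ((?m powr \<alpha> * dens k) powr q * udens k) * ennreal ?m"
      by (rule nn_integral_ring[OF ring tree_sets[OF S]])
    also have "\<dots> = ennreal ((?m powr \<alpha> * dens k) powr q * udens k * ?m)"
      using udens_pos[of k] by (simp add: ennreal_mult)
    also have "\<dots> \<le> ennreal (L powr q * (dens k * ?m) powr (q / p))"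
      by (intro ennreal_leI ring_inequality m)
    finally have "(\<integral>\<^sup>+x\<in>S. (ennpowr (?N x) q * ennreal (u x)) \<partial>unit_space) \<le> ennreal (L powr q * (dens k * ?m) powr (q / p))" .
    then have "ennpowr (\<integral>\<^sup>+x\<in>S. (ennpowr (?N x) q * ennreal (u x)) \<partial>unit_space) (1 / q) \<le> ennreal L * ennpowr (ennreal (dens k * ?m)) (1 / p)"
      by (rule suff) (use dens_pos[of k] m in auto)
    also have "ennreal (dens k * ?m) = (\<integral>\<^sup>+x\<in>S. ennreal (\<sigma> x) \<partial>unit_space)"
      using dens_pos[of k] by (subst nn_integral_ring[OF ring tree_sets[OF S]]) (simp add: ennreal_mult)
    finally show ?thesis .
  qed
qed

text \<open>
  The test function is \<open>f = g(t\<^sup>k) \<sigma>\<close> on ring \<open>k\<close>. Using only the corner of level \<open>k\<close> on ring \<open>k\<close>, the powers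
  of 2 in the maximal function cancel against those in \<open>u\<close>, and the two norms become the sums of
  \<open>near_extremal_discrete\<close>.
\<close>

lemma norm_lower_bound:
  assumes ne: "near_extremal p q g F E J"
  shows "ennreal (L * t\<^sup>2 * J powr (1 / q) / E powr (1 / p)) \<le> frac_max_norm unit_space dyadic_tree \<alpha> p v q u"
  unfolding frac_max_norm_def
proof (rule Inf_greatest)
  fix K assume "K \<in> {K. \<forall>f\<in>wLp unit_space v p. wnorm unit_space u q (frac_max unit_space dyadic_tree \<alpha> f) \<le> K * wnorm unit_space v p (\<lambda>x. ennreal \<bar>f x\<bar>)}"
  then have K: "\<And>f. f \<in> wLp unit_space v p \<Longrightarrow> wnorm unit_space u q (frac_max unit_space dyadic_tree \<alpha> f) \<le> K * wnorm unit_space v p (\<lambda>x. ennreal \<bar>f x\<bar>)"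
    by simp
  have tk: "0 < t ^ k" "t ^ k \<le> 1" for k using t t0 by (auto simp: power_le_one)
  have gpos: "0 < g (t ^ k)" for k using ne tk[of k] unfolding near_extremal_def by auto
  have E0: "0 < E" and J0: "0 < J" using ne unfolding near_extremal_def by auto
  note disc = near_extremal_discrete[OF ne p q t0 t(2)]
  define f where "f x = g (t ^ ring_index x) * dens (ring_index x)" for x
  have fpos: "0 < f x" for x using gpos dens_pos by (simp add: f_def)
  have fm: "f \<in> borel_measurable unit_space"
    unfolding f_def[abs_def] by (rule measurable_ring_comp[of "\<lambda>k. g (t ^ k) * dens k"])
  have fint: "(\<integral>\<^sup>+x. ennpowr (ennreal \<bar>f x\<bar>) p * ennreal (v x) \<partial>unit_space) \<le> ennreal E"
  proof -
    have "(\<integral>\<^sup>+x. ennpowr (ennreal \<bar>f x\<bar>) p * ennreal (v x) \<partial>unit_space)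
       = (\<integral>\<^sup>+x\<in>{0<..(1 / 2) ^ 0}. ennreal (g (t ^ ring_index x) powr p * dens (ring_index x)) \<partial>unit_space)"
    proof (rule trans[OF nn_integral_unit_space_restrict], rule nn_integral_cong)
      fix x
      have "\<bar>f x\<bar> powr p * v x = g (t ^ ring_index x) powr p * (dens (ring_index x) powr p * dens (ring_index x) powr (1 - p))"
        using gpos[of "ring_index x"] dens_pos[of "ring_index x"] by (simp add: f_def abs_mult powr_mult)
      also have "dens (ring_index x) powr p * dens (ring_index x) powr (1 - p) = dens (ring_index x)"
        using dens_pos[of "ring_index x"] by (simp add: powr_add[symmetric])
      finally show "ennpowr (ennreal \<bar>f x\<bar>) p * ennreal (v x) * indicator {0<..(1 / 2) ^ 0} x
         = ennreal (g (t ^ ring_index x) powr p * dens (ring_index x)) * indicator {0<..(1 / 2) ^ 0} x"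
        by (simp add: ennreal_mult[symmetric])
    qed
    also have "\<dots> = (\<Sum>k. ennreal (g (t ^ (k + 0)) powr p * dens (k + 0)) * ennreal ((1 / 2) ^ Suc (k + 0)))"
      by (rule nn_integral_ring_index)
    also have "\<dots> = (\<Sum>k. ennreal (g (t ^ k) powr p * (t ^ k - t ^ Suc k)))"
    proof (intro suminf_cong)
      fix k
      have "ennreal (g (t ^ k) powr p * dens k) * ennreal ((1 / 2) ^ Suc k) = ennreal (g (t ^ k) powr p * (dens k * (1 / 2) ^ Suc k))"
        using dens_pos[of k] by (subst ennreal_mult[symmetric]) (auto simp: mult.assoc)
      then show "ennreal (g (t ^ (k + 0)) powr p * dens (k + 0)) * ennreal ((1 / 2) ^ Suc (k + 0)) = ennreal (g (t ^ k) powr p * (t ^ k - t ^ Suc k))"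
        by (simp only: dens_half add_0_right)
    qed
    also have "\<dots> \<le> ennreal E" by (rule disc(1))
    finally show ?thesis .
  qed
  have vnorm: "wnorm unit_space v p (\<lambda>x. ennreal \<bar>f x\<bar>) \<le> ennreal (E powr (1 / p))"
  proof -
    have "wnorm unit_space v p (\<lambda>x. ennreal \<bar>f x\<bar>) \<le> ennpowr (ennreal E) (1 / p)"
      unfolding wnorm_def using p by (intro ennpowr_mono fint) auto
    then show ?thesis using E0 by simp
  qed
  then have fL: "f \<in> wLp unit_space v p"
    unfolding wLp_def using fm by (auto intro: le_less_trans)
  define A where "A k = (\<Sum>j. ennreal (g (t ^ (k + j)) * (t ^ (k + j) - t ^ Suc (k + j))))" for k
  have intf: "(\<integral>\<^sup>+y\<in>{0<..(1 / 2) ^ k}. ennreal \<bar>f y\<bar> \<partial>unit_space) = A k" for k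
  proof -
    have "(\<integral>\<^sup>+y\<in>{0<..(1 / 2) ^ k}. ennreal \<bar>f y\<bar> \<partial>unit_space) = (\<integral>\<^sup>+y\<in>{0<..(1 / 2) ^ k}. ennreal (g (t ^ ring_index y) * dens (ring_index y)) \<partial>unit_space)"
      by (rule nn_integral_cong) (simp add: abs_of_pos[OF fpos], simp add: f_def)
    also have "\<dots> = (\<Sum>j. ennreal (g (t ^ (j + k)) * dens (j + k)) * ennreal ((1 / 2) ^ Suc (j + k)))"
      by (rule nn_integral_ring_index)
    also have "\<dots> = A k"
      unfolding A_def
    proof (intro suminf_cong)
      fix j
      have "ennreal (g (t ^ (j + k)) * dens (j + k)) * ennreal ((1 / 2) ^ Suc (j + k)) = ennreal (g (t ^ (j + k)) * (dens (j + k) * (1 / 2) ^ Suc (j + k)))"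
        using dens_pos[of "j + k"] gpos[of "j + k"] by (subst ennreal_mult[symmetric]) (auto simp: mult.assoc)
      then show "ennreal (g (t ^ (j + k)) * dens (j + k)) * ennreal ((1 / 2) ^ Suc (j + k)) = ennreal (g (t ^ (k + j)) * (t ^ (k + j) - t ^ Suc (k + j)))"
        by (simp only: dens_half add.commute[of j k])
    qed
    finally show ?thesis .
  qed
  have Mlow: "ennreal (2 powr ((1 - \<alpha>) * real (ring_index x))) * A (ring_index x) \<le> frac_max unit_space dyadic_tree \<alpha> f x"
    if x: "x \<in> space unit_space" for x
  proof -
    let ?Q = "{0<..(1 / 2) ^ ring_index x}"
    have "?Q \<in> {Q \<in> dyadic_tree. x \<in> Q}" using x ring_index_bounds[of x] corner_in_dyadic_tree by auto
    then have "ennreal (measure unit_space ?Q powr \<alpha> * (1 / measure unit_space ?Q)) * (\<integral>\<^sup>+y\<in>?Q. ennreal \<bar>f y\<bar> \<partial>unit_space) \<le> frac_max unit_space dyadic_tree \<alpha> f x"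
      unfolding frac_max_def by (rule SUP_upper)
    then show ?thesis by (simp only: intf measure_corner half_powr)
  qed
  have "ennreal (L powr q * (t powr (2 * q) * J)) \<le> (\<integral>\<^sup>+x. ennpowr (frac_max unit_space dyadic_tree \<alpha> f x) q * ennreal (u x) \<partial>unit_space)"
  proof -
    have "ennreal (L powr q * (t powr (2 * q) * J)) = ennreal (L powr q) * ennreal (t powr (2 * q) * J)"
      using J0 by (intro ennreal_mult) auto
    also have "\<dots> \<le> ennreal (L powr q) * (\<Sum>k. ennpowr (A k) q * ennreal ((t ^ k) powr (- q) * gap k))"
      unfolding A_def gap_def by (intro mult_left_mono disc(2)) auto
    also have "\<dots> = (\<Sum>k. ennreal (L powr q) * (ennpowr (A k) q * ennreal ((t ^ k) powr (- q) * gap k)))"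
      by (rule ennreal_suminf_cmult[symmetric])
    also have "\<dots> = (\<Sum>k. ennpowr (ennreal (2 powr ((1 - \<alpha>) * real (k + 0))) * A (k + 0)) q * ennreal (udens (k + 0)) * ennreal ((1 / 2) ^ Suc (k + 0)))"
    proof (intro suminf_cong)
      fix k
      define z where "z = 2 powr ((1 - \<alpha>) * real k)"
      have z: "0 < z" by (simp add: z_def)
      have hz: "height k = z * t ^ k" by (simp add: height_def z_def)
      have "z powr q * (udens k * (1 / 2) ^ Suc k) = L powr q * ((t ^ k) powr (- q) * gap k)"
      proof -
        have "height k powr (- q) = z powr (- q) * (t ^ k) powr (- q)"
          unfolding hz using z tk[of k] by (subst powr_mult) auto
        moreover have "z powr q * z powr (- q) = 1" using z by (simp add: powr_minus)
        ultimately show ?thesis unfolding udens_half by (simp add: mult_ac)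
      qed
      moreover have "ennreal (z powr q) * ennreal (udens k) * ennreal ((1 / 2) ^ Suc k) = ennreal (z powr q * (udens k * (1 / 2) ^ Suc k))"
      proof -
        have "ennreal (udens k) * ennreal ((1 / 2) ^ Suc k) = ennreal (udens k * (1 / 2) ^ Suc k)"
          using udens_pos[of k] by (intro ennreal_mult[symmetric]) auto
        moreover have "ennreal (z powr q) * ennreal (udens k * (1 / 2) ^ Suc k) = ennreal (z powr q * (udens k * (1 / 2) ^ Suc k))"
          using udens_pos[of k] by (intro ennreal_mult[symmetric]) auto
        ultimately show ?thesis by (simp only: mult.assoc)
      qed
      moreover have "ennreal (L powr q * ((t ^ k) powr (- q) * gap k)) = ennreal (L powr q) * ennreal ((t ^ k) powr (- q) * gap k)"
        using gap_pos[of k] by (intro ennreal_mult) auto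
      ultimately have "ennreal (z powr q) * ennreal (udens k) * ennreal ((1 / 2) ^ Suc k) = ennreal (L powr q) * ennreal ((t ^ k) powr (- q) * gap k)"
        by simp
      moreover have "ennpowr (ennreal z * A k) q = ennreal (z powr q) * ennpowr (A k) q"
        using z q0 by (simp add: ennpowr_mult)
      ultimately have "ennreal (L powr q) * (ennpowr (A k) q * ennreal ((t ^ k) powr (- q) * gap k)) = ennpowr (ennreal z * A k) q * ennreal (udens k) * ennreal ((1 / 2) ^ Suc k)"
        by (simp only: mult_ac)
      then show "ennreal (L powr q) * (ennpowr (A k) q * ennreal ((t ^ k) powr (- q) * gap k))
         = ennpowr (ennreal (2 powr ((1 - \<alpha>) * real (k + 0))) * A (k + 0)) q * ennreal (udens (k + 0)) * ennreal ((1 / 2) ^ Suc (k + 0))"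
        by (simp only: z_def add_0_right)
    qed
    also have "\<dots> = (\<integral>\<^sup>+x\<in>{0<..(1 / 2) ^ 0}. (ennpowr (ennreal (2 powr ((1 - \<alpha>) * real (ring_index x))) * A (ring_index x)) q * ennreal (udens (ring_index x))) \<partial>unit_space)"
      by (rule nn_integral_ring_index[symmetric])
    also have "\<dots> \<le> (\<integral>\<^sup>+x. ennpowr (frac_max unit_space dyadic_tree \<alpha> f x) q * ennreal (u x) \<partial>unit_space)"
    proof (rule nn_integral_mono)
      fix x assume x: "x \<in> space unit_space"
      have "ennpowr (ennreal (2 powr ((1 - \<alpha>) * real (ring_index x))) * A (ring_index x)) q \<le> ennpowr (frac_max unit_space dyadic_tree \<alpha> f x) q"
        using q0 by (intro ennpowr_mono Mlow x) auto
      then have "ennpowr (ennreal (2 powr ((1 - \<alpha>) * real (ring_index x))) * A (ring_index x)) q * ennreal (udens (ring_index x)) \<le> ennpowr (frac_max unit_space dyadic_tree \<alpha> f x) q * ennreal (u x)"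
        by (rule mult_right_mono) simp
      then show "ennpowr (ennreal (2 powr ((1 - \<alpha>) * real (ring_index x))) * A (ring_index x)) q * ennreal (udens (ring_index x)) * indicator {0<..(1 / 2) ^ 0} x
         \<le> ennpowr (frac_max unit_space dyadic_tree \<alpha> f x) q * ennreal (u x)"
        using x by simp
    qed
    finally show ?thesis .
  qed
  then have "ennpowr (ennreal (L powr q * (t powr (2 * q) * J))) (1 / q) \<le> wnorm unit_space u q (frac_max unit_space dyadic_tree \<alpha> f)"
    unfolding wnorm_def using q0 by (intro ennpowr_mono) auto
  also have "ennpowr (ennreal (L powr q * (t powr (2 * q) * J))) (1 / q) = ennreal (L * t\<^sup>2 * J powr (1 / q))"
    using q0 L t0 J0 by (simp add: powr_mult powr_powr mult.assoc powr_numeral)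
  also have "wnorm unit_space u q (frac_max unit_space dyadic_tree \<alpha> f) \<le> K * wnorm unit_space v p (\<lambda>x. ennreal \<bar>f x\<bar>)"
    by (rule K[OF fL])
  also have "\<dots> \<le> K * ennreal (E powr (1 / p))" by (intro mult_left_mono vnorm) auto
  finally have main: "ennreal (L * t\<^sup>2 * J powr (1 / q)) \<le> K * ennreal (E powr (1 / p))" .
  have "ennreal (L * t\<^sup>2 * J powr (1 / q) / E powr (1 / p)) = ennreal (L * t\<^sup>2 * J powr (1 / q)) / ennreal (E powr (1 / p))"
    using L t0 E0 by (intro divide_ennreal[symmetric]) auto
  also have "\<dots> \<le> K" using E0 main by (intro divide_le_posI_ennreal) (auto simp: mult.commute)
  finally show "ennreal (L * t\<^sup>2 * J powr (1 / q) / E powr (1 / p)) \<le> K" .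
qed

end

text \<open>
  First a nearly extremal pair is fixed, then \<open>t\<close> is taken close to 1, depending on it.
\<close>

lemma frac_max_norm_sharp:
  fixes p q \<alpha> L c :: real
  assumes p: "1 < p" and q: "p \<le> q" and a: "0 \<le> \<alpha>" "\<alpha> < 1" "1 / p - 1 / q \<le> \<alpha>" and L: "0 < L" and c: "c < C_const p q * L"
  shows "\<exists>(M :: real measure) T u v.
               prob_space M \<and> is_tree M T \<and>
               weight M u \<and> weight M v \<and> weight M (\<lambda>x. v x powr (1 - conj_exp p)) \<and>
               testing_condition M T \<alpha> p q L u v \<and>
               ennreal c < frac_max_norm M T \<alpha> p v q u"
proof -
  \<comment> \<open>negative bounds reduce to 0, because \<open>ennreal\<close> truncates them\<close>
  define c' where "c' = max c 0"
  have C0: "0 < C_const p q" by (rule C_const_pos[OF p q])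
  have c': "0 \<le> c'" "c' / L < C_const p q" using c L C0 by (auto simp: c'_def max_def field_simps)
  obtain g F E J where ne: "near_extremal p q g F E J" and EJ: "c' / L * E powr (1 / p) < J powr (1 / q)"
    using near_extremal_exists[OF p q c'(2)] by metis
  have E0: "0 < E" using ne by (simp add: near_extremal_def)
  have "c' < L * 1\<^sup>2 * J powr (1 / q) / E powr (1 / p)"
    using EJ L E0 by (simp add: field_simps)
  moreover have "((\<lambda>t. L * t\<^sup>2 * J powr (1 / q) / E powr (1 / p)) \<longlongrightarrow> L * 1\<^sup>2 * J powr (1 / q) / E powr (1 / p)) (at_left 1)"
    using E0 by (intro tendsto_intros) auto
  ultimately have e1: "eventually (\<lambda>t. c' < L * t\<^sup>2 * J powr (1 / q) / E powr (1 / p)) (at_left 1)"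
    by (intro order_tendstoD(1))
  have "((\<lambda>t. 2 powr q * (q / p) * (1 - t)) \<longlongrightarrow> 2 powr q * (q / p) * (1 - 1)) (at_left 1)"
    by (intro tendsto_intros)
  then have e2: "eventually (\<lambda>t. 2 powr q * (q / p) * (1 - t) < 1) (at_left 1)"
    by (rule order_tendstoD(2)) simp
  have "2 powr 0 < 2 powr (1 - \<alpha>)" using a by (intro powr_less_mono) auto
  moreover have "((\<lambda>t. 2 powr (1 - \<alpha>) * t) \<longlongrightarrow> 2 powr (1 - \<alpha>) * 1) (at_left 1)"
    by (intro tendsto_intros)
  ultimately have e3: "eventually (\<lambda>t. 1 < 2 powr (1 - \<alpha>) * t) (at_left 1)"
    by (intro order_tendstoD(1)) auto
  have e4: "eventually (\<lambda>t. t \<in> {1 / 2<..<1}) (at_left (1::real))"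
    by (rule eventually_at_left_real) simp
  have "eventually (\<lambda>t. (c' < L * t\<^sup>2 * J powr (1 / q) / E powr (1 / p) \<and> 2 powr q * (q / p) * (1 - t) < 1) \<and> (1 < 2 powr (1 - \<alpha>) * t \<and> t \<in> {1 / 2<..<1})) (at_left 1)"
    by (intro eventually_conj e1 e2 e3 e4)
  then obtain t where good: "c' < L * t\<^sup>2 * J powr (1 / q) / E powr (1 / p)" "2 powr q * (q / p) * (1 - t) < 1" "1 < 2 powr (1 - \<alpha>) * t" "1 / 2 < t" "t < 1"
    using eventually_happens[of _ "at_left (1::real)"] by (auto simp: trivial_limit_at_left_real)
  interpret sharp_example p q \<alpha> L t
    by unfold_locales (use p q a L good in auto)
  have "ennreal c \<le> ennreal c'" by (intro ennreal_leI) (simp add: c'_def)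
  also have "\<dots> < ennreal (L * t\<^sup>2 * J powr (1 / q) / E powr (1 / p))"
    using good(1) c' by (intro ennreal_lessI) auto
  also have "\<dots> \<le> frac_max_norm unit_space dyadic_tree \<alpha> p v q u" by (rule norm_lower_bound[OF ne])
  finally have "ennreal c < frac_max_norm unit_space dyadic_tree \<alpha> p v q u" .
  moreover have "weight unit_space (\<lambda>x. v x powr (1 - conj_exp p))" unfolding v_dual by (rule weight_sigma)
  ultimately show ?thesis
    using prob_space_unit_space is_tree_dyadic weight_u weight_v testing by blast
qed

section \<open>The sharp testing theorem\<close>

theorem theorem1p2:
  fixes p q \<alpha> L :: real
  assumes "1 < p" and "p \<le> q" and "0 \<le> \<alpha>" and "\<alpha> < 1" and "0 < L"
  shows "(\<forall>(M :: 'a measure) T u v.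
            prob_space M \<longrightarrow> is_tree M T \<longrightarrow>
            weight M u \<longrightarrow> weight M v \<longrightarrow> weight M (\<lambda>x. v x powr (1 - conj_exp p)) \<longrightarrow>
            testing_condition M T \<alpha> p q L u v \<longrightarrow>
            frac_max_norm M T \<alpha> p v q u \<le> ennreal (C_const p q * L)) \<and>
         (1 / p - 1 / q \<le> \<alpha> \<longrightarrow>
          (\<forall>c :: real. c < C_const p q * L \<longrightarrow>
            (\<exists>(M :: real measure) T u v.
               prob_space M \<and> is_tree M T \<and>
               weight M u \<and> weight M v \<and> weight M (\<lambda>x. v x powr (1 - conj_exp p)) \<and>
               testing_condition M T \<alpha> p q L u v \<and>
               ennreal c < frac_max_norm M T \<alpha> p v q u)))"
  using frac_max_norm_upper_bound[OF _ _ assms(1,2,5)] frac_max_norm_sharp[OF assms(1-4) _ assms(5)]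
  by auto

end
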